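(* Let $0<\alpha\le1$ and let $a$ be a complex-valued symbol on $[0,1]\times[0,2\pi]$ with Fourier series $a(x,t)=\sum_{k\in\mathbb{Z}}\hat a_k(x)e^{ikt}$ such that $t\mapsto a(x,t)$ is in $C^{1+\alpha}([0,2\pi])$ for each $x$ and $x\mapsto a(x,t)$ is in $C^{1+\lceil1/\alpha\rceil}([0,1])$ for each $t$. Suppose moreover that $$\sum_{k\in\mathbb{Z}}|k|^{1+1/\alpha}\|\hat a_k\|_\infty<\infty\qquad\text{and}\qquad\sum_{k\in\mathbb{Z}}\|\partial_x\hat a_k\|_{\varepsilon}<\infty$$ for some $\varepsilon\in(0,1]$, where $\|\cdot\|_\varepsilon$ is the Hölder norm of exponent $\varepsilon$ on $[0,1]$. If $\operatorname{Re}(a)>0$ on $[0,1]\times[0,2\pi]$, then $$\lim_{n\to\infty}\frac{\det T_n(a)}{G(a)^{n+1}}=\exp\left(\tfrac12\{e(a;0)-e(a;1)+E(a;0)+E(a;1)\}\right).$$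
   Context: For a function $a(x,t)$ on $[0,1]\times[0,2\pi]$ with Fourier series $a(x,t)=\sum_{k\in\mathbb{Z}}\hat a_k(x)e^{ikt}$, where $\hat a_k(x)=\frac1{2\pi}\int_0^{2\pi}a(x,t)e^{-ikt}\,dt$, the Kac-Murdock-Szegő (KMS) matrix with symbol $a$ is the $(n+1)\times(n+1)$ matrix $$T_n(a)=\left[\hat a_{j-i}\left(\frac{i+j}{2n+2}\right)\right]_{i,j=0}^n .$$ Here $\|\hat a_k\|_\infty=\sup_{x\in[0,1]}|\hat a_k(x)|$. $C^{1+\alpha}$ denotes the space of $C^1$ functions with $\alpha$-Hölder first derivative, and $C^m$, for an integer $m$, the space of $m$ times continuously differentiable functions. With $\log$ the principal branch (well defined since $\operatorname{Re}(a)>0$) and $\widehat{(\log a)}_k(x)=\frac1{2\pi}\int_0^{2\pi}\log a(x,t)\,e^{-ikt}\,dt$, set $$G(a)=\exp\left[\frac1{2\pi}\int_0^1\int_0^{2\pi}\log a(x,t)\,dt\,dx\right],\qquad e(a;x)=\frac1{2\pi}\int_0^{2\pi}\log a(x,t)\,dt,$$ $$E(a;x)=\sum_{k=1}^\infty k\,\widehat{(\log a)}_k(x)\,\widehat{(\log a)}_{-k}(x).$$ *)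

theory Defs
  imports
    "HOL-Analysis.Analysis"
    "Jordan_Normal_Form.Determinant"
begin

text \<open>A symbol is a function \<open>a :: real \<Rightarrow> real \<Rightarrow> complex\<close>, of which only the values \<open>a x t\<close> with
  \<open>x \<in> {0..1}\<close> and \<open>t \<in> {0..2 * pi}\<close> matter. Derivatives on a closed interval are taken
  within the interval, hence are one-sided at the end points.\<close>

text \<open>The norms take values in \<^typ>\<open>ennreal\<close>, so that a supremum over an unbounded set is
  \<open>\<infinity>\<close> and finiteness of a series of norms includes finiteness of its terms.\<close>

definition sup_norm_on :: "'a set \<Rightarrow> ('a \<Rightarrow> 'b::real_normed_vector) \<Rightarrow> ennreal" where
  "sup_norm_on S f = (SUP x\<in>S. ennreal (norm (f x)))"

definition holder_seminorm_on ::
    "real \<Rightarrow> 'a::metric_space set \<Rightarrow> ('a \<Rightarrow> 'b::real_normed_vector) \<Rightarrow> ennreal" where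
  "holder_seminorm_on \<beta> S f =
     (SUP (x, y)\<in>{(x, y). x \<in> S \<and> y \<in> S \<and> x \<noteq> y}.
        ennreal (norm (f x - f y) / dist x y powr \<beta>))"

definition holder_norm_on ::
    "real \<Rightarrow> 'a::metric_space set \<Rightarrow> ('a \<Rightarrow> 'b::real_normed_vector) \<Rightarrow> ennreal" where
  "holder_norm_on \<beta> S f = sup_norm_on S f + holder_seminorm_on \<beta> S f"

definition C_diff_on :: "nat \<Rightarrow> real set \<Rightarrow> (real \<Rightarrow> 'a::real_normed_vector) \<Rightarrow> bool" where
  "C_diff_on m S f \<longleftrightarrow>
     (\<exists>D :: nat \<Rightarrow> real \<Rightarrow> 'a.
        D 0 = f \<and>
        (\<forall>j<m. \<forall>x\<in>S. (D j has_vector_derivative D (Suc j) x) (at x within S)) \<and>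
        continuous_on S (D m))"

definition C1_holder_on :: "real \<Rightarrow> real set \<Rightarrow> (real \<Rightarrow> 'a::real_normed_vector) \<Rightarrow> bool" where
  "C1_holder_on \<beta> S f \<longleftrightarrow>
     (\<exists>f'. (\<forall>x\<in>S. (f has_vector_derivative f' x) (at x within S)) \<and>
           continuous_on S f' \<and> holder_seminorm_on \<beta> S f' < \<infinity>)"

definition fourier_coeff :: "(real \<Rightarrow> real \<Rightarrow> complex) \<Rightarrow> int \<Rightarrow> real \<Rightarrow> complex" where
  "fourier_coeff a k x =
     1 / (2 * pi) * integral {0..2 * pi} (\<lambda>t. a x t * exp (- \<i> * of_int k * of_real t))"

definition fourier_coeff_deriv :: "(real \<Rightarrow> real \<Rightarrow> complex) \<Rightarrow> int \<Rightarrow> real \<Rightarrow> complex" where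
  "fourier_coeff_deriv a k x = vector_derivative (fourier_coeff a k) (at x within {0..1})"

definition KMS_matrix :: "nat \<Rightarrow> (real \<Rightarrow> real \<Rightarrow> complex) \<Rightarrow> complex mat" where
  "KMS_matrix n a =
     Matrix.mat (n + 1) (n + 1)
       (\<lambda>(i, j). fourier_coeff a (int j - int i) (real (i + j) / real (2 * n + 2)))"

definition log_symbol :: "(real \<Rightarrow> real \<Rightarrow> complex) \<Rightarrow> real \<Rightarrow> real \<Rightarrow> complex" where
  "log_symbol a x t = Ln (a x t)"

definition G_const :: "(real \<Rightarrow> real \<Rightarrow> complex) \<Rightarrow> complex" where
  "G_const a =
     exp (1 / (2 * pi) * integral {0..1} (\<lambda>x. integral {0..2 * pi} (\<lambda>t. log_symbol a x t)))"

definition e_const :: "(real \<Rightarrow> real \<Rightarrow> complex) \<Rightarrow> real \<Rightarrow> complex" where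
  "e_const a x = 1 / (2 * pi) * integral {0..2 * pi} (\<lambda>t. log_symbol a x t)"

definition E_const :: "(real \<Rightarrow> real \<Rightarrow> complex) \<Rightarrow> real \<Rightarrow> complex" where
  "E_const a x =
     (\<Sum>k. of_nat (Suc k) * fourier_coeff (log_symbol a) (int (Suc k)) x
                          * fourier_coeff (log_symbol a) (- int (Suc k)) x)"

end

theory Submission imports Defs "HOL-Complex_Analysis.Complex_Analysis" "HOL-Real_Asymp.Real_Asymp"
begin

text \<open>
  Write \<open>log a = u + v\<close>, where \<open>u\<close> carries the nonnegative and \<open>v\<close> the negative frequencies, and put
  \<open>F\<^sub>n(s) = det T\<^sub>n(exp(u) exp(s v)) / \<Prod>\<^sub>i exp(u\<^sub>0(i/(n+1)))\<close>. Multiplying the matrix by the triangular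
  matrices of \<open>exp(-u)\<close> and \<open>exp(-s v)\<close>, whose determinants are explicit, gives the identity plus a matrix
  whose entrywise \<open>\<ell>\<^sup>1\<close>-norm is bounded in \<open>n\<close>, so the entire functions \<open>F\<^sub>n\<close> are locally bounded.
  For small \<open>s\<close> the matrix \<open>T\<^sub>n(exp(u) exp(s v))\<close> is stably invertible, and \<open>F\<^sub>n'/F\<^sub>n\<close> is the trace of its inverse times
  \<open>T\<^sub>n(v exp(u) exp(s v))\<close>. Replacing the latter by the symmetrized product of \<open>T\<^sub>n(v)\<close> and
  \<open>T\<^sub>n(exp(u) exp(s v))\<close> leaves an \<open>o(1)\<close> error from the \<open>x\<close>-dependence and two terms located at the corners
  \<open>x = 0\<close> and \<open>x = 1\<close>, so \<open>F\<^sub>n'/F\<^sub>n \<longlonglongrightarrow> c = (E(a;0) + E(a;1))/2\<close>. By Montel's theorem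
  \<open>F\<^sub>n(s) \<longlonglongrightarrow> exp(c s)\<close> for every \<open>s\<close>, in particular for \<open>s = 1\<close>. The terms in \<open>e(a;x)\<close> come from
  comparing \<open>\<Sum>\<^sub>i u\<^sub>0(i/(n+1))\<close> with \<open>(n+1) \<integral> u\<^sub>0\<close>.
\<close>

subsection \<open>Bounded continuous functions as an algebra\<close>

text \<open>The obstacle is the range of \<open>s\<close>. A bound on the inverse of
  \<open>kms n (b s)\<close> uniform in \<open>n\<close> comes from perturbing the triangular matrix
  at \<open>s = 0\<close>, so the logarithmic derivative is computed only near 0, while the value at
  \<open>s = 1\<close> is wanted. Bounding determinants needs no inverse:
  \<open>exp (- u) * b s = Y s\<close> and \<open>Y s * Y (- s) = 1\<close> hold for all
  \<open>s\<close>, and their matrix versions fail only by errors of bounded entry norm. Hence the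
  detour through entire functions. Scaling \<open>v\<close> alone makes the start trivial:
  \<open>F n 0 = 1\<close>, and as \<open>v\<close> has no zeroth coefficient,
  \<open>kms n (Y s)\<close> has determinant 1 and \<open>kms n v\<close> has trace 0. A single
  product \<open>kms n v * kms n (b s)\<close> differs from \<open>kms n (v * b s)\<close> by a
  sampling error of order 1/n in each of \<open>n + 1\<close> rows, so of order 1 in the trace. The
  two orders of multiplication have essentially opposite first-order errors; this is why the product
  is symmetrized. Coefficient sequences whose entries are functions of \<open>x\<close> put both
  variables into one commutative Banach algebra, where \<open>exp\<close> is defined and both
  partial derivatives are closed derivations.\<close>

instantiation bcontfun :: (topological_space, real_normed_field) comm_ring_1
begin

definition "1 = const_bcontfun (1 :: 'b)"

definition "f * g = Bcontfun (\<lambda>x. apply_bcontfun f x * apply_bcontfun g x)"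

lemma apply_bcontfun_times [simp]:
  "apply_bcontfun (f * g) x = apply_bcontfun f x * apply_bcontfun g (x :: 'a)"
proof -
  have "(\<lambda>x. apply_bcontfun f x * apply_bcontfun g x) \<in> bcontfun"
    by (rule bcontfun_normI[where b = "norm f * norm g"])
      (auto intro!: continuous_intros mult_mono norm_bounded simp: norm_mult)
  then show ?thesis
    by (simp add: times_bcontfun_def Bcontfun_inverse)
qed

lemma apply_bcontfun_one [simp]: "apply_bcontfun 1 x = (1 :: 'b)"
  by (simp add: one_bcontfun_def)

instance
proof
  have "apply_bcontfun (0 :: 'a \<Rightarrow>\<^sub>C 'b) undefined \<noteq> apply_bcontfun 1 undefined"
    by simp
  then show "(0 :: 'a \<Rightarrow>\<^sub>C 'b) \<noteq> 1"
    by metis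
qed (auto intro!: bcontfun_eqI simp: algebra_simps)

end

text \<open>The convolution product of \<open>wiener\<close> asks its coefficients for a
  submultiplicative norm with \<open>norm 1 = 1\<close>; \<open>exp\<close> of symbols rests on
  this.\<close>

instance bcontfun :: (topological_space, real_normed_field) real_normed_algebra_1
proof
  fix f g :: "'a \<Rightarrow>\<^sub>C 'b"
  show "norm (f * g) \<le> norm f * norm g"
    by (rule norm_bound) (auto simp: norm_mult intro!: mult_mono norm_bounded)
  show "norm (1 :: 'a \<Rightarrow>\<^sub>C 'b) = 1"
    using norm_bound[of "1 :: 'a \<Rightarrow>\<^sub>C 'b" 1] norm_bounded[of "1 :: 'a \<Rightarrow>\<^sub>C 'b" undefined]
    by (auto intro: antisym)
qed (auto intro!: bcontfun_eqI)

instance bcontfun :: (metric_space, banach) banach ..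

subsection \<open>The Wiener algebra\<close>

text \<open>Absolutely convergent Fourier series with coefficients in a normed space, held as their
  coefficient sequences in l^1. The variable \<open>t\<close> is absent until \<open>ev\<close>
  evaluates the series.\<close>

typedef (overloaded) 'b wiener =
  "{f :: int \<Rightarrow> 'b :: real_normed_vector. (\<lambda>k. norm (f k)) summable_on UNIV}"
  morphisms wcoeff Wiener
  by (rule exI[of _ "\<lambda>_. 0"]) auto

setup_lifting type_definition_wiener

lemma wcoeff_summable [simp, intro]: "(\<lambda>k. norm (wcoeff f k)) summable_on UNIV"
  using wcoeff[of f] by simp

lemma wiener_eqI: "(\<And>k. wcoeff f k = wcoeff g k) \<Longrightarrow> f = g"
  by (metis wcoeff_inject ext)

instantiation wiener :: (real_normed_vector) real_vector
begin

lift_definition zero_wiener :: "'a wiener" is "\<lambda>_. 0" by simp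

lift_definition uminus_wiener :: "'a wiener \<Rightarrow> 'a wiener" is "\<lambda>f k. - f k" by simp

lift_definition plus_wiener :: "'a wiener \<Rightarrow> 'a wiener \<Rightarrow> 'a wiener" is "\<lambda>f g k. f k + g k"
proof -
  fix f g :: "int \<Rightarrow> 'a"
  assume "(\<lambda>k. norm (f k)) summable_on UNIV" "(\<lambda>k. norm (g k)) summable_on UNIV"
  from summable_on_add[OF this] show "(\<lambda>k. norm (f k + g k)) summable_on UNIV"
    by (rule summable_on_comparison_test) (auto intro: norm_triangle_ineq)
qed

lift_definition minus_wiener :: "'a wiener \<Rightarrow> 'a wiener \<Rightarrow> 'a wiener" is "\<lambda>f g k. f k - g k"
proof -
  fix f g :: "int \<Rightarrow> 'a"
  assume "(\<lambda>k. norm (f k)) summable_on UNIV" "(\<lambda>k. norm (g k)) summable_on UNIV"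
  from summable_on_add[OF this] show "(\<lambda>k. norm (f k - g k)) summable_on UNIV"
    by (rule summable_on_comparison_test) (auto intro: norm_triangle_ineq4)
qed

lift_definition scaleR_wiener :: "real \<Rightarrow> 'a wiener \<Rightarrow> 'a wiener" is "\<lambda>c f k. c *\<^sub>R f k"
  by (simp add: summable_on_cmult_right)

lemmas wcoeff_simps [simp] = zero_wiener.rep_eq uminus_wiener.rep_eq plus_wiener.rep_eq
  minus_wiener.rep_eq scaleR_wiener.rep_eq

instance
  by standard (auto intro!: wiener_eqI simp: algebra_simps)

end

instantiation wiener :: (real_normed_vector) real_normed_vector
begin

definition norm_wiener :: "'a wiener \<Rightarrow> real" where
  "norm_wiener f = (\<Sum>\<^sub>\<infinity>k. norm (wcoeff f k))"

definition dist_wiener :: "'a wiener \<Rightarrow> 'a wiener \<Rightarrow> real" where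
  "dist_wiener f g = norm (f - g)"

definition sgn_wiener :: "'a wiener \<Rightarrow> 'a wiener" where
  "sgn_wiener f = f /\<^sub>R norm f"

definition uniformity_wiener :: "('a wiener \<times> 'a wiener) filter" where
  "uniformity_wiener = (INF e\<in>{0<..}. principal {(f, g :: 'a wiener). dist f g < e})"

definition open_wiener :: "'a wiener set \<Rightarrow> bool" where
  "open_wiener S = (\<forall>f\<in>S. \<forall>\<^sub>F (f', g) in uniformity. f' = f \<longrightarrow> g \<in> S)"

lemma norm_wcoeff_le: "norm (wcoeff f k) \<le> norm (f :: 'a wiener)"
  using finite_sum_le_infsum[of "\<lambda>k. norm (wcoeff f k)" UNIV "{k}"] by (simp add: norm_wiener_def)

instance
proof
  fix f g :: "'a wiener" and a b :: real
  show "norm f = 0 \<longleftrightarrow> f = 0"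
  proof
    assume "norm f = 0"
    then show "f = 0"
      using norm_wcoeff_le[of f] by (intro wiener_eqI) (simp add: norm_le_zero_iff)
  qed (simp add: norm_wiener_def)
  have "norm (f + g) \<le> (\<Sum>\<^sub>\<infinity>k. norm (wcoeff f k) + norm (wcoeff g k))"
    unfolding norm_wiener_def
    using wcoeff_summable[of "f + g"]
    by (intro infsum_mono) (auto intro: summable_on_add norm_triangle_ineq)
  also have "\<dots> = norm f + norm g"
    unfolding norm_wiener_def by (rule infsum_add) auto
  finally show "norm (f + g) \<le> norm f + norm g" .
  show "norm (a *\<^sub>R f) = \<bar>a\<bar> * norm f"
    by (simp add: norm_wiener_def infsum_cmult_right')
qed (auto simp: dist_wiener_def sgn_wiener_def uniformity_wiener_def open_wiener_def)

end

lemma has_sum_norm_wcoeff: "((\<lambda>k. norm (wcoeff f k)) has_sum norm f) UNIV"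
  by (simp add: norm_wiener_def)

lemma wiener_normI:
  assumes "\<And>F. finite F \<Longrightarrow> (\<Sum>k\<in>F. norm (f k)) \<le> c"
  obtains g where "wcoeff g = f" "norm g \<le> c"
proof -
  have *: "(\<lambda>k. norm (f k)) summable_on UNIV"
    by (rule nonneg_bdd_above_summable_on) (auto intro!: bdd_aboveI[of _ c] assms)
  then have "wcoeff (Wiener f) = f"
    by (simp add: Wiener_inverse)
  moreover have "(\<Sum>\<^sub>\<infinity>k. norm (f k)) \<le> c"
    by (rule infsum_le_finite_sums[OF *]) (use assms in auto)
  ultimately show ?thesis
    using that[of "Wiener f"] by (simp add: norm_wiener_def)
qed

lemma bounded_linear_wcoeff: "bounded_linear (\<lambda>f. wcoeff f k)"
  by (rule bounded_linear_intro[of _ 1]) (auto simp: norm_wcoeff_le)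

instance wiener :: (banach) banach
proof
  fix X :: "nat \<Rightarrow> 'a wiener"
  assume X: "Cauchy X"
  have "Cauchy (\<lambda>n. wcoeff (X n) k)" for k
    using bounded_linear.Cauchy[OF bounded_linear_wcoeff X] .
  then have "\<exists>l. (\<lambda>n. wcoeff (X n) k) \<longlonglongrightarrow> l" for k
    by (simp add: Cauchy_convergent_iff convergent_def)
  then obtain l where l: "\<And>k. (\<lambda>n. wcoeff (X n) k) \<longlonglongrightarrow> l k"
    by metis
  have *: "\<exists>N. \<forall>n\<ge>N. \<forall>F. finite F \<longrightarrow> (\<Sum>k\<in>F. norm (wcoeff (X n) k - l k)) \<le> e" if "e > 0" for e
  proof -
    obtain N where N: "\<And>m n. m \<ge> N \<Longrightarrow> n \<ge> N \<Longrightarrow> dist (X n) (X m) < e"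
      using X \<open>e > 0\<close> unfolding Cauchy_def by metis
    have "(\<Sum>k\<in>F. norm (wcoeff (X n) k - l k)) \<le> e" if "n \<ge> N" "finite F" for n F
    proof (rule LIMSEQ_le_const2)
      show "(\<lambda>m. \<Sum>k\<in>F. norm (wcoeff (X n) k - wcoeff (X m) k)) \<longlonglongrightarrow>
          (\<Sum>k\<in>F. norm (wcoeff (X n) k - l k))"
        by (intro tendsto_intros l)
      have "(\<Sum>k\<in>F. norm (wcoeff (X n) k - wcoeff (X m) k)) \<le> e" if "m \<ge> N" for m
      proof -
        have "(\<Sum>k\<in>F. norm (wcoeff (X n) k - wcoeff (X m) k)) \<le> norm (X n - X m)"
          unfolding norm_wiener_def
          using finite_sum_le_infsum[OF wcoeff_summable[of "X n - X m"], of F] \<open>finite F\<close>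
          by simp
        also have "\<dots> \<le> e"
          using N[OF \<open>m \<ge> N\<close> \<open>n \<ge> N\<close>] by (simp add: dist_norm)
        finally show ?thesis .
      qed
      then show "\<exists>M. \<forall>m\<ge>M. (\<Sum>k\<in>F. norm (wcoeff (X n) k - wcoeff (X m) k)) \<le> e"
        by blast
    qed
    then show ?thesis by blast
  qed
  \<comment> \<open>The pointwise limit \<open>l\<close> is not yet known to be summable, but its
    distance to one \<open>X N\<close> is; so the limit is built as \<open>X N - D\<close>.\<close>
  obtain N where "\<And>F. finite F \<Longrightarrow> (\<Sum>k\<in>F. norm (wcoeff (X N) k - l k)) \<le> 1"
    using *[of 1] by auto
  then obtain D where D: "wcoeff D = (\<lambda>k. wcoeff (X N) k - l k)"
    by (rule wiener_normI)
  define L where "L = X N - D"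
  have L: "wcoeff L k = l k" for k
    by (simp add: L_def D)
  have "X \<longlonglongrightarrow> L"
  proof (rule metric_LIMSEQ_I)
    fix r :: real assume "r > 0"
    obtain M where M: "\<And>n F. n \<ge> M \<Longrightarrow> finite F \<Longrightarrow> (\<Sum>k\<in>F. norm (wcoeff (X n) k - l k)) \<le> r / 2"
      using *[of "r / 2"] \<open>r > 0\<close> by auto
    have "norm (X n - L) \<le> r / 2" if "n \<ge> M" for n
      unfolding norm_wiener_def
      by (rule infsum_le_finite_sums) (use M[OF that] L wcoeff_summable[of "X n - L"] in auto)
    then show "\<exists>M. \<forall>n\<ge>M. dist (X n) L < r"
      using \<open>r > 0\<close> by (intro exI[of _ M]) (force simp: dist_norm)
  qed
  then show "convergent X"
    by (auto simp: convergent_def)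
qed

lemma has_sum_product:
  fixes f g :: "_ \<Rightarrow> real"
  assumes "(f has_sum F) A" "(g has_sum G) B"
    and "\<And>x. x \<in> A \<Longrightarrow> f x \<ge> 0" "\<And>y. y \<in> B \<Longrightarrow> g y \<ge> 0"
  shows "((\<lambda>(x, y). f x * g y) has_sum (F * G)) (A \<times> B)"
proof (rule has_sum_SigmaI)
  show "((\<lambda>y. case (x, y) of (x, y) \<Rightarrow> f x * g y) has_sum f x * G) B" for x
    using has_sum_cmult_right[OF assms(2)] by simp
  show *: "((\<lambda>x. f x * G) has_sum F * G) A"
    by (rule has_sum_cmult_left[OF assms(1)])
  show "(\<lambda>(x, y). f x * g y) summable_on A \<times> B"
    by (rule summable_on_SigmaI[where g = "\<lambda>x. f x * G"])
      (use * assms has_sum_cmult_right[OF assms(2)] in \<open>auto simp: has_sum_imp_summable\<close>)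
qed

text \<open>The bijection sorts pairs \<open>(p, q)\<close> by their sum \<open>k = p + q\<close>;
  \<open>convolution_norms\<close> and \<open>ev_mult\<close> are obtained through it.\<close>

lemma has_sum_conv_pairs:
  fixes h :: "int \<times> int \<Rightarrow> 'a :: {comm_monoid_add, topological_space}"
  shows "((\<lambda>(k, p). h (p, k - p)) has_sum S) UNIV \<longleftrightarrow> (h has_sum S) UNIV"
proof -
  have "bij_betw (\<lambda>(k, p). (p, k - p)) (UNIV :: (int \<times> int) set) UNIV"
    by (rule bij_betwI[of _ _ _ "\<lambda>(p, q). (p + q, p)"]) auto
  from has_sum_reindex_bij_betw[OF this, of h S] show ?thesis
    by (simp add: case_prod_unfold)
qed

text \<open>Young's inequality for l^1 with equality, as all terms are nonnegative. It is the
  majorant behind every convolution below.\<close>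

lemma convolution_norms:
  "((\<lambda>(k, p). norm (wcoeff f p) * norm (wcoeff g (k - p))) has_sum (norm f * norm g)) (UNIV \<times> UNIV)"
  using has_sum_product[OF has_sum_norm_wcoeff[of f] has_sum_norm_wcoeff[of g]]
    has_sum_conv_pairs[of "\<lambda>(p, q). norm (wcoeff f p) * norm (wcoeff g q)"]
  by (simp add: case_prod_unfold)

lemma convolution_norm_summable:
  "(\<lambda>p. norm (wcoeff f p) * norm (wcoeff g (k - p))) summable_on UNIV"
  using summable_on_SigmaD1[OF has_sum_imp_summable[OF convolution_norms[of f g]], of k] by simp

lemma convolution_abs_summable:
  fixes f g :: "'a :: real_normed_algebra wiener"
  shows "(\<lambda>p. norm (wcoeff f p * wcoeff g (k - p))) summable_on UNIV"
  by (rule summable_on_comparison_test[OF convolution_norm_summable[of f g k]])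
    (auto intro: norm_mult_ineq)

instantiation wiener :: ("{banach, real_normed_algebra_1, comm_ring_1}") comm_ring_1
begin

lift_definition times_wiener :: "'a wiener \<Rightarrow> 'a wiener \<Rightarrow> 'a wiener" is
  "\<lambda>f g k. \<Sum>\<^sub>\<infinity>p. f p * g (k - p)"
proof -
  fix f g :: "int \<Rightarrow> 'a"
  assume "(\<lambda>k. norm (f k)) summable_on UNIV" "(\<lambda>k. norm (g k)) summable_on UNIV"
  then obtain f' g' where fg: "f = wcoeff f'" "g = wcoeff g'"
    by (metis wcoeff_cases mem_Collect_eq)
  have "(\<lambda>k. \<Sum>\<^sub>\<infinity>p. norm (f p) * norm (g (k - p))) summable_on UNIV"
    using summable_on_Sigma_banach[OF has_sum_imp_summable[OF convolution_norms[of f' g']]]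
    by (simp add: fg)
  then show "(\<lambda>k. norm (\<Sum>\<^sub>\<infinity>p. f p * g (k - p))) summable_on UNIV"
  proof (rule summable_on_comparison_test)
    fix k
    have "norm (\<Sum>\<^sub>\<infinity>p. f p * g (k - p)) \<le> (\<Sum>\<^sub>\<infinity>p. norm (f p * g (k - p)))"
      by (rule norm_infsum_bound) (simp add: fg convolution_abs_summable)
    also have "\<dots> \<le> (\<Sum>\<^sub>\<infinity>p. norm (f p) * norm (g (k - p)))"
      by (rule infsum_mono)
        (simp_all add: fg convolution_abs_summable convolution_norm_summable norm_mult_ineq)
    finally show "norm (\<Sum>\<^sub>\<infinity>p. f p * g (k - p)) \<le> (\<Sum>\<^sub>\<infinity>p. norm (f p) * norm (g (k - p)))" .
  qed simp
qed

lift_definition one_wiener :: "'a wiener" is "\<lambda>k. if k = 0 then 1 else 0"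
  by (rule finite_nonzero_values_imp_summable_on) auto

lemma wcoeff_mult: "((\<lambda>p. wcoeff f p * wcoeff g (k - p)) has_sum wcoeff (f * g) k) UNIV"
  for f g :: "'a wiener"
  using abs_summable_summable[OF convolution_abs_summable[of f g k]]
  by (simp add: times_wiener.rep_eq)

instance
proof
  fix f g h :: "'a wiener"
  show comm: "f * g = g * f" for f g :: "'a wiener"
  proof (rule wiener_eqI)
    fix k
    have "bij_betw (\<lambda>p. k - p) (UNIV :: int set) UNIV"
      by (rule bij_betwI[of _ _ _ "\<lambda>p. k - p"]) auto
    from has_sum_reindex_bij_betw[OF this, of "\<lambda>p. wcoeff f p * wcoeff g (k - p)"]
    have "((\<lambda>p. wcoeff g p * wcoeff f (k - p)) has_sum wcoeff (f * g) k) UNIV"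
      using wcoeff_mult[of f g k] by (simp add: mult.commute)
    then show "wcoeff (f * g) k = wcoeff (g * f) k"
      using wcoeff_mult[of g f k] has_sum_unique by blast
  qed
  show "f * g * h = f * (g * h)"
  proof (rule wiener_eqI)
    fix k
    let ?t = "\<lambda>q p. wcoeff f p * wcoeff g (q - p) * wcoeff h (k - q)"
    have bij: "bij_betw (\<lambda>q. q - p) (UNIV :: int set) UNIV" for p
      by (rule bij_betwI[of _ _ _ "\<lambda>q. q + p"]) auto
    \<comment> \<open>Fubini for the triple product: the last factor is at most
      \<open>norm h\<close>, the other two are covered by \<open>convolution_norms\<close>.\<close>
    have "(\<lambda>(q, p). norm h * (norm (wcoeff f p) * norm (wcoeff g (q - p)))) summable_on UNIV \<times> UNIV"
      using summable_on_cmult_right[OF has_sum_imp_summable[OF convolution_norms[of f g]]]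
      by (simp add: case_prod_unfold)
    then have "(\<lambda>x. norm (case x of (q, p) \<Rightarrow> ?t q p)) summable_on UNIV \<times> UNIV"
    proof (rule summable_on_comparison_test)
      fix x :: "int \<times> int"
      obtain q p where x: "x = (q, p)" by force
      have "norm (?t q p) \<le> norm (wcoeff f p) * norm (wcoeff g (q - p)) * norm (wcoeff h (k - q))"
        by (meson mult_right_mono norm_ge_zero norm_mult_ineq order_trans)
      also have "\<dots> \<le> norm (wcoeff f p) * norm (wcoeff g (q - p)) * norm h"
        by (intro mult_left_mono norm_wcoeff_le) auto
      finally show "norm (case x of (q, p) \<Rightarrow> ?t q p) \<le>
          (case x of (q, p) \<Rightarrow> norm h * (norm (wcoeff f p) * norm (wcoeff g (q - p))))"
        by (simp add: x mult_ac)
    qed simp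
    then have sm: "(\<lambda>(q, p). ?t q p) summable_on UNIV \<times> UNIV"
      by (rule abs_summable_summable)
    have "wcoeff (f * g * h) k = (\<Sum>\<^sub>\<infinity>q. (\<Sum>\<^sub>\<infinity>p. wcoeff f p * wcoeff g (q - p)) * wcoeff h (k - q))"
      by (simp add: times_wiener.rep_eq)
    also have "\<dots> = (\<Sum>\<^sub>\<infinity>q. \<Sum>\<^sub>\<infinity>p. ?t q p)"
      by (intro infsum_cong infsum_cmult_left[symmetric])
        (rule has_sum_imp_summable[OF wcoeff_mult])
    also have "\<dots> = (\<Sum>\<^sub>\<infinity>p. \<Sum>\<^sub>\<infinity>q. ?t q p)"
      by (rule infsum_swap_banach[OF sm])
    also have "\<dots> = (\<Sum>\<^sub>\<infinity>p. wcoeff f p * (\<Sum>\<^sub>\<infinity>q. wcoeff g (q - p) * wcoeff h (k - p - (q - p))))"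
    proof (rule infsum_cong)
      fix p
      have "(\<lambda>q. wcoeff g (q - p) * wcoeff h (k - p - (q - p))) summable_on UNIV"
        using has_sum_imp_summable[OF wcoeff_mult[of g h "k - p"]]
          summable_on_reindex_bij_betw[OF bij, of "\<lambda>r. wcoeff g r * wcoeff h (k - p - r)" p] by simp
      then show "(\<Sum>\<^sub>\<infinity>q. ?t q p) =
          wcoeff f p * (\<Sum>\<^sub>\<infinity>q. wcoeff g (q - p) * wcoeff h (k - p - (q - p)))"
        by (subst infsum_cmult_right[symmetric]) (auto simp: mult.assoc)
    qed
    also have "\<dots> = (\<Sum>\<^sub>\<infinity>p. wcoeff f p * wcoeff (g * h) (k - p))"
      unfolding times_wiener.rep_eq
      using infsum_reindex_bij_betw[OF bij, of "\<lambda>r. wcoeff g r * wcoeff h (k - p - r)" p for p]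
      by simp
    also have "\<dots> = wcoeff (f * (g * h)) k"
      by (simp add: times_wiener.rep_eq)
    finally show "wcoeff (f * g * h) k = wcoeff (f * (g * h)) k" .
  qed
  have "wcoeff (1 * f) k = wcoeff f k" for k
  proof -
    have "((\<lambda>p. wcoeff 1 p * wcoeff f (k - p)) has_sum wcoeff f k) UNIV"
      by (rule has_sum_finite_neutralI[of "{0}"]) (auto simp: one_wiener.rep_eq)
    then show ?thesis
      using wcoeff_mult[of 1 f k] has_sum_unique by blast
  qed
  then show "1 * f = f"
    by (rule wiener_eqI)
  show "(f + g) * h = f * h + g * h"
  proof (rule wiener_eqI)
    fix k
    show "wcoeff ((f + g) * h) k = wcoeff (f * h + g * h) k"
      using has_sum_add[OF wcoeff_mult[of f h k] wcoeff_mult[of g h k]] wcoeff_mult[of "f + g" h k]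
      by (simp add: algebra_simps has_sum_unique)
  qed
  have "wcoeff (0 :: 'a wiener) 0 \<noteq> wcoeff 1 0"
    by (simp add: one_wiener.rep_eq)
  then show "(0 :: 'a wiener) \<noteq> 1"
    by metis
qed

end

lemma wcoeff_one: "wcoeff 1 k = (if k = 0 then 1 else 0)"
  by (simp add: one_wiener.rep_eq)

instance wiener :: ("{banach, real_normed_algebra_1, comm_ring_1}") real_normed_algebra_1
proof
  fix f g :: "'a wiener" and a :: real
  show *: "a *\<^sub>R f * g = a *\<^sub>R (f * g)" for f g :: "'a wiener"
  proof (rule wiener_eqI)
    fix k
    show "wcoeff (a *\<^sub>R f * g) k = wcoeff (a *\<^sub>R (f * g)) k"
      using has_sum_scaleR[OF wcoeff_mult[of f g k], of a] wcoeff_mult[of "a *\<^sub>R f" g k]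
      by (simp add: has_sum_unique)
  qed
  show "f * a *\<^sub>R g = a *\<^sub>R (f * g)"
    using *[of g f] by (simp add: mult.commute)
  have "norm (f * g) \<le> (\<Sum>\<^sub>\<infinity>k. \<Sum>\<^sub>\<infinity>p. norm (wcoeff f p) * norm (wcoeff g (k - p)))"
    unfolding norm_wiener_def
  proof (rule infsum_mono)
    show "(\<lambda>k. \<Sum>\<^sub>\<infinity>p. norm (wcoeff f p) * norm (wcoeff g (k - p))) summable_on UNIV"
      using summable_on_Sigma_banach[OF has_sum_imp_summable[OF convolution_norms[of f g]]] by simp
    fix k
    have "((\<lambda>p. norm (wcoeff f p) * norm (wcoeff g (k - p))) has_sum
        (\<Sum>\<^sub>\<infinity>p. norm (wcoeff f p) * norm (wcoeff g (k - p)))) UNIV"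
      by (rule has_sum_infsum[OF convolution_norm_summable])
    then show "norm (wcoeff (f * g) k) \<le> (\<Sum>\<^sub>\<infinity>p. norm (wcoeff f p) * norm (wcoeff g (k - p)))"
      by (rule norm_infsum_le[OF wcoeff_mult]) (auto intro: norm_mult_ineq)
  qed simp
  also have "\<dots> = norm f * norm g"
    using infsum_Sigma'_banach[OF has_sum_imp_summable[OF convolution_norms[of f g]]]
      infsumI[OF convolution_norms[of f g]] by simp
  finally show "norm (f * g) \<le> norm f * norm g" .
  show "norm (1 :: 'a wiener) = 1"
    unfolding norm_wiener_def
    by (rule infsumI, rule has_sum_finite_neutralI[of "{0}"]) (auto simp: wcoeff_one)
qed

subsection \<open>Exponentials and closed derivations\<close>

text \<open>\<open>R f f'\<close> is the graph of a derivation, a relation because derivatives exist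
  only for some elements. By Leibniz, each Taylor partial sum of \<open>exp u\<close> has as
  derivative \<open>u'\<close> times the preceding partial sum, and closedness of the graph passes
  to the limit.\<close>

lemma exp_closed_derivation:
  fixes R :: "'a :: {banach, real_normed_algebra_1, comm_ring_1} \<Rightarrow> 'a \<Rightarrow> bool"
  assumes one: "R 1 0"
    and add: "\<And>f f' g g'. R f f' \<Longrightarrow> R g g' \<Longrightarrow> R (f + g) (f' + g')"
    and scale: "\<And>c f f'. R f f' \<Longrightarrow> R (c *\<^sub>R f) (c *\<^sub>R f')"
    and mult: "\<And>f f' g g'. R f f' \<Longrightarrow> R g g' \<Longrightarrow> R (f * g) (f * g' + f' * g)"
    and closed: "\<And>X Y x y. (\<And>n::nat. R (X n) (Y n)) \<Longrightarrow> X \<longlonglongrightarrow> x \<Longrightarrow> Y \<longlonglongrightarrow> y \<Longrightarrow> R x y"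
    and R: "R u u'"
  shows "R (exp u) (u' * exp u)"
proof -
  define T where "T = (\<lambda>n. \<Sum>k<n. u ^ k /\<^sub>R fact k)"
  have pow: "R (u ^ Suc n) (of_nat (Suc n) *\<^sub>R (u' * u ^ n))" for n
  proof (induction n)
    case (Suc n)
    have "R (u * u ^ Suc n) (u * of_nat (Suc n) *\<^sub>R (u' * u ^ n) + u' * u ^ Suc n)"
      by (rule mult[OF R Suc])
    moreover have "u * c *\<^sub>R (u' * u ^ n) + u' * u ^ Suc n = (1 + c) *\<^sub>R (u' * u ^ Suc n)" for c
      by (simp add: scaleR_add_left mult.left_commute)
    then have "u * of_nat (Suc n) *\<^sub>R (u' * u ^ n) + u' * u ^ Suc n =
        of_nat (Suc (Suc n)) *\<^sub>R (u' * u ^ Suc n)"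
      unfolding of_nat_Suc[of "Suc n"] .
    ultimately show ?case by simp
  qed (use R in simp)
  have "R (T (Suc n)) (u' * T n)" for n
  proof (induction n)
    case 0
    then show ?case using one by (simp add: T_def)
  next
    case (Suc n)
    have "R (T (Suc n) + u ^ Suc n /\<^sub>R fact (Suc n))
        (u' * T n + of_nat (Suc n) *\<^sub>R (u' * u ^ n) /\<^sub>R fact (Suc n))"
      by (intro add scale pow Suc)
    moreover have "of_nat (Suc n) *\<^sub>R (u' * u ^ n) /\<^sub>R fact (Suc n) = u' * (u ^ n /\<^sub>R fact n)"
      by (simp add: field_simps del: of_nat_Suc)
    ultimately have "R (T (Suc n) + u ^ Suc n /\<^sub>R fact (Suc n)) (u' * T n + u' * (u ^ n /\<^sub>R fact n))"
      by (simp only:)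
    moreover have "T (Suc (Suc n)) = T (Suc n) + u ^ Suc n /\<^sub>R fact (Suc n)"
      unfolding T_def by (rule sum.lessThan_Suc)
    moreover have "u' * T (Suc n) = u' * T n + u' * (u ^ n /\<^sub>R fact n)"
      unfolding T_def sum.lessThan_Suc by (rule distrib_left)
    ultimately show ?case
      by (simp only:)
  qed
  moreover have T: "T \<longlonglongrightarrow> exp u"
    using exp_converges[of u] by (simp add: sums_def T_def)
  ultimately show ?thesis
    using closed[of "\<lambda>n. T (Suc n)" "\<lambda>n. u' * T n" "exp u" "u' * exp u"]
      LIMSEQ_Suc[OF T] tendsto_mult_left[OF T, of u'] by blast
qed

text \<open>The case of a relation that ignores its second argument.\<close>

lemma exp_closed_subalgebra:
  fixes S :: "'a :: {banach, real_normed_algebra_1, comm_ring_1} set"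
  assumes "1 \<in> S" "\<And>f g. f \<in> S \<Longrightarrow> g \<in> S \<Longrightarrow> f + g \<in> S" "\<And>c f. f \<in> S \<Longrightarrow> c *\<^sub>R f \<in> S"
    "\<And>f g. f \<in> S \<Longrightarrow> g \<in> S \<Longrightarrow> f * g \<in> S" "closed S" "u \<in> S"
  shows "exp u \<in> S"
  by (rule exp_closed_derivation[of "\<lambda>f _. f \<in> S" u 0, OF assms(1-4) _ assms(6)])
    (use closed_sequentially[OF assms(5)] in auto)

text \<open>Multiplicativity is asked only on the powers of \<open>u\<close>. So it covers the
  zeroth coefficient, which is multiplicative merely among symbols supported on one side.\<close>

lemma bounded_linear_exp_eq:
  fixes \<phi> :: "'a :: {banach, real_normed_algebra_1} \<Rightarrow> 'b :: {banach, real_normed_algebra_1}"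
  assumes "bounded_linear \<phi>" "\<And>n. \<phi> (u ^ n) = \<phi> u ^ n"
  shows "\<phi> (exp u) = exp (\<phi> u)"
proof -
  have "(\<lambda>n. \<phi> (u ^ n /\<^sub>R fact n)) sums \<phi> (exp u)"
    by (rule bounded_linear.sums[OF assms(1) exp_converges])
  then have "(\<lambda>n. \<phi> u ^ n /\<^sub>R fact n) sums \<phi> (exp u)"
    using assms by (simp add: linear_simps bounded_linear.linear linear_scale)
  then show ?thesis
    using exp_converges sums_unique2 by blast
qed

subsection \<open>Symbols\<close>

text \<open>Coefficients live on the whole line although only \<open>[0,1]\<close> matters;
  \<open>symbolI\<close> extends from the interval by clamping.\<close>

type_synonym symbol = "(real \<Rightarrow>\<^sub>C complex) wiener"

definition cf :: "symbol \<Rightarrow> int \<Rightarrow> real \<Rightarrow> complex" where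
  "cf f k x = apply_bcontfun (wcoeff f k) x"

lemma symbol_eqI: "(\<And>k x. cf f k x = cf g k x) \<Longrightarrow> f = g"
  by (auto intro!: wiener_eqI bcontfun_eqI simp: cf_def)

lemma cf_simps [simp]:
  "cf 0 k x = 0" "cf (f + g) k x = cf f k x + cf g k x" "cf (f - g) k x = cf f k x - cf g k x"
  "cf (- f) k x = - cf f k x" "cf (c *\<^sub>R f) k x = c *\<^sub>R cf f k x"
  "cf 1 k x = (if k = 0 then 1 else 0)"
  by (auto simp: cf_def wcoeff_one)

lemma continuous_on_cf [continuous_intros]: "continuous_on S (cf f k)"
  using continuous_on_apply_bcontfun unfolding cf_def by blast

lemma norm_cf_le: "norm (cf f k x) \<le> norm (wcoeff f k)"
  by (simp add: cf_def norm_bounded)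

lemma bounded_linear_cf: "bounded_linear (\<lambda>f. cf f k x)"
  by (rule bounded_linear_intro[of _ 1])
    (auto intro: order_trans[OF norm_cf_le] simp: norm_wcoeff_le)

lemma bounded_linear_apply_bcontfun:
  "bounded_linear (\<lambda>f :: _ \<Rightarrow>\<^sub>C _ :: real_normed_vector. apply_bcontfun f x)"
  by (rule bounded_linear_intro[of _ 1]) (auto simp: norm_bounded)

lemma cf_mult: "((\<lambda>p. cf f p x * cf g (k - p) x) has_sum cf (f * g) k x) UNIV"
  using has_sum_bounded_linear[OF bounded_linear_apply_bcontfun wcoeff_mult[of f g k]]
  by (simp add: cf_def o_def)

subsection \<open>Derivatives of symbols\<close>

text \<open>The operator (1/i) d/dt, so the factor is \<open>k\<close> without the imaginary unit.
  It is a relation since the weighted coefficients need not be summable.\<close>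

definition t_deriv :: "symbol \<Rightarrow> symbol \<Rightarrow> bool" where
  "t_deriv f g \<longleftrightarrow> (\<forall>k x. cf g k x = of_int k * cf f k x)"

text \<open>That \<open>g\<close> is again a \<open>symbol\<close> makes the derivatives continuous
  with summable sup norms; outside \<open>[0,1]\<close> nothing ties \<open>g\<close> to
  \<open>f\<close>.\<close>

definition x_deriv :: "symbol \<Rightarrow> symbol \<Rightarrow> bool" where
  "x_deriv f g \<longleftrightarrow>
     (\<forall>k. \<forall>x\<in>{0..1}. (cf f k has_vector_derivative cf g k x) (at x within {0..1}))"

lemma t_derivD: "t_deriv f g \<Longrightarrow> cf g k x = of_int k * cf f k x"
  by (simp add: t_deriv_def)

lemma t_deriv_add: "t_deriv f f' \<Longrightarrow> t_deriv g g' \<Longrightarrow> t_deriv (f + g) (f' + g')"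
  by (simp add: t_deriv_def algebra_simps)

lemma t_deriv_mult:
  assumes "t_deriv f f'" "t_deriv g g'"
  shows "t_deriv (f * g) (f * g' + f' * g)"
  unfolding t_deriv_def
proof safe
  fix k x
  have "((\<lambda>p. cf f p x * cf g' (k - p) x + cf f' p x * cf g (k - p) x) has_sum
      cf (f * g') k x + cf (f' * g) k x) UNIV"
    by (intro has_sum_add cf_mult)
  moreover have "cf f p x * cf g' (k - p) x + cf f' p x * cf g (k - p) x =
      of_int k * (cf f p x * cf g (k - p) x)" for p
    using assms by (simp add: t_deriv_def algebra_simps)
  moreover have "((\<lambda>p. of_int k * (cf f p x * cf g (k - p) x)) has_sum of_int k * cf (f * g) k x) UNIV"
    by (intro has_sum_cmult_right cf_mult)
  ultimately show "cf (f * g' + f' * g) k x = of_int k * cf (f * g) k x"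
    using has_sum_unique by fastforce
qed

lemma t_deriv_exp:
  assumes "t_deriv u u'"
  shows "t_deriv (exp u) (u' * exp u)"
proof (rule exp_closed_derivation[OF _ t_deriv_add _ t_deriv_mult _ assms])
  show "t_deriv 1 0"
    by (auto simp: t_deriv_def)
  show "t_deriv (c *\<^sub>R f) (c *\<^sub>R f')" if "t_deriv f f'" for c f f'
    using that by (simp add: t_deriv_def)
  show "t_deriv x y" if "\<And>n. t_deriv (X n) (Y n)" "X \<longlonglongrightarrow> x" "Y \<longlonglongrightarrow> y" for X Y :: "nat \<Rightarrow> symbol" and x y
    unfolding t_deriv_def
  proof safe
    fix k z
    have "(\<lambda>n. cf (Y n) k z) \<longlonglongrightarrow> cf y k z"
      by (rule bounded_linear.tendsto[OF bounded_linear_cf that(3)])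
    moreover have "(\<lambda>n. of_int k * cf (X n) k z) \<longlonglongrightarrow> of_int k * cf x k z"
      by (intro tendsto_intros bounded_linear.tendsto[OF bounded_linear_cf that(2)])
    ultimately show "cf y k z = of_int k * cf x k z"
      using that(1) LIMSEQ_unique by (simp add: t_deriv_def)
  qed
qed

lemma x_derivD:
  "x_deriv f g \<Longrightarrow> x \<in> {0..1} \<Longrightarrow> (cf f k has_vector_derivative cf g k x) (at x within {0..1})"
  by (simp add: x_deriv_def)

lemma cf_fun_add: "cf (f + g) k = (\<lambda>x. cf f k x + cf g k x)"
  by auto

lemma cf_fun_scaleR: "cf (c *\<^sub>R f) k = (\<lambda>x. c *\<^sub>R cf f k x)"
  by auto

lemma x_deriv_add: "x_deriv f f' \<Longrightarrow> x_deriv g g' \<Longrightarrow> x_deriv (f + g) (f' + g')"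
  unfolding x_deriv_def cf_fun_add by (auto intro!: derivative_intros)

lemma x_deriv_scaleR: "x_deriv f f' \<Longrightarrow> x_deriv (c *\<^sub>R f) (c *\<^sub>R f')"
  unfolding x_deriv_def cf_fun_scaleR by (auto intro!: derivative_eq_intros)

lemma has_vector_derivative_sequence_limit:
  fixes f :: "nat \<Rightarrow> real \<Rightarrow> 'a :: banach"
  assumes "convex S"
    and der: "\<And>n x. x \<in> S \<Longrightarrow> (f n has_vector_derivative f' n x) (at x within S)"
    and lim: "\<And>x. x \<in> S \<Longrightarrow> (\<lambda>n. f n x) \<longlonglongrightarrow> g x"
    and unif: "uniform_limit S f' g' sequentially"
    and "x \<in> S"
  shows "(g has_vector_derivative g' x) (at x within S)"
proof -
  have "\<exists>G. \<forall>x\<in>S. (\<lambda>n. f n x) \<longlonglongrightarrow> G x \<and> (G has_derivative (\<lambda>h. h *\<^sub>R g' x)) (at x within S)"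
  proof (rule has_derivative_sequence[where f = f and f' = "\<lambda>n x h. h *\<^sub>R f' n x",
        OF \<open>convex S\<close> _ _ \<open>x \<in> S\<close> lim[OF \<open>x \<in> S\<close>]])
    show "(f n has_derivative (\<lambda>h. h *\<^sub>R f' n x)) (at x within S)" if "x \<in> S" for n x
      using der[OF that] by (simp add: has_vector_derivative_def)
    fix e :: real assume "e > 0"
    then have "\<forall>\<^sub>F n in sequentially. \<forall>x\<in>S. dist (f' n x) (g' x) < e"
      using unif by (simp add: uniform_limit_iff)
    then show "\<forall>\<^sub>F n in sequentially. \<forall>x\<in>S. \<forall>h::real. norm (h *\<^sub>R f' n x - h *\<^sub>R g' x) \<le> e * norm h"
    proof (rule eventually_mono, intro ballI allI)
      fix n x and h :: real
      assume "\<forall>x\<in>S. dist (f' n x) (g' x) < e" "x \<in> S"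
      then have "norm h * norm (f' n x - g' x) \<le> norm h * e"
        by (intro mult_left_mono) (auto simp: dist_norm less_imp_le)
      then show "norm (h *\<^sub>R f' n x - h *\<^sub>R g' x) \<le> e * norm h"
        by (simp add: scaleR_diff_right[symmetric] mult.commute)
    qed
  qed
  then obtain G where G: "\<And>x. x \<in> S \<Longrightarrow> (\<lambda>n. f n x) \<longlonglongrightarrow> G x"
    "\<And>x. x \<in> S \<Longrightarrow> (G has_derivative (\<lambda>h. h *\<^sub>R g' x)) (at x within S)"
    by auto
  have "g y = G y" if "y \<in> S" for y
    using LIMSEQ_unique[OF lim[OF that] G(1)[OF that]] .
  then show ?thesis
    unfolding has_vector_derivative_def
    by (rule has_derivative_transform[OF \<open>x \<in> S\<close> _ G(2)[OF \<open>x \<in> S\<close>]])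
qed

text \<open>The norm of \<open>wiener\<close> dominates the sup norm of each coefficient, so the
  derivatives converge uniformly, coefficient by coefficient.\<close>

lemma x_deriv_closed:
  assumes "\<And>n::nat. x_deriv (X n) (Y n)" "X \<longlonglongrightarrow> f" "Y \<longlonglongrightarrow> g"
  shows "x_deriv f g"
  unfolding x_deriv_def
proof safe
  fix k and x :: real assume "x \<in> {0..1}"
  show "(cf f k has_vector_derivative cf g k x) (at x within {0..1})"
  proof (rule has_vector_derivative_sequence_limit[OF _ _ _ _ \<open>x \<in> {0..1}\<close>])
    show "(cf (X n) k has_vector_derivative cf (Y n) k x) (at x within {0..1})" if "x \<in> {0..1}" for n x
      using assms(1) that by (simp add: x_deriv_def)
    show "(\<lambda>n. cf (X n) k x) \<longlonglongrightarrow> cf f k x" for x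
      by (rule bounded_linear.tendsto[OF bounded_linear_cf assms(2)])
    have "(\<lambda>n. wcoeff (Y n) k) \<longlonglongrightarrow> wcoeff g k"
      by (rule bounded_linear.tendsto[OF bounded_linear_wcoeff assms(3)])
    then show "uniform_limit {0..1} (\<lambda>n. cf (Y n) k) (cf g k) sequentially"
      unfolding cf_def using uniform_limit_on_subset[OF tendsto_bcontfun_uniform_limit] by blast
  qed auto
qed

section \<open>Sums over the integers as limits over symmetric intervals\<close>

lemma filterlim_int_intervals:
  "filterlim (\<lambda>n. {- int n..int n}) (finite_subsets_at_top UNIV) sequentially"
  unfolding filterlim_finite_subsets_at_top
proof safe
  fix X :: "int set" assume X: "finite X"
  then obtain b where b: "\<And>k. k \<in> X \<Longrightarrow> \<bar>k\<bar> \<le> b"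
    using finite_imageI[OF X, of abs] by (metis Max_ge imageI)
  have "\<forall>\<^sub>F n in sequentially. n \<ge> nat b"
    by (rule eventually_ge_at_top)
  then show "\<forall>\<^sub>F y in sequentially. finite {- int y..int y} \<and> X \<subseteq> {- int y..int y} \<and> {- int y..int y} \<subseteq> UNIV"
    by eventually_elim (auto dest!: b)
qed

lemma has_sum_int_limit:
  "(f has_sum S) (UNIV :: int set) \<Longrightarrow> (\<lambda>n. \<Sum>k\<in>{- int n..int n}. f k) \<longlonglongrightarrow> S"
  unfolding has_sum_def using filterlim_compose filterlim_int_intervals by blast

text \<open>The Weierstrass M-test: the tail outside \<open>{- n..n}\<close> is bounded by the tail
  of \<open>M\<close>, whatever \<open>x\<close> is.\<close>

lemma uniform_limit_int_sums:
  fixes f :: "int \<Rightarrow> 'a \<Rightarrow> 'b :: banach"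
  assumes sum: "\<And>x. x \<in> S \<Longrightarrow> ((\<lambda>k. f k x) has_sum g x) UNIV"
    and le: "\<And>k x. x \<in> S \<Longrightarrow> norm (f k x) \<le> M k" and M: "M summable_on UNIV"
  shows "uniform_limit S (\<lambda>n x. \<Sum>k\<in>{- int n..int n}. f k x) g sequentially"
proof (rule uniform_limitI)
  fix e :: real assume "e > 0"
  obtain m where m: "(M has_sum m) UNIV"
    using M by (auto simp: summable_on_def)
  have "\<forall>\<^sub>F n in sequentially. dist (\<Sum>k\<in>{- int n..int n}. M k) m < e"
    using tendstoD[OF has_sum_int_limit[OF m] \<open>e > 0\<close>] .
  then show "\<forall>\<^sub>F n in sequentially. \<forall>x\<in>S. dist (\<Sum>k\<in>{- int n..int n}. f k x) (g x) < e"
  proof (rule eventually_mono, intro ballI)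
    fix n x
    assume n: "dist (\<Sum>k\<in>{- int n..int n}. M k) m < e" and x: "x \<in> S"
    let ?F = "{- int n..int n}"
    have tail: "(h has_sum s - (\<Sum>k\<in>?F. h k)) (- ?F)" if "(h has_sum s) UNIV" for h :: "int \<Rightarrow> 'c :: banach" and s
    proof -
      have "(h has_sum (\<Sum>k\<in>?F. h k)) ?F"
        by (rule has_sum_finite) simp
      from has_sum_Diff[OF that this] show ?thesis
        by (simp add: Compl_eq_Diff_UNIV)
    qed
    have "norm (g x - (\<Sum>k\<in>?F. f k x)) \<le> m - (\<Sum>k\<in>?F. M k)"
      by (rule norm_infsum_le[OF tail[OF sum[OF x]] tail[OF m]]) (use le x in auto)
    also have "\<dots> < e"
      using n by (auto simp: dist_real_def)
    finally show "dist (\<Sum>k\<in>?F. f k x) (g x) < e"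
      by (simp add: dist_norm norm_minus_commute)
  qed
qed

lemma has_vector_derivative_has_sum:
  fixes f :: "int \<Rightarrow> real \<Rightarrow> 'b :: banach"
  assumes "convex S"
    and der: "\<And>k x. x \<in> S \<Longrightarrow> (f k has_vector_derivative f' k x) (at x within S)"
    and sum: "\<And>x. x \<in> S \<Longrightarrow> ((\<lambda>k. f k x) has_sum g x) UNIV"
    and sum': "\<And>x. x \<in> S \<Longrightarrow> ((\<lambda>k. f' k x) has_sum g' x) UNIV"
    and le: "\<And>k x. x \<in> S \<Longrightarrow> norm (f' k x) \<le> M k" and M: "M summable_on UNIV"
    and "x \<in> S"
  shows "(g has_vector_derivative g' x) (at x within S)"
proof (rule has_vector_derivative_sequence_limit[OF \<open>convex S\<close> _ _ _ \<open>x \<in> S\<close>])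
  show "uniform_limit S (\<lambda>n x. \<Sum>k\<in>{- int n..int n}. f' k x) g' sequentially"
    by (rule uniform_limit_int_sums[OF sum' le M])
  show "(\<lambda>n. \<Sum>k\<in>{- int n..int n}. f k x) \<longlonglongrightarrow> g x" if "x \<in> S" for x
    by (rule has_sum_int_limit[OF sum[OF that]])
  show "((\<lambda>x. \<Sum>k\<in>{- int n..int n}. f k x) has_vector_derivative (\<Sum>k\<in>{- int n..int n}. f' k x))
      (at x within S)" if "x \<in> S" for n x
    by (intro derivative_intros der that)
qed

text \<open>The convolution is differentiated term by term; the products of coefficient norms
  majorize the derivatives.\<close>

lemma x_deriv_mult:
  assumes "x_deriv f f'" "x_deriv g g'"
  shows "x_deriv (f * g) (f * g' + f' * g)"
  unfolding x_deriv_def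
proof safe
  fix k and x :: real assume "x \<in> {0..1}"
  show "(cf (f * g) k has_vector_derivative cf (f * g' + f' * g) k x) (at x within {0..1})"
  proof (rule has_vector_derivative_has_sum[OF _ _ _ _ _ _ \<open>x \<in> {0..1}\<close>])
    show "((\<lambda>p. cf f p x * cf g (k - p) x) has_sum cf (f * g) k x) UNIV" for x
      by (rule cf_mult)
    show "((\<lambda>p. cf f p x * cf g' (k - p) x + cf f' p x * cf g (k - p) x) has_sum
        cf (f * g' + f' * g) k x) UNIV" for x
      unfolding cf_simps by (intro has_sum_add cf_mult)
    show "((\<lambda>x. cf f p x * cf g (k - p) x) has_vector_derivative
        cf f p x * cf g' (k - p) x + cf f' p x * cf g (k - p) x) (at x within {0..1})"
      if "x \<in> {0..1}" for p x
      using has_vector_derivative_mult[OF x_derivD[OF assms(1) that] x_derivD[OF assms(2) that]] .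
    show "norm (cf f p x * cf g' (k - p) x + cf f' p x * cf g (k - p) x) \<le>
        norm (wcoeff f p) * norm (wcoeff g' (k - p)) + norm (wcoeff f' p) * norm (wcoeff g (k - p))" for p x
      by (intro norm_triangle_le add_mono) (auto simp: norm_mult intro!: mult_mono norm_cf_le)
    show "(\<lambda>p. norm (wcoeff f p) * norm (wcoeff g' (k - p)) +
        norm (wcoeff f' p) * norm (wcoeff g (k - p))) summable_on UNIV"
      by (intro summable_on_add convolution_norm_summable)
  qed auto
qed

lemma x_deriv_one: "x_deriv 1 0"
  unfolding x_deriv_def by (auto simp: fun_eq_iff intro!: has_vector_derivative_transform[OF _ _ has_vector_derivative_const])

lemma x_deriv_exp: "x_deriv u u' \<Longrightarrow> x_deriv (exp u) (u' * exp u)"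
  by (rule exp_closed_derivation[OF x_deriv_one x_deriv_add x_deriv_scaleR x_deriv_mult x_deriv_closed])

subsection \<open>Symbols with one-sided support\<close>

text \<open>Named after the matrix: entry \<open>(i, j)\<close> carries the frequency
  \<open>j - i\<close>, so nonnegative frequencies fill the upper triangle.\<close>

definition upper :: "symbol \<Rightarrow> bool" where
  "upper f \<longleftrightarrow> (\<forall>k<0. \<forall>x. cf f k x = 0)"

definition lower :: "symbol \<Rightarrow> bool" where
  "lower f \<longleftrightarrow> (\<forall>k>0. \<forall>x. cf f k x = 0)"

lemma upper_one: "upper 1" and lower_one: "lower 1"
  by (auto simp: upper_def lower_def)

lemma has_sum_zeroI: "((\<lambda>p. h p) has_sum s) A \<Longrightarrow> (\<And>p. p \<in> A \<Longrightarrow> h p = 0) \<Longrightarrow> s = 0"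
  for s :: "'a :: {topological_comm_monoid_add, t2_space}"
  using has_sum_cong[of A h "\<lambda>_. 0" s] has_sum_0_simp has_sum_unique by metis

lemma upper_mult: "upper f \<Longrightarrow> upper g \<Longrightarrow> upper (f * g)"
  unfolding upper_def
proof (intro allI impI)
  fix k :: int and x
  assume fg: "\<forall>k<0. \<forall>x. cf f k x = 0" "\<forall>k<0. \<forall>x. cf g k x = 0" and "k < 0"
  have "cf f p x * cf g (k - p) x = 0" for p
    by (cases "p < 0") (use fg \<open>k < 0\<close> in auto)
  then show "cf (f * g) k x = 0"
    using has_sum_zeroI[OF cf_mult[of f x g k]] by simp
qed

lemma lower_mult: "lower f \<Longrightarrow> lower g \<Longrightarrow> lower (f * g)"
  unfolding lower_def
proof (intro allI impI)
  fix k :: int and x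
  assume fg: "\<forall>k>0. \<forall>x. cf f k x = 0" "\<forall>k>0. \<forall>x. cf g k x = 0" and "k > 0"
  have "cf f p x * cf g (k - p) x = 0" for p
    by (cases "p > 0") (use fg \<open>k > 0\<close> in auto)
  then show "cf (f * g) k x = 0"
    using has_sum_zeroI[OF cf_mult[of f x g k]] by simp
qed

lemma closed_cf_zero: "closed {f. cf f k x = 0}"
proof -
  have "closed ((\<lambda>f. cf f k x) -` {0})"
    by (rule continuous_closed_vimage)
      (auto intro: linear_continuous_at[OF bounded_linear_cf])
  then show ?thesis by (simp add: vimage_def)
qed

lemma upper_exp: "upper u \<Longrightarrow> upper (exp u)"
  using exp_closed_subalgebra[of "Collect upper" u]
proof (simp add: upper_mult)
  have "Collect upper = (\<Inter>k\<in>{..<0}. \<Inter>x. {f. cf f k x = 0})"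
    by (auto simp: upper_def)
  then have "closed (Collect upper)"
    by (simp add: closed_INT closed_cf_zero)
  then show "(upper 1 \<Longrightarrow> (\<And>f g. upper f \<Longrightarrow> upper g \<Longrightarrow> upper (f + g)) \<Longrightarrow>
      (\<And>c f. upper f \<Longrightarrow> upper (c *\<^sub>R f)) \<Longrightarrow> closed (Collect upper) \<Longrightarrow> upper (exp u)) \<Longrightarrow>
      upper (exp u)"
    by (auto simp: upper_def)
qed

lemma lower_exp: "lower u \<Longrightarrow> lower (exp u)"
  using exp_closed_subalgebra[of "Collect lower" u]
proof (simp add: lower_mult)
  have "Collect lower = (\<Inter>k\<in>{0<..}. \<Inter>x. {f. cf f k x = 0})"
    by (auto simp: lower_def)
  then have "closed (Collect lower)"
    by (simp add: closed_INT closed_cf_zero)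
  then show "(lower 1 \<Longrightarrow> (\<And>f g. lower f \<Longrightarrow> lower g \<Longrightarrow> lower (f + g)) \<Longrightarrow>
      (\<And>c f. lower f \<Longrightarrow> lower (c *\<^sub>R f)) \<Longrightarrow> closed (Collect lower) \<Longrightarrow> lower (exp u)) \<Longrightarrow>
      lower (exp u)"
    by (auto simp: lower_def)
qed

text \<open>Frequencies \<open>p\<close> and \<open>- p\<close> meet in the convolution; for
  \<open>p\<close> other than 0 one of them has the forbidden sign.\<close>

lemma cf_mult_zero:
  assumes "upper f \<and> upper g \<or> lower f \<and> lower g"
  shows "cf (f * g) 0 x = cf f 0 x * cf g 0 x"
proof -
  have "((\<lambda>p. cf f p x * cf g (0 - p) x) has_sum cf f 0 x * cf g 0 x) UNIV"
  proof (rule has_sum_finite_neutralI[of "{0}"])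
    fix p :: int
    assume "p \<in> UNIV - {0}"
    then have "p < 0 \<or> p > 0" by auto
    then show "cf f p x * cf g (0 - p) x = 0"
      using assms by (auto simp: upper_def lower_def)
  qed auto
  then show ?thesis
    using cf_mult[of f x g 0] has_sum_unique by blast
qed

text \<open>Makes the diagonal, hence the determinant, of the triangular matrix of an exponential
  explicit.\<close>

lemma cf_exp_zero:
  assumes "upper u \<or> lower u"
  shows "cf (exp u) 0 x = exp (cf u 0 x)"
proof (rule bounded_linear_exp_eq[OF bounded_linear_cf])
  have pow: "(upper u \<longrightarrow> upper (u ^ n)) \<and> (lower u \<longrightarrow> lower (u ^ n))" for n
    by (induction n) (auto intro: upper_mult lower_mult upper_one lower_one)
  show "cf (u ^ n) 0 x = cf u 0 x ^ n" for n
  proof (induction n)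
    case (Suc n)
    then show ?case
      using cf_mult_zero[of u "u ^ n" x] pow[of n] assms by auto
  qed auto
qed

subsection \<open>Entrywise norms of matrices\<close>

text \<open>Dominates the trace norm and takes its place. Likewise \<open>row_le\<close> and
  \<open>col_le\<close> bound the operator norms on l^infinity and l^1.\<close>

definition entry_norm :: "complex mat \<Rightarrow> real" where
  "entry_norm A = (\<Sum>i<dim_row A. \<Sum>j<dim_col A. cmod (A $$ (i, j)))"

definition row_le :: "complex mat \<Rightarrow> real \<Rightarrow> bool" where
  "row_le A c \<longleftrightarrow> (\<forall>i<dim_row A. (\<Sum>j<dim_col A. cmod (A $$ (i, j))) \<le> c)"

definition col_le :: "complex mat \<Rightarrow> real \<Rightarrow> bool" where
  "col_le A c \<longleftrightarrow> (\<forall>j<dim_col A. (\<Sum>i<dim_row A. cmod (A $$ (i, j))) \<le> c)"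

definition mtrace :: "complex mat \<Rightarrow> complex" where
  "mtrace A = (\<Sum>i<dim_row A. A $$ (i, i))"

lemma index_mult_mat_sum:
  assumes "A \<in> carrier_mat n n" "B \<in> carrier_mat n n" "i < n" "j < n"
  shows "(A * B) $$ (i, j) = (\<Sum>k<n. A $$ (i, k) * B $$ (k, j))"
  using assms by (simp add: scalar_prod_def atLeast0LessThan)

lemma col_le_transpose: "col_le A c \<longleftrightarrow> row_le (transpose_mat A) c"
  by (simp add: col_le_def row_le_def)

lemma entry_norm_transpose: "entry_norm (transpose_mat A) = entry_norm A"
  unfolding entry_norm_def by (simp add: sum.swap[of _ "{..<dim_col A}"])

lemma entry_norm_mult_right:
  assumes A: "A \<in> carrier_mat n n" and B: "B \<in> carrier_mat n n" and c: "row_le B c"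
  shows "entry_norm (A * B) \<le> entry_norm A * c"
proof -
  have "entry_norm (A * B) \<le> (\<Sum>i<n. \<Sum>j<n. \<Sum>k<n. cmod (A $$ (i, k)) * cmod (B $$ (k, j)))"
    unfolding entry_norm_def using A B
    by (auto simp: index_mult_mat_sum[OF A B] norm_mult[symmetric] simp del: index_mult_mat(1)
        intro!: sum_mono norm_sum)
  also have "\<dots> = (\<Sum>i<n. \<Sum>k<n. cmod (A $$ (i, k)) * (\<Sum>j<n. cmod (B $$ (k, j))))"
    unfolding sum_distrib_left by (intro sum.cong sum.swap refl)
  also have "\<dots> \<le> (\<Sum>i<n. \<Sum>k<n. cmod (A $$ (i, k)) * c)"
    using c B by (intro sum_mono mult_left_mono) (auto simp: row_le_def)
  also have "\<dots> = entry_norm A * c"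
    using A by (simp add: entry_norm_def sum_distrib_right)
  finally show ?thesis .
qed

lemma entry_norm_mult_left:
  assumes A: "A \<in> carrier_mat n n" and B: "B \<in> carrier_mat n n" and c: "col_le A c"
  shows "entry_norm (A * B) \<le> c * entry_norm B"
proof -
  have "entry_norm (transpose_mat B * transpose_mat A) \<le> entry_norm (transpose_mat B) * c"
    by (rule entry_norm_mult_right[of _ n]) (use A B c in \<open>auto simp: col_le_transpose\<close>)
  then show ?thesis
    by (simp add: entry_norm_transpose transpose_mult[OF A B, symmetric] mult.commute)
qed

lemma entry_norm_add:
  assumes "A \<in> carrier_mat n n" "B \<in> carrier_mat n n"
  shows "entry_norm (A + B) \<le> entry_norm A + entry_norm B"
  using assms unfolding entry_norm_def
  by (auto simp: sum.distrib[symmetric] intro!: sum_mono norm_triangle_ineq)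

lemma row_le_mult:
  assumes A: "A \<in> carrier_mat n n" and B: "B \<in> carrier_mat n n"
    and "row_le A a" "row_le B b" "b \<ge> 0"
  shows "row_le (A * B) (a * b)"
  unfolding row_le_def
proof safe
  fix i assume "i < dim_row (A * B)"
  then have i: "i < n" using A by simp
  have "(\<Sum>j<n. cmod ((A * B) $$ (i, j))) \<le> (\<Sum>j<n. \<Sum>k<n. cmod (A $$ (i, k)) * cmod (B $$ (k, j)))"
    by (auto simp: index_mult_mat_sum[OF A B i] norm_mult[symmetric] simp del: index_mult_mat(1)
        intro!: sum_mono norm_sum)
  also have "\<dots> = (\<Sum>k<n. cmod (A $$ (i, k)) * (\<Sum>j<n. cmod (B $$ (k, j))))"
    unfolding sum_distrib_left by (rule sum.swap)
  also have "\<dots> \<le> (\<Sum>k<n. cmod (A $$ (i, k)) * b)"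
    using assms by (intro sum_mono mult_left_mono) (auto simp: row_le_def)
  also have "\<dots> \<le> a * b"
    unfolding sum_distrib_right[symmetric] using assms i
    by (intro mult_right_mono) (auto simp: row_le_def)
  finally show "(\<Sum>j<dim_col (A * B). cmod ((A * B) $$ (i, j))) \<le> a * b"
    using B by simp
qed

lemma col_le_mult:
  assumes A: "A \<in> carrier_mat n n" and B: "B \<in> carrier_mat n n"
    and "col_le A a" "col_le B b" "a \<ge> 0"
  shows "col_le (A * B) (a * b)"
  using row_le_mult[of "transpose_mat B" n "transpose_mat A" b a] assms
  by (simp add: col_le_transpose transpose_mult[OF A B] mult.commute)

lemma row_le_add:
  assumes "A \<in> carrier_mat n n" "B \<in> carrier_mat n n" "row_le A a" "row_le B b"
  shows "row_le (A + B) (a + b)"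
  unfolding row_le_def
proof safe
  fix i assume "i < dim_row (A + B)"
  then have i: "i < n" using assms by simp
  have "(\<Sum>j<n. cmod ((A + B) $$ (i, j))) \<le> (\<Sum>j<n. cmod (A $$ (i, j))) + (\<Sum>j<n. cmod (B $$ (i, j)))"
    using assms i by (auto simp: sum.distrib[symmetric] intro!: sum_mono norm_triangle_ineq)
  also have "\<dots> \<le> a + b"
    using assms i by (intro add_mono) (auto simp: row_le_def)
  finally show "(\<Sum>j<dim_col (A + B). cmod ((A + B) $$ (i, j))) \<le> a + b"
    using assms by simp
qed

lemma col_le_add:
  assumes "A \<in> carrier_mat n n" "B \<in> carrier_mat n n" "col_le A a" "col_le B b"
  shows "col_le (A + B) (a + b)"
  using row_le_add[of "transpose_mat A" n "transpose_mat B" a b] assms transpose_add[of A n n B]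
  by (simp add: col_le_transpose)

lemma row_le_mono: "row_le A a \<Longrightarrow> a \<le> b \<Longrightarrow> row_le A b"
  unfolding row_le_def by (meson order_trans)

lemma col_le_mono: "col_le A a \<Longrightarrow> a \<le> b \<Longrightarrow> col_le A b"
  unfolding col_le_def by (meson order_trans)

lemma row_le_entry: "row_le A c \<Longrightarrow> i < dim_row A \<Longrightarrow> j < dim_col A \<Longrightarrow> cmod (A $$ (i, j)) \<le> c"
  unfolding row_le_def
  by (rule order_trans[OF member_le_sum[of j "{..<dim_col A}" "\<lambda>j. cmod (A $$ (i, j))"]]) auto

lemma mtrace_mult:
  assumes "A \<in> carrier_mat n n" "B \<in> carrier_mat n n"
  shows "mtrace (A * B) = (\<Sum>i<n. \<Sum>j<n. A $$ (i, j) * B $$ (j, i))"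
proof -
  have "mtrace (A * B) = (\<Sum>i<n. (A * B) $$ (i, i))"
    using assms by (simp add: mtrace_def)
  also have "\<dots> = (\<Sum>i<n. \<Sum>j<n. A $$ (i, j) * B $$ (j, i))"
    by (intro sum.cong refl index_mult_mat_sum assms) auto
  finally show ?thesis .
qed

lemma mtrace_mult_comm:
  assumes "A \<in> carrier_mat n n" "B \<in> carrier_mat n n"
  shows "mtrace (A * B) = mtrace (B * A)"
  unfolding mtrace_mult[OF assms] mtrace_mult[OF assms(2,1)]
  by (subst sum.swap) (simp add: mult.commute)

lemma mtrace_add:
  assumes "A \<in> carrier_mat n n" "B \<in> carrier_mat n n"
  shows "mtrace (A + B) = mtrace A + mtrace B"
  using assms by (simp add: mtrace_def sum.distrib)

text \<open>Only single entries of \<open>A\<close> matter, each at most \<open>c\<close>. In this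
  way an error matrix of small entry norm drops out of a trace.\<close>

lemma norm_mtrace_mult_le:
  assumes A: "A \<in> carrier_mat n n" and B: "B \<in> carrier_mat n n" and c: "row_le A c"
  shows "cmod (mtrace (A * B)) \<le> c * entry_norm B"
proof -
  have "cmod (mtrace (A * B)) \<le> (\<Sum>i<n. \<Sum>j<n. cmod (A $$ (i, j) * B $$ (j, i)))"
    unfolding mtrace_mult[OF A B] by (intro order_trans[OF norm_sum] sum_mono norm_sum)
  also have "\<dots> \<le> (\<Sum>i<n. \<Sum>j<n. c * cmod (B $$ (j, i)))"
    unfolding norm_mult
    using A row_le_entry[OF c] by (intro sum_mono mult_right_mono) auto
  also have "\<dots> = c * entry_norm B"
    using B by (subst sum.swap) (simp add: entry_norm_def sum_distrib_left)
  finally show ?thesis .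
qed

subsection \<open>Determinants\<close>

text \<open>The product of the row sums expands into a sum over all maps of the index set into
  itself; the Leibniz formula uses just the permutations among them.\<close>

lemma norm_det_le:
  assumes A: "A \<in> carrier_mat n n"
  shows "cmod (Determinant.det A) \<le> (\<Prod>i<n. \<Sum>j<n. cmod (A $$ (i, j)))"
proof -
  let ?P = "{p. p permutes {0..<n}}" and ?I = "{0..<n}"
  have "cmod (Determinant.det A) \<le> (\<Sum>p\<in>?P. cmod (signof p * (\<Prod>i = 0..<n. A $$ (i, p i))))"
    unfolding det_def'[OF A] by (rule norm_sum)
  also have "\<dots> = (\<Sum>p\<in>?P. \<Prod>i = 0..<n. cmod (A $$ (i, p i)))"
    by (intro sum.cong refl) (auto simp: norm_mult prod_norm sign_def)
  \<comment> \<open>Restriction turns permutations into members of \<open>PiE\<close>. It is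
    injective, since a permutation fixes everything outside the index set.\<close>
  also have "\<dots> = (\<Sum>g\<in>(\<lambda>p. restrict p ?I) ` ?P. \<Prod>i = 0..<n. cmod (A $$ (i, g i)))"
  proof (subst sum.reindex)
    show "inj_on (\<lambda>p. restrict p ?I) ?P"
    proof (rule inj_onI, rule ext)
      fix p q x
      assume pq: "p \<in> ?P" "q \<in> ?P" "restrict p ?I = restrict q ?I"
      show "p x = q x"
      proof (cases "x \<in> ?I")
        case True
        then show ?thesis using pq(3) by (metis restrict_apply')
      next
        case False
        then show ?thesis using pq by (simp add: permutes_not_in)
      qed
    qed
  qed simp
  also have "\<dots> \<le> (\<Sum>g\<in>PiE ?I (\<lambda>_. ?I). \<Prod>i = 0..<n. cmod (A $$ (i, g i)))"
  proof (rule sum_mono2)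
    show "(\<lambda>p. restrict p ?I) ` ?P \<subseteq> PiE ?I (\<lambda>_. ?I)"
    proof (rule image_subsetI)
      fix p assume "p \<in> ?P"
      then have "\<forall>i\<in>?I. p i \<in> ?I"
        using permutes_in_image[of p ?I] by blast
      then show "restrict p ?I \<in> PiE ?I (\<lambda>_. ?I)"
        by (simp only: restrict_PiE_iff)
    qed
  qed (auto intro: prod_nonneg finite_PiE)
  also have "\<dots> = (\<Prod>i\<in>?I. \<Sum>j\<in>?I. cmod (A $$ (i, j)))"
    by (rule prod_sum_PiE[symmetric]) auto
  finally show ?thesis
    by (simp add: atLeast0LessThan)
qed

text \<open>Each row sum of \<open>1 + A\<close> is at most \<open>exp\<close> of the row sum of
  \<open>A\<close>. The counterpart of the bound by the exponential of the trace norm; it asks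
  nothing about invertibility.\<close>

lemma norm_det_one_add_le:
  assumes A: "A \<in> carrier_mat n n"
  shows "cmod (Determinant.det (1\<^sub>m n + A)) \<le> exp (entry_norm A)"
proof -
  have "cmod (Determinant.det (1\<^sub>m n + A)) \<le> (\<Prod>i<n. \<Sum>j<n. cmod ((1\<^sub>m n + A) $$ (i, j)))"
    by (rule norm_det_le) (use A in auto)
  also have "\<dots> \<le> (\<Prod>i<n. exp (\<Sum>j<n. cmod (A $$ (i, j))))"
  proof (intro prod_mono conjI sum_nonneg)
    fix i assume "i \<in> {..<n}"
    then have "(\<Sum>j<n. cmod ((1\<^sub>m n + A) $$ (i, j))) \<le>
        (\<Sum>j<n. (if j = i then 1 else 0) + cmod (A $$ (i, j)))"
      using A by (intro sum_mono) (auto intro: order_trans[OF norm_triangle_ineq])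
    also have "\<dots> = 1 + (\<Sum>j<n. cmod (A $$ (i, j)))"
      using \<open>i \<in> {..<n}\<close> by (simp add: sum.distrib)
    also have "\<dots> \<le> exp (\<Sum>j<n. cmod (A $$ (i, j)))"
      by (rule exp_ge_add_one_self)
    finally show "(\<Sum>j<n. cmod ((1\<^sub>m n + A) $$ (i, j))) \<le> exp (\<Sum>j<n. cmod (A $$ (i, j)))" .
  qed auto
  also have "\<dots> = exp (entry_norm A)"
    using A by (simp add: entry_norm_def exp_sum)
  finally show ?thesis .
qed

text \<open>Diagonal dominance: the equation for a kernel vector is read at a component of largest
  modulus.\<close>

lemma det_perturbed_one_nonzero:
  assumes G: "G \<in> carrier_mat n n" and le: "row_le G c" and c: "c < 1"
  shows "Determinant.det (1\<^sub>m n + G) \<noteq> 0"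
proof
  assume "Determinant.det (1\<^sub>m n + G) = 0"
  then obtain v where v: "v \<in> carrier_vec n" "v \<noteq> 0\<^sub>v n" "(1\<^sub>m n + G) *\<^sub>v v = 0\<^sub>v n"
    using det_0_iff_vec_prod_zero_field[of "1\<^sub>m n + G" n] G by auto
  define m where "m = Max ((\<lambda>i. cmod (vec_index v i)) ` {..<n})"
  have "n > 0"
    using v(1,2) by (cases n) auto
  then have "m \<in> (\<lambda>i. cmod (vec_index v i)) ` {..<n}"
    unfolding m_def by (intro Max_in) auto
  then obtain i where i: "i < n" "m = cmod (vec_index v i)" by auto
  have le_m: "cmod (vec_index v j) \<le> m" if "j < n" for j
    unfolding m_def using that by (intro Max_ge) auto
  have "vec_index v i + (\<Sum>j<n. G $$ (i, j) * vec_index v j) = vec_index ((1\<^sub>m n + G) *\<^sub>v v) i"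
    using G v(1) i by (simp add: add_mult_distrib_mat_vec[of _ n n] scalar_prod_def atLeast0LessThan)
  then have "vec_index v i = - (\<Sum>j<n. G $$ (i, j) * vec_index v j)"
    using v(3) i by (simp add: eq_neg_iff_add_eq_0)
  then have "m \<le> (\<Sum>j<n. cmod (G $$ (i, j)) * m)"
    using i le_m by (auto simp: norm_mult intro!: order_trans[OF norm_sum] sum_mono mult_left_mono)
  also have "\<dots> \<le> c * m"
    unfolding sum_distrib_right[symmetric] using le G i
    by (intro mult_right_mono) (auto simp: row_le_def)
  finally have "(1 - c) * m \<le> 0"
    by (simp add: algebra_simps)
  then have "m \<le> 0"
    using c by (simp add: mult_le_0_iff)
  then have "vec_index v j = 0" if "j < n" for j
    using order_trans[OF le_m[OF that] \<open>m \<le> 0\<close>] by simp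
  then have "v = 0\<^sub>v n"
    using v(1) by (intro eq_vecI) auto
  with v(2) show False by simp
qed

lemma inverse_matE:
  fixes A :: "complex mat"
  assumes A: "A \<in> carrier_mat n n" and "Determinant.det A \<noteq> 0"
  obtains S where "S \<in> carrier_mat n n" "A * S = 1\<^sub>m n" "S * A = 1\<^sub>m n"
  using det_non_zero_imp_unit[OF assms, of "()"] that
  unfolding Units_def by (auto simp: ring_mat_simps)

text \<open>From \<open>S = 1 - G * S\<close> the largest row sum \<open>m\<close> of
  \<open>S\<close> satisfies \<open>m <= 1 + m / 2\<close>; this replaces the Neumann
  series.\<close>

lemma row_le_inverse:
  assumes S: "S \<in> carrier_mat n n" and G: "G \<in> carrier_mat n n" and inv: "(1\<^sub>m n + G) * S = 1\<^sub>m n"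
    and le: "row_le G (1/2)"
  shows "row_le S 2"
proof (cases "n = 0")
  case True
  then show ?thesis using S by (simp add: row_le_def)
next
  case False
  define r where "r = (\<lambda>i. \<Sum>j<n. cmod (S $$ (i, j)))"
  define m where "m = Max (r ` {..<n})"
  have "m \<in> r ` {..<n}"
    unfolding m_def using False by (intro Max_in) auto
  then obtain i where i: "i < n" "m = r i" by auto
  have le_m: "r k \<le> m" if "k < n" for k
    unfolding m_def using that by (intro Max_ge) auto
  have "0 \<le> m"
    using i by (simp add: r_def sum_nonneg)
  have eq: "S $$ (i, j) = (if i = j then 1 else 0) - (\<Sum>k<n. G $$ (i, k) * S $$ (k, j))" if "j < n" for j
  proof -
    have "((1\<^sub>m n + G) * S) $$ (i, j) = S $$ (i, j) + (G * S) $$ (i, j)"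
      using S G i that by (simp add: add_mult_distrib_mat[of _ n n] del: index_mult_mat(1))
    then show ?thesis
      using inv S G i that by (simp add: index_mult_mat_sum[OF G S] algebra_simps del: index_mult_mat(1))
  qed
  have "m \<le> (\<Sum>j<n. (if i = j then 1 else 0) + (\<Sum>k<n. cmod (G $$ (i, k)) * cmod (S $$ (k, j))))"
    unfolding i(2) r_def
  proof (rule sum_mono)
    fix j assume "j \<in> {..<n}"
    then have "cmod (S $$ (i, j)) = cmod ((if i = j then 1 else 0) - (\<Sum>k<n. G $$ (i, k) * S $$ (k, j)))"
      using eq[of j] by (simp only: lessThan_iff)
    also have "\<dots> \<le> cmod (if i = j then 1 else 0) + cmod (\<Sum>k<n. G $$ (i, k) * S $$ (k, j))"
      by (rule norm_triangle_ineq4)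
    also have "\<dots> \<le> (if i = j then 1 else 0) + (\<Sum>k<n. cmod (G $$ (i, k)) * cmod (S $$ (k, j)))"
      by (intro add_mono) (auto simp: norm_mult[symmetric] intro: norm_sum)
    finally show "cmod (S $$ (i, j)) \<le>
        (if i = j then 1 else 0) + (\<Sum>k<n. cmod (G $$ (i, k)) * cmod (S $$ (k, j)))" .
  qed
  also have "\<dots> = 1 + (\<Sum>j<n. \<Sum>k<n. cmod (G $$ (i, k)) * cmod (S $$ (k, j)))"
    using i by (simp add: sum.distrib)
  also have "(\<Sum>j<n. \<Sum>k<n. cmod (G $$ (i, k)) * cmod (S $$ (k, j))) = (\<Sum>k<n. cmod (G $$ (i, k)) * r k)"
    unfolding r_def sum_distrib_left by (rule sum.swap)
  also have "\<dots> \<le> (\<Sum>k<n. cmod (G $$ (i, k)) * m)"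
    using le_m by (intro sum_mono mult_left_mono) auto
  also have "\<dots> \<le> 1/2 * m"
    unfolding sum_distrib_right[symmetric] using le G i \<open>0 \<le> m\<close>
    by (intro mult_right_mono) (auto simp: row_le_def)
  finally have "m \<le> 2" by simp
  then show ?thesis
    using le_m S by (force simp: row_le_def r_def)
qed

lemma inverse_perturbed_one:
  assumes G: "G \<in> carrier_mat n n" and le: "row_le G (1/2)" "col_le G (1/2)"
  obtains S where "S \<in> carrier_mat n n" "(1\<^sub>m n + G) * S = 1\<^sub>m n" "S * (1\<^sub>m n + G) = 1\<^sub>m n"
    "row_le S 2" "col_le S 2"
proof -
  obtain S where S: "S \<in> carrier_mat n n" "(1\<^sub>m n + G) * S = 1\<^sub>m n" "S * (1\<^sub>m n + G) = 1\<^sub>m n"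
    by (rule inverse_matE[of "1\<^sub>m n + G" n])
      (use G det_perturbed_one_nonzero[OF G le(1)] in auto)
  have "transpose_mat (S * (1\<^sub>m n + G)) = (1\<^sub>m n + transpose_mat G) * transpose_mat S"
    using S(1) G by (simp add: transpose_mult[of _ n n _ n] transpose_add[of _ n n])
  then have "(1\<^sub>m n + transpose_mat G) * transpose_mat S = 1\<^sub>m n"
    unfolding S(3) transpose_one by (rule sym)
  then have "row_le (transpose_mat S) 2"
    by (rule row_le_inverse[rotated 2]) (use S G le in \<open>auto simp: col_le_transpose\<close>)
  with S row_le_inverse[OF S(1) G S(2) le(1)] show ?thesis
    by (intro that) (auto simp: col_le_transpose)
qed

text \<open>A permutation other than the identity moves at least two points, so after one factor is
  differentiated another off-diagonal factor, zero at \<open>s0\<close>, is left.\<close>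

lemma det_derivative_at_one:
  fixes M :: "complex \<Rightarrow> complex mat"
  assumes M: "\<And>s. M s \<in> carrier_mat n n" and one: "M s0 = 1\<^sub>m n"
    and der: "\<And>i j. i < n \<Longrightarrow> j < n \<Longrightarrow> ((\<lambda>s. M s $$ (i, j)) has_field_derivative D i j) (at s0)"
  shows "((\<lambda>s. Determinant.det (M s)) has_field_derivative (\<Sum>i<n. D i i)) (at s0)"
proof -
  let ?P = "{p. p permutes {0..<n}}"
  let ?d = "\<lambda>p. \<Sum>i\<in>{0..<n}. D i (p i) * (\<Prod>j\<in>{0..<n} - {i}. M s0 $$ (j, p j))"
  have p_lt: "p i < n" if "p \<in> ?P" "i < n" for p i
    using that permutes_in_image[of p "{0..<n}" i] by auto
  have zero: "?d p = 0" if p: "p \<in> ?P" "p \<noteq> id" for p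
  proof (rule sum.neutral, safe)
    fix i assume i: "i \<in> {0..<n}"
    obtain a where a: "p a \<noteq> a"
      using p by (auto simp: fun_eq_iff)
    then have a_in: "a \<in> {0..<n}"
      using p(1) by (metis mem_Collect_eq permutes_not_in)
    have pa: "p a \<in> {0..<n}" "p (p a) \<noteq> p a"
      using a a_in p(1) permutes_in_image[of p "{0..<n}" a] permutes_inj[of p "{0..<n}"]
      by (blast, metis injD mem_Collect_eq)
    obtain j where j: "j \<in> {0..<n} - {i}" "p j \<noteq> j"
      using a a_in pa by (cases "a = i") blast+
    have "M s0 $$ (j, p j) = 0"
      using j p_lt[OF p(1), of j] by (auto simp: one)
    then have "(\<Prod>j\<in>{0..<n} - {i}. M s0 $$ (j, p j)) = 0"
      using j by (intro prod_zero) auto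
    then show "D i (p i) * (\<Prod>j\<in>{0..<n} - {i}. M s0 $$ (j, p j)) = 0"
      by simp
  qed
  have "((\<lambda>s. \<Sum>p\<in>?P. signof p * (\<Prod>i\<in>{0..<n}. M s $$ (i, p i))) has_field_derivative
      (\<Sum>p\<in>?P. signof p * ?d p)) (at s0)"
    by (intro DERIV_sum DERIV_cmult has_field_derivative_prod der) (auto intro: p_lt)
  also have "(\<Sum>p\<in>?P. signof p * ?d p) = (\<Sum>p\<in>{id}. signof p * ?d p)"
    by (rule sum.mono_neutral_right) (auto simp: zero finite_permutations permutes_id)
  also have "\<dots> = (\<Sum>i\<in>{0..<n}. D i i)"
    by (auto simp: one intro!: sum.cong prod.neutral)
  finally show ?thesis
    using M by (simp add: det_def'[OF M] atLeast0LessThan)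
qed

text \<open>Jacobi's formula, reduced to the identity matrix by
  \<open>M s = M s0 * (S * M s)\<close>.\<close>

lemma det_has_field_derivative:
  fixes M :: "complex \<Rightarrow> complex mat"
  assumes M: "\<And>s. M s \<in> carrier_mat n n" and D: "D \<in> carrier_mat n n" and S: "S \<in> carrier_mat n n"
    and inv: "M s0 * S = 1\<^sub>m n" "S * M s0 = 1\<^sub>m n"
    and der: "\<And>i j. i < n \<Longrightarrow> j < n \<Longrightarrow> ((\<lambda>s. M s $$ (i, j)) has_field_derivative D $$ (i, j)) (at s0)"
  shows "((\<lambda>s. Determinant.det (M s)) has_field_derivative Determinant.det (M s0) * mtrace (S * D)) (at s0)"
proof -
  have "((\<lambda>s. Determinant.det (S * M s)) has_field_derivative (\<Sum>i<n. (S * D) $$ (i, i))) (at s0)"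
  proof (rule det_derivative_at_one[where M = "\<lambda>s. S * M s" and D = "\<lambda>i j. (S * D) $$ (i, j)"])
    show "((\<lambda>s. (S * M s) $$ (i, j)) has_field_derivative (S * D) $$ (i, j)) (at s0)"
      if "i < n" "j < n" for i j
      unfolding index_mult_mat_sum[OF S M that] index_mult_mat_sum[OF S D that]
      using that by (intro DERIV_sum DERIV_cmult der) auto
  qed (use M S inv in auto)
  then have "((\<lambda>s. Determinant.det (M s0) * Determinant.det (S * M s)) has_field_derivative
      Determinant.det (M s0) * mtrace (S * D)) (at s0)"
    using S by (intro DERIV_cmult) (simp add: mtrace_def)
  moreover have "Determinant.det (M s0) * Determinant.det (S * M s) = Determinant.det (M s)" for s
  proof -
    have "Determinant.det (M s0) * Determinant.det (S * M s) = Determinant.det ((M s0 * S) * M s)"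
      using S M by (simp add: det_mult[of _ n] assoc_mult_mat[of _ n n _ n _ n])
    then show ?thesis
      using inv M[of s] by simp
  qed
  ultimately show ?thesis by simp
qed

subsection \<open>Kac-Murdock-Szego matrices of symbols\<close>

text \<open>Matrix indices are integers, so that \<open>j - i\<close> and shifts beyond the matrix
  can be written without truncated subtraction.\<close>

abbreviation idx :: "nat \<Rightarrow> int set" where "idx n \<equiv> {0..int n}"

definition imat :: "nat \<Rightarrow> (int \<Rightarrow> int \<Rightarrow> complex) \<Rightarrow> complex mat" where
  "imat n F = Matrix.mat (n + 1) (n + 1) (\<lambda>(i, j). F (int i) (int j))"

lemma sum_idx: "(\<Sum>i<n + 1. F (int i)) = (\<Sum>i\<in>idx n. F i)"
  by (rule sum.reindex_bij_witness[of _ nat int]) auto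

lemma ball_idx: "(\<forall>i<n + 1. P (int i)) \<longleftrightarrow> (\<forall>i\<in>idx n. P i)"
proof safe
  fix i assume P: "\<forall>i<n + 1. P (int i)" and i: "i \<in> idx n"
  then have "P (int (nat i))"
    by (intro P[rule_format]) auto
  with i show "P i" by simp
qed auto

lemma imat_carrier [simp]: "imat n F \<in> carrier_mat (n + 1) (n + 1)"
  "dim_row (imat n F) = n + 1" "dim_col (imat n F) = n + 1"
  by (simp_all add: imat_def)

lemma imat_carrier_Suc [simp]: "imat n F \<in> carrier_mat (Suc n) (Suc n)"
  by (simp add: imat_def)

lemma index_imat [simp]: "i < n + 1 \<Longrightarrow> j < n + 1 \<Longrightarrow> imat n F $$ (i, j) = F (int i) (int j)"
  by (simp add: imat_def)

lemma imat_eqI: "(\<And>i j. i \<in> idx n \<Longrightarrow> j \<in> idx n \<Longrightarrow> F i j = G i j) \<Longrightarrow> imat n F = imat n G"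
  by (rule eq_matI) auto

lemma imat_index: "A \<in> carrier_mat (n + 1) (n + 1) \<Longrightarrow> A = imat n (\<lambda>i j. A $$ (nat i, nat j))"
  by (rule eq_matI) auto

lemma imat_add: "imat n F + imat n G = imat n (\<lambda>i j. F i j + G i j)"
  by (rule eq_matI) auto

lemma imat_minus: "imat n F - imat n G = imat n (\<lambda>i j. F i j - G i j)"
  by (rule eq_matI) auto

lemma imat_one: "1\<^sub>m (n + 1) = imat n (\<lambda>i j. if i = j then 1 else 0)"
  by (rule eq_matI) auto

lemma imat_mult: "imat n F * imat n G = imat n (\<lambda>i j. \<Sum>k\<in>idx n. F i k * G k j)"
proof (rule eq_matI)
  fix i j assume "i < dim_row (imat n (\<lambda>i j. \<Sum>k\<in>idx n. F i k * G k j))"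
    "j < dim_col (imat n (\<lambda>i j. \<Sum>k\<in>idx n. F i k * G k j))"
  then have ij: "i < n + 1" "j < n + 1" by simp_all
  have "(imat n F * imat n G) $$ (i, j) = (\<Sum>k<n + 1. F (int i) (int k) * G (int k) (int j))"
    unfolding index_mult_mat_sum[OF imat_carrier(1) imat_carrier(1) ij]
    by (intro sum.cong refl) (use ij in auto)
  also have "\<dots> = (\<Sum>k\<in>idx n. F (int i) k * G k (int j))"
    by (rule sum_idx)
  finally show "(imat n F * imat n G) $$ (i, j) = imat n (\<lambda>i j. \<Sum>k\<in>idx n. F i k * G k j) $$ (i, j)"
    using ij by simp
qed auto

lemma entry_norm_imat: "entry_norm (imat n F) = (\<Sum>i\<in>idx n. \<Sum>j\<in>idx n. cmod (F i j))"
proof -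
  have "entry_norm (imat n F) = (\<Sum>i<n + 1. \<Sum>j<n + 1. cmod (F (int i) (int j)))"
    by (simp add: entry_norm_def)
  also have "\<dots> = (\<Sum>i\<in>idx n. \<Sum>j\<in>idx n. cmod (F i j))"
    unfolding sum_idx[of "\<lambda>j. cmod (F _ j)"]
    by (rule sum_idx[of "\<lambda>i. \<Sum>j\<in>idx n. cmod (F i j)"])
  finally show ?thesis .
qed

lemma row_le_imat: "row_le (imat n F) c \<longleftrightarrow> (\<forall>i\<in>idx n. (\<Sum>j\<in>idx n. cmod (F i j)) \<le> c)"
proof -
  have "row_le (imat n F) c \<longleftrightarrow> (\<forall>i<n + 1. (\<Sum>j<n + 1. cmod (F (int i) (int j))) \<le> c)"
    by (simp add: row_le_def)
  also have "\<dots> \<longleftrightarrow> (\<forall>i<n + 1. (\<Sum>j\<in>idx n. cmod (F (int i) j)) \<le> c)"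
    unfolding sum_idx[of "\<lambda>j. cmod (F _ j)"] ..
  also have "\<dots> \<longleftrightarrow> (\<forall>i\<in>idx n. (\<Sum>j\<in>idx n. cmod (F i j)) \<le> c)"
    by (rule ball_idx)
  finally show ?thesis .
qed

lemma col_le_imat: "col_le (imat n F) c \<longleftrightarrow> (\<forall>j\<in>idx n. (\<Sum>i\<in>idx n. cmod (F i j)) \<le> c)"
proof -
  have "transpose_mat (imat n F) = imat n (\<lambda>i j. F j i)"
    by (rule eq_matI) auto
  then show ?thesis
    by (simp add: col_le_transpose row_le_imat)
qed

lemma mtrace_imat: "mtrace (imat n F) = (\<Sum>i\<in>idx n. F i i)"
  using sum_idx[of "\<lambda>i. F i i" n] by (simp add: mtrace_def)

text \<open>On the diagonal this is \<open>i / (n + 1)\<close>, the left end of a cell in the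
  partition of \<open>[0,1]\<close> into \<open>n + 1\<close> cells; the \<open>e_const\<close>
  terms of the limit come from this asymmetry.\<close>

definition node :: "nat \<Rightarrow> int \<Rightarrow> int \<Rightarrow> real" where
  "node n i j = of_int (i + j) / real (2 * n + 2)"

definition kms :: "nat \<Rightarrow> symbol \<Rightarrow> complex mat" where
  "kms n f = imat n (\<lambda>i j. cf f (j - i) (node n i j))"

lemma node_in [simp]: "i \<in> idx n \<Longrightarrow> j \<in> idx n \<Longrightarrow> node n i j \<in> {0..1}"
  by (auto simp: node_def field_simps)

lemma kms_carrier [simp]: "kms n f \<in> carrier_mat (n + 1) (n + 1)" "kms n f \<in> carrier_mat (Suc n) (Suc n)"
  "dim_row (kms n f) = n + 1" "dim_col (kms n f) = n + 1"
  by (simp_all add: kms_def)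

abbreviation wn :: "symbol \<Rightarrow> int \<Rightarrow> real" where "wn f k \<equiv> norm (wcoeff f k)"

lemma sum_wn_le:
  assumes "inj_on h A" "finite A"
  shows "(\<Sum>a\<in>A. wn f (h a)) \<le> norm f"
proof -
  have "(\<Sum>a\<in>A. wn f (h a)) = sum (wn f) (h ` A)"
    using assms by (simp add: sum.reindex)
  also have "\<dots> \<le> norm f"
    unfolding norm_wiener_def by (rule finite_sum_le_infsum) (use assms in auto)
  finally show ?thesis .
qed

lemma row_le_kms: "row_le (kms n f) (norm f)"
  unfolding kms_def row_le_imat
  by (intro ballI order_trans[OF sum_mono[OF norm_cf_le] sum_wn_le]) (auto simp: inj_on_def)

lemma col_le_kms: "col_le (kms n f) (norm f)"
  unfolding kms_def col_le_imat
  by (intro ballI order_trans[OF sum_mono[OF norm_cf_le] sum_wn_le]) (auto simp: inj_on_def)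

lemma kms_one: "kms n 1 = 1\<^sub>m (n + 1)"
  unfolding kms_def imat_one by (rule imat_eqI) auto

lemma kms_add: "kms n (f + g) = kms n f + kms n g"
  unfolding kms_def imat_add by (rule imat_eqI) auto

section \<open>Products of Kac-Murdock-Szego matrices and their errors\<close>

lemma has_sum_finite_sum:
  fixes f :: "'a \<Rightarrow> 'b \<Rightarrow> 'c :: topological_comm_monoid_add"
  assumes "finite A" "\<And>a. a \<in> A \<Longrightarrow> (f a has_sum s a) B"
  shows "((\<lambda>x. \<Sum>a\<in>A. f a x) has_sum (\<Sum>a\<in>A. s a)) B"
  using assms by (induction A) (auto intro: has_sum_add)

text \<open>The source of the weight |p|: through this count the norm of a
  \<open>t\<close>-derivative controls entry norms.\<close>

lemma card_shifted_out: "card {i \<in> idx n. i + p \<notin> idx n} \<le> nat \<bar>p\<bar>"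
proof (cases "p \<ge> 0")
  case True
  have "card {i \<in> idx n. i + p \<notin> idx n} \<le> card {int n - p + 1..int n}"
    by (rule card_mono) (use True in auto)
  with True show ?thesis by simp
next
  case False
  have "card {i \<in> idx n. i + p \<notin> idx n} \<le> card {0..- p - 1}"
    by (rule card_mono) (use False in auto)
  with False show ?thesis by simp
qed

lemma t_deriv_wn: "t_deriv f g \<Longrightarrow> wn g k = real_of_int \<bar>k\<bar> * wn f k"
proof -
  assume *: "t_deriv f g"
  define c where "c = real_of_int k"
  have "complex_of_int k = complex_of_real c"
    by (simp add: c_def)
  then have "wcoeff g k = c *\<^sub>R wcoeff f k"
    using * by (intro bcontfun_eqI) (simp add: t_deriv_def cf_def scaleR_conv_of_real[where 'a = complex])
  then have "wn g k = \<bar>c\<bar> * wn f k"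
    by simp
  then show ?thesis
    by (simp add: c_def)
qed

text \<open>The tail that truncation to \<open>0..n\<close> cuts from the convolution at the sample
  point of entry \<open>(i, j)\<close>; it corresponds to the Hankel products in Widom's identity
  for Toeplitz matrices.\<close>

definition gap :: "nat \<Rightarrow> symbol \<Rightarrow> symbol \<Rightarrow> int \<Rightarrow> int \<Rightarrow> complex" where
  "gap n f g i j = (\<Sum>\<^sub>\<infinity>k\<in>- idx n. cf f (k - i) (node n i j) * cf g (j - k) (node n i j))"

text \<open>The price for sampling the two factors at their own nodes instead of at the node of the
  product.\<close>

definition shift_error :: "nat \<Rightarrow> symbol \<Rightarrow> symbol \<Rightarrow> int \<Rightarrow> int \<Rightarrow> int \<Rightarrow> complex" where
  "shift_error n f g i k j =
     cf f (k - i) (node n i k) * cf g (j - k) (node n k j) -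
     cf f (k - i) (node n i j) * cf g (j - k) (node n i j)"

lemma has_sum_shift: "((\<lambda>k. h (k - i)) has_sum s) UNIV \<longleftrightarrow> (h has_sum s) (UNIV :: int set)"
  by (rule has_sum_reindex_bij_witness[of _ "\<lambda>p. p + i" "\<lambda>k. k - i"]) auto

lemma cf_mult_shift:
  "((\<lambda>k. cf f (k - i) x * cf g (j - k) x) has_sum cf (f * g) (j - i) x) UNIV"
  using has_sum_shift[of "\<lambda>p. cf f p x * cf g (j - i - p) x" i] cf_mult[of f x g "j - i"] by simp

lemma wn_mult_shift_summable: "(\<lambda>k. wn f (k - i) * wn g (j - k)) summable_on A"
proof -
  have "(\<lambda>k. wn f (k - i) * wn g (j - k)) summable_on UNIV"
    using has_sum_shift[of "\<lambda>p. wn f p * wn g (j - i - p)" i] convolution_norm_summable[of f g "j - i"]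
    by (simp add: summable_on_def)
  then show ?thesis
    by (rule summable_on_subset) auto
qed

text \<open>An exact identity that keeps the two failures of multiplicativity apart:
  \<open>shift_error\<close> stems from the dependence on \<open>x\<close>, \<open>gap\<close> from
  truncation, and the latter concentrates at the corners.\<close>

lemma kms_mult:
  "kms n f * kms n g =
     kms n (f * g) + imat n (\<lambda>i j. (\<Sum>k\<in>idx n. shift_error n f g i k j) - gap n f g i j)"
  unfolding kms_def imat_mult imat_add
proof (rule imat_eqI)
  fix i j assume "i \<in> idx n" "j \<in> idx n"
  let ?h = "\<lambda>k. cf f (k - i) (node n i j) * cf g (j - k) (node n i j)"
  have *: "(?h has_sum cf (f * g) (j - i) (node n i j)) UNIV"
    by (rule cf_mult_shift)
  have "?h summable_on - idx n"
    by (rule summable_on_subset[OF has_sum_imp_summable[OF *]]) auto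
  then have "(?h has_sum gap n f g i j) (- idx n)"
    by (simp add: gap_def)
  then have "(?h has_sum (\<Sum>k\<in>idx n. ?h k) + gap n f g i j) (idx n \<union> - idx n)"
    by (intro has_sum_Un_disjoint) auto
  then have "cf (f * g) (j - i) (node n i j) = (\<Sum>k\<in>idx n. ?h k) + gap n f g i j"
    using * has_sum_unique by auto
  then show "(\<Sum>k\<in>idx n. cf f (k - i) (node n i k) * cf g (j - k) (node n k j)) =
      cf (f * g) (j - i) (node n i j) + ((\<Sum>k\<in>idx n. shift_error n f g i k j) - gap n f g i j)"
    by (simp add: shift_error_def sum_subtractf)
qed

lemma norm_gap_le: "cmod (gap n f g i j) \<le> (\<Sum>\<^sub>\<infinity>k\<in>- idx n. wn f (k - i) * wn g (j - k))"
  unfolding gap_def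
proof (rule norm_infsum_le[OF has_sum_infsum has_sum_infsum])
  show "(\<lambda>k. cf f (k - i) (node n i j) * cf g (j - k) (node n i j)) summable_on - idx n"
    by (rule summable_on_subset[OF has_sum_imp_summable[OF cf_mult_shift]]) auto
  show "(\<lambda>k. wn f (k - i) * wn g (j - k)) summable_on - idx n"
    by (rule wn_mult_shift_summable)
qed (auto simp: norm_mult intro!: mult_mono norm_cf_le)

text \<open>Summing over \<open>j\<close> first costs \<open>norm g\<close>. For frequency
  \<open>p\<close> at most |p| indices \<open>i\<close> are shifted out of range, which turns the
  rest into \<open>norm f'\<close>.\<close>

lemma sum_outside_le:
  assumes "t_deriv f f'"
  shows "(\<Sum>i\<in>idx n. \<Sum>j\<in>idx n. \<Sum>\<^sub>\<infinity>k\<in>- idx n. wn f (k - i) * wn g (j - k)) \<le> norm f' * norm g"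
proof -
  let ?S = "\<lambda>i. \<Sum>\<^sub>\<infinity>k\<in>- idx n. wn f (k - i)"
  have sm: "(\<lambda>k. wn f (k - i)) summable_on A" for i A
    using has_sum_shift[of "wn f" i] wcoeff_summable[of f]
    by (metis summable_on_def summable_on_subset subset_UNIV)
  have 1: "(\<Sum>j\<in>idx n. \<Sum>\<^sub>\<infinity>k\<in>- idx n. wn f (k - i) * wn g (j - k)) \<le> ?S i * norm g" for i
  proof (rule has_sum_mono)
    show "((\<lambda>k. \<Sum>j\<in>idx n. wn f (k - i) * wn g (j - k)) has_sum
        (\<Sum>j\<in>idx n. \<Sum>\<^sub>\<infinity>k\<in>- idx n. wn f (k - i) * wn g (j - k))) (- idx n)"
      by (intro has_sum_finite_sum has_sum_infsum wn_mult_shift_summable) auto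
    show "((\<lambda>k. wn f (k - i) * norm g) has_sum ?S i * norm g) (- idx n)"
      by (intro has_sum_cmult_left has_sum_infsum sm)
    show "(\<Sum>j\<in>idx n. wn f (k - i) * wn g (j - k)) \<le> wn f (k - i) * norm g" for k
      unfolding sum_distrib_left[symmetric]
      by (intro mult_left_mono sum_wn_le) (auto simp: inj_on_def)
  qed
  have "((\<lambda>p. \<Sum>i\<in>idx n. if i + p \<in> idx n then 0 else wn f p) has_sum (\<Sum>i\<in>idx n. ?S i)) UNIV"
  proof (rule has_sum_finite_sum)
    fix i assume "i \<in> idx n"
    have "((\<lambda>k. wn f (k - i)) has_sum ?S i) (- idx n)"
      by (intro has_sum_infsum sm)
    moreover have "((\<lambda>k. wn f (k - i)) has_sum ?S i) (- idx n) \<longleftrightarrow>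
        ((\<lambda>k. if k \<in> idx n then 0 else wn f (k - i)) has_sum ?S i) UNIV"
      by (rule has_sum_cong_neutral) auto
    ultimately have "((\<lambda>k. if k \<in> idx n then 0 else wn f (k - i)) has_sum ?S i) UNIV"
      by blast
    then show "((\<lambda>p. if i + p \<in> idx n then 0 else wn f p) has_sum ?S i) UNIV"
      using has_sum_shift[of "\<lambda>p. if i + p \<in> idx n then 0 else wn f p" i] by simp
  qed simp
  then have "(\<Sum>i\<in>idx n. ?S i) \<le> norm f'"
  proof (rule has_sum_mono[OF _ has_sum_norm_wcoeff])
    fix p
    have "(\<Sum>i\<in>idx n. if i + p \<in> idx n then 0 else wn f p) =
        (\<Sum>i\<in>{i \<in> idx n. i + p \<notin> idx n}. wn f p)"
      by (rule sum.mono_neutral_cong_right) auto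
    also have "\<dots> \<le> real (nat \<bar>p\<bar>) * wn f p"
      using card_shifted_out[of n p] by (simp add: mult_right_mono)
    also have "\<dots> = wn f' p"
      by (simp add: t_deriv_wn[OF assms])
    finally show "(\<Sum>i\<in>idx n. if i + p \<in> idx n then 0 else wn f p) \<le> wn f' p" .
  qed
  then have "(\<Sum>i\<in>idx n. ?S i * norm g) \<le> norm f' * norm g"
    unfolding sum_distrib_right[symmetric] by (intro mult_right_mono) auto
  with sum_mono[of "idx n", OF 1] show ?thesis
    by (rule order_trans)
qed

lemma sum_gap_le:
  assumes "t_deriv f f'"
  shows "(\<Sum>i\<in>idx n. \<Sum>j\<in>idx n. cmod (gap n f g i j)) \<le> norm f' * norm g"
  by (rule order_trans[OF sum_mono[OF sum_mono[OF norm_gap_le]] sum_outside_le[OF assms]])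

lemma x_deriv_lipschitz:
  assumes "x_deriv f f'" "x \<in> {0..1}" "y \<in> {0..1}"
  shows "cmod (cf f k x - cf f k y) \<le> wn f' k * \<bar>x - y\<bar>"
proof -
  have "cmod (cf f k x - cf f k y) \<le> wn f' k * norm (x - y)"
  proof (rule differentiable_bound[OF _ _ _ assms(2,3)])
    show "(cf f k has_derivative (\<lambda>h. h *\<^sub>R cf f' k z)) (at z within {0..1})" if "z \<in> {0..1}" for z
      using x_derivD[OF assms(1) that] by (simp add: has_vector_derivative_def)
    show "onorm (\<lambda>h. h *\<^sub>R cf f' k z) \<le> wn f' k" for z
      by (rule onorm_le) (simp add: mult.commute mult_left_mono norm_cf_le)
  qed simp
  then show ?thesis by simp
qed

text \<open>The node of one factor is displaced in proportion to the frequency of the other factor,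
  so an \<open>x\<close>-derivative of one is always paired with a \<open>t\<close>-derivative of
  the other.\<close>

lemma shift_error_le:
  assumes f: "x_deriv f fx" "t_deriv f ft" and g: "x_deriv g gx" "t_deriv g gt"
    and ijk: "i \<in> idx n" "j \<in> idx n" "k \<in> idx n"
  shows "cmod (shift_error n f g i k j) \<le>
    (wn fx (k - i) * wn gt (j - k) + wn ft (k - i) * wn gx (j - k)) / real (2 * n + 2)"
proof -
  let ?x = "node n i j" and ?y = "node n i k" and ?z = "node n k j" and ?h = "1 / real (2 * n + 2)"
  have y: "\<bar>?y - ?x\<bar> = \<bar>j - k\<bar> * ?h" and z: "\<bar>?z - ?x\<bar> = \<bar>k - i\<bar> * ?h"
    unfolding node_def diff_divide_distrib[symmetric] abs_divide by auto
  have "shift_error n f g i k j = (cf f (k - i) ?y - cf f (k - i) ?x) * cf g (j - k) ?z +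
      cf f (k - i) ?x * (cf g (j - k) ?z - cf g (j - k) ?x)"
    by (simp add: shift_error_def algebra_simps)
  also have "cmod \<dots> \<le> (wn fx (k - i) * \<bar>?y - ?x\<bar>) * wn g (j - k) + wn f (k - i) * (wn gx (j - k) * \<bar>?z - ?x\<bar>)"
    by (rule order_trans[OF norm_triangle_ineq])
      (auto simp: norm_mult intro!: add_mono mult_mono norm_cf_le x_deriv_lipschitz f g ijk node_in simp del: of_nat_Suc)
  also have "\<dots> = (wn fx (k - i) * wn gt (j - k) + wn ft (k - i) * wn gx (j - k)) * ?h"
    unfolding y z t_deriv_wn[OF f(2)] t_deriv_wn[OF g(2)] by (simp add: algebra_simps)
  finally show ?thesis by simp
qed

lemma sum_sum_wn_le_row:
  "(\<Sum>k\<in>idx n. \<Sum>j\<in>idx n. wn f (k - i) * wn g (j - k)) \<le> norm f * norm g"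
proof -
  have "(\<Sum>k\<in>idx n. \<Sum>j\<in>idx n. wn f (k - i) * wn g (j - k)) \<le> (\<Sum>k\<in>idx n. wn f (k - i) * norm g)"
    unfolding sum_distrib_left[symmetric]
    by (intro sum_mono mult_left_mono sum_wn_le) (auto simp: inj_on_def)
  also have "\<dots> \<le> norm f * norm g"
    unfolding sum_distrib_right[symmetric]
    by (intro mult_right_mono sum_wn_le) (auto simp: inj_on_def)
  finally show ?thesis .
qed

lemma sum_sum_wn_le_col:
  "(\<Sum>k\<in>idx n. \<Sum>i\<in>idx n. wn f (k - i) * wn g (j - k)) \<le> norm f * norm g"
proof -
  have "(\<Sum>k\<in>idx n. \<Sum>i\<in>idx n. wn f (k - i) * wn g (j - k)) \<le> (\<Sum>k\<in>idx n. norm f * wn g (j - k))"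
    unfolding sum_distrib_right[symmetric]
    by (intro sum_mono mult_right_mono sum_wn_le) (auto simp: inj_on_def)
  also have "\<dots> \<le> norm f * norm g"
    unfolding sum_distrib_left[symmetric]
    by (intro mult_left_mono sum_wn_le) (auto simp: inj_on_def)
  finally show ?thesis .
qed

lemma shift_error_row:
  assumes f: "x_deriv f fx" "t_deriv f ft" and g: "x_deriv g gx" "t_deriv g gt" and i: "i \<in> idx n"
  shows "(\<Sum>j\<in>idx n. cmod (\<Sum>k\<in>idx n. shift_error n f g i k j)) \<le>
    (norm fx * norm gt + norm ft * norm gx) / real (2 * n + 2)"
proof -
  have "(\<Sum>j\<in>idx n. cmod (\<Sum>k\<in>idx n. shift_error n f g i k j)) \<le>
      (\<Sum>j\<in>idx n. \<Sum>k\<in>idx n. (wn fx (k - i) * wn gt (j - k) + wn ft (k - i) * wn gx (j - k)) / real (2 * n + 2))"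
    by (intro sum_mono order_trans[OF norm_sum] shift_error_le[OF f g i])
  also have "\<dots> = ((\<Sum>k\<in>idx n. \<Sum>j\<in>idx n. wn fx (k - i) * wn gt (j - k)) +
      (\<Sum>k\<in>idx n. \<Sum>j\<in>idx n. wn ft (k - i) * wn gx (j - k))) / real (2 * n + 2)"
    by (subst sum.swap) (simp add: sum_divide_distrib[symmetric] sum.distrib)
  also have "\<dots> \<le> (norm fx * norm gt + norm ft * norm gx) / real (2 * n + 2)"
    by (intro divide_right_mono add_mono sum_sum_wn_le_row) auto
  finally show ?thesis .
qed

lemma shift_error_col:
  assumes f: "x_deriv f fx" "t_deriv f ft" and g: "x_deriv g gx" "t_deriv g gt" and j: "j \<in> idx n"
  shows "(\<Sum>i\<in>idx n. cmod (\<Sum>k\<in>idx n. shift_error n f g i k j)) \<le>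
    (norm fx * norm gt + norm ft * norm gx) / real (2 * n + 2)"
proof -
  have "(\<Sum>i\<in>idx n. cmod (\<Sum>k\<in>idx n. shift_error n f g i k j)) \<le>
      (\<Sum>i\<in>idx n. \<Sum>k\<in>idx n. (wn fx (k - i) * wn gt (j - k) + wn ft (k - i) * wn gx (j - k)) / real (2 * n + 2))"
    by (intro sum_mono order_trans[OF norm_sum] shift_error_le[OF f g _ j])
  also have "\<dots> = ((\<Sum>k\<in>idx n. \<Sum>i\<in>idx n. wn fx (k - i) * wn gt (j - k)) +
      (\<Sum>k\<in>idx n. \<Sum>i\<in>idx n. wn ft (k - i) * wn gx (j - k))) / real (2 * n + 2)"
    by (subst sum.swap) (simp add: sum_divide_distrib[symmetric] sum.distrib)
  also have "\<dots> \<le> (norm fx * norm gt + norm ft * norm gx) / real (2 * n + 2)"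
    by (intro divide_right_mono add_mono sum_sum_wn_le_col) auto
  finally show ?thesis .
qed

text \<open>There are \<open>n + 1\<close> rows with shift errors of order 1/n, so the bound is O(1)
  and not o(1): enough for bounded determinants, not for the limit of a trace.\<close>

lemma kms_mult_entry_norm:
  assumes f: "x_deriv f fx" "t_deriv f ft" and g: "x_deriv g gx" "t_deriv g gt"
  obtains E where "E \<in> carrier_mat (n + 1) (n + 1)" "kms n f * kms n g = kms n (f * g) + E"
    "entry_norm E \<le> norm fx * norm gt + norm ft * norm gx + norm ft * norm g"
proof
  let ?E = "imat n (\<lambda>i j. (\<Sum>k\<in>idx n. shift_error n f g i k j) - gap n f g i j)"
  let ?c = "norm fx * norm gt + norm ft * norm gx"
  show "kms n f * kms n g = kms n (f * g) + ?E"
    by (rule kms_mult)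
  have "entry_norm ?E \<le> (\<Sum>i\<in>idx n. \<Sum>j\<in>idx n.
      cmod (\<Sum>k\<in>idx n. shift_error n f g i k j) + cmod (gap n f g i j))"
    unfolding entry_norm_imat by (intro sum_mono norm_triangle_ineq4)
  also have "\<dots> \<le> (\<Sum>i\<in>idx n. ?c / real (2 * n + 2)) + norm ft * norm g"
    unfolding sum.distrib by (intro add_mono sum_mono shift_error_row f g sum_gap_le) auto
  also have "(\<Sum>i\<in>idx n. ?c / real (2 * n + 2)) = ?c * (real (n + 1) / real (2 * n + 2))"
    by (simp add: nat_add_distrib)
  also have "\<dots> \<le> ?c * 1"
    by (intro mult_left_mono add_nonneg_nonneg mult_nonneg_nonneg) auto
  finally show "entry_norm ?E \<le> ?c + norm ft * norm g"
    by simp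
qed simp

text \<open>For \<open>k\<close> outside the index range one of \<open>k - i\<close>,
  \<open>j - k\<close> is negative, so \<open>gap\<close> vanishes and the whole error is O(1/n) in
  row and column sums. This gives \<open>kms n (exp u)\<close> an approximate inverse.\<close>

lemma kms_mult_upper:
  assumes f: "x_deriv f fx" "t_deriv f ft" and g: "x_deriv g gx" "t_deriv g gt"
    and up: "upper f" "upper g"
  obtains E where "E \<in> carrier_mat (n + 1) (n + 1)" "kms n f * kms n g = kms n (f * g) + E"
    "row_le E ((norm fx * norm gt + norm ft * norm gx) / real (2 * n + 2))"
    "col_le E ((norm fx * norm gt + norm ft * norm gx) / real (2 * n + 2))"
proof
  let ?E = "imat n (\<lambda>i j. \<Sum>k\<in>idx n. shift_error n f g i k j)"
  have "gap n f g i j = 0" if "i \<in> idx n" "j \<in> idx n" for i j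
    unfolding gap_def
  proof (rule infsum_0)
    fix k assume "k \<in> - idx n"
    then have "k - i < 0 \<or> j - k < 0" using that by auto
    then show "cf f (k - i) (node n i j) * cf g (j - k) (node n i j) = 0"
      using up by (auto simp: upper_def)
  qed
  then have "imat n (\<lambda>i j. (\<Sum>k\<in>idx n. shift_error n f g i k j) - gap n f g i j) = ?E"
    by (intro imat_eqI) simp
  then show "kms n f * kms n g = kms n (f * g) + ?E"
    by (simp add: kms_mult)
  show "row_le ?E ((norm fx * norm gt + norm ft * norm gx) / real (2 * n + 2))"
    unfolding row_le_imat using shift_error_row[OF f g] by blast
  show "col_le ?E ((norm fx * norm gt + norm ft * norm gx) / real (2 * n + 2))"
    unfolding col_le_imat using shift_error_col[OF f g] by blast
qed simp

section \<open>Determinants of the triangular matrices\<close>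

lemma det_kms_upper: "upper f \<Longrightarrow> Determinant.det (kms n f) = (\<Prod>i\<in>idx n. cf f 0 (node n i i))"
proof -
  assume "upper f"
  then have "upper_triangular (kms n f)"
    by (auto simp: upper_triangular_def kms_def upper_def)
  then have "Determinant.det (kms n f) = (\<Prod>i\<in>{0..<n + 1}. kms n f $$ (i, i))"
    by (subst det_upper_triangular[of _ "n + 1"]) (auto simp: prod_list_diag_prod)
  also have "\<dots> = (\<Prod>i\<in>idx n. cf f 0 (node n i i))"
    by (rule prod.reindex_bij_witness[of _ nat int]) (auto simp: kms_def)
  finally show ?thesis .
qed

lemma det_kms_lower: "lower f \<Longrightarrow> Determinant.det (kms n f) = (\<Prod>i\<in>idx n. cf f 0 (node n i i))"
proof -
  assume "lower f"
  then have "Determinant.det (kms n f) = (\<Prod>i\<in>{0..<n + 1}. kms n f $$ (i, i))"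
    by (subst det_lower_triangular[of "n + 1"]) (auto simp: prod_list_diag_prod kms_def lower_def)
  also have "\<dots> = (\<Prod>i\<in>idx n. cf f 0 (node n i i))"
    by (rule prod.reindex_bij_witness[of _ nat int]) (auto simp: kms_def)
  finally show ?thesis .
qed

subsection \<open>The symmetrized product\<close>

lemma tannery_null:
  fixes f :: "nat \<Rightarrow> 'a \<Rightarrow> real"
  assumes g: "g summable_on UNIV" and le: "\<And>n x. 0 \<le> f n x \<and> f n x \<le> g x"
    and lim: "\<And>x. (\<lambda>n. f n x) \<longlonglongrightarrow> 0"
  shows "(\<lambda>n. \<Sum>\<^sub>\<infinity>x. f n x) \<longlonglongrightarrow> 0"
proof (rule LIMSEQ_I)
  fix e :: real assume "e > 0"
  have g0: "g x \<ge> 0" for x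
    using le[of 0 x] by linarith
  obtain F where F: "finite F" "dist (\<Sum>x\<in>F. g x) (\<Sum>\<^sub>\<infinity>x. g x) \<le> e / 3"
    using infsum_finite_approximation[OF g, of "e / 3"] \<open>e > 0\<close> by auto
  have gC: "(\<Sum>\<^sub>\<infinity>x\<in>- F. g x) \<le> e / 3"
  proof -
    have "(\<Sum>\<^sub>\<infinity>x. g x) = (\<Sum>\<^sub>\<infinity>x\<in>F. g x) + (\<Sum>\<^sub>\<infinity>x\<in>- F. g x)"
      using infsum_Un_disjoint[of g F "- F"] F(1) summable_on_subset[OF g, of "- F"] by simp
    then show ?thesis
      using F by (simp add: dist_real_def abs_le_iff)
  qed
  have "(\<lambda>n. \<Sum>x\<in>F. f n x) \<longlonglongrightarrow> 0"
    using tendsto_sum[of F "\<lambda>x n. f n x" "\<lambda>_. 0"] lim by simp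
  then have "\<forall>\<^sub>F n in sequentially. dist (\<Sum>x\<in>F. f n x) 0 < e / 3"
    by (rule tendstoD) (use \<open>e > 0\<close> in simp)
  then obtain N where N: "\<And>n. n \<ge> N \<Longrightarrow> dist (\<Sum>x\<in>F. f n x) 0 < e / 3"
    unfolding eventually_sequentially by blast
  have "norm ((\<Sum>\<^sub>\<infinity>x. f n x) - 0) < e" if "n \<ge> N" for n
  proof -
    have sm: "f n summable_on UNIV"
      by (rule summable_on_comparison_test[OF g]) (use le in auto)
    have "(\<Sum>\<^sub>\<infinity>x. f n x) = (\<Sum>x\<in>F. f n x) + (\<Sum>\<^sub>\<infinity>x\<in>- F. f n x)"
      using infsum_Un_disjoint[of "f n" F "- F"] F(1) summable_on_subset[OF sm, of "- F"] by simp
    also have "(\<Sum>\<^sub>\<infinity>x\<in>- F. f n x) \<le> (\<Sum>\<^sub>\<infinity>x\<in>- F. g x)"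
      using le summable_on_subset[OF sm, of "- F"] summable_on_subset[OF g, of "- F"]
      by (intro infsum_mono) auto
    finally have "(\<Sum>\<^sub>\<infinity>x. f n x) < e"
      using gC N[OF that] \<open>e > 0\<close> by (simp add: dist_real_def)
    moreover have "0 \<le> (\<Sum>\<^sub>\<infinity>x. f n x)"
      using le by (intro infsum_nonneg) auto
    ultimately show ?thesis by simp
  qed
  then show "\<exists>N. \<forall>n\<ge>N. norm ((\<Sum>\<^sub>\<infinity>x. f n x) - 0) < e"
    by blast
qed

lemma tannery_null_sum:
  fixes f :: "nat \<Rightarrow> 'a \<Rightarrow> real"
  assumes g: "g summable_on UNIV" and le: "\<And>n x. x \<in> A n \<Longrightarrow> 0 \<le> f n x \<and> f n x \<le> g x"
    and g0: "\<And>x. g x \<ge> 0"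
    and lim: "\<And>x. (\<lambda>n. if x \<in> A n then f n x else 0) \<longlonglongrightarrow> 0" and fin: "\<And>n. finite (A n)"
  shows "(\<lambda>n. \<Sum>x\<in>A n. f n x) \<longlonglongrightarrow> 0"
proof -
  have "(\<lambda>n. \<Sum>\<^sub>\<infinity>x. if x \<in> A n then f n x else 0) \<longlonglongrightarrow> 0"
    by (rule tannery_null[OF g]) (use le g0 lim in auto)
  moreover have "(\<Sum>\<^sub>\<infinity>x. if x \<in> A n then f n x else 0) = (\<Sum>x\<in>A n. f n x)" for n
  proof -
    have "(\<Sum>\<^sub>\<infinity>x. if x \<in> A n then f n x else 0) = (\<Sum>\<^sub>\<infinity>x\<in>A n. f n x)"
      by (rule infsum_cong_neutral) auto
    then show ?thesis using fin by simp
  qed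
  ultimately show ?thesis by simp
qed

text \<open>Uniform continuity of \<open>cf f' k\<close> on \<open>[0,1]\<close> makes the remainder
  o(h) uniformly in the base point.\<close>

lemma x_deriv_linearization:
  assumes f: "x_deriv f f'" and "e > 0"
  obtains d where "d > 0" "\<And>x y. x \<in> {0..1} \<Longrightarrow> y \<in> {0..1} \<Longrightarrow> \<bar>y - x\<bar> < d \<Longrightarrow>
    cmod (cf f k y - cf f k x - of_real (y - x) * cf f' k x) \<le> e * \<bar>y - x\<bar>"
proof -
  have "uniformly_continuous_on {0..1} (cf f' k)"
    by (intro compact_uniformly_continuous continuous_on_cf) auto
  then obtain d where d: "d > 0"
    "\<And>x y. x \<in> {0..1} \<Longrightarrow> y \<in> {0..1} \<Longrightarrow> dist y x < d \<Longrightarrow> dist (cf f' k y) (cf f' k x) < e"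
    using \<open>e > 0\<close> unfolding uniformly_continuous_on_def by metis
  show ?thesis
  proof (rule that[OF d(1)])
    fix x y :: real assume xy: "x \<in> {0..1}" "y \<in> {0..1}" "\<bar>y - x\<bar> < d"
    have sub: "closed_segment x y \<subseteq> {0..1}"
      using xy by (intro closed_segment_subset) auto
    have "norm (cf f k y - cf f k x - (y - x) *\<^sub>R cf f' k x) \<le> norm (y - x) * e"
    proof (rule vector_differentiable_bound_linearization[of "closed_segment x y"])
      fix z assume z: "z \<in> closed_segment x y"
      then show "(cf f k has_vector_derivative cf f' k z) (at z within closed_segment x y)"
        using has_vector_derivative_within_subset[OF x_derivD[OF f] sub] sub by blast
      have "\<bar>z - x\<bar> \<le> \<bar>y - x\<bar>"
        using z by (auto simp: closed_segment_eq_real_ivl split: if_splits)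
      then show "norm (cf f' k z - cf f' k x) \<le> e"
        using d(2)[of x z] xy sub z by (auto simp: dist_norm less_imp_le)
    qed auto
    then show "cmod (cf f k y - cf f k x - of_real (y - x) * cf f' k x) \<le> e * \<bar>y - x\<bar>"
      by (simp add: scaleR_conv_of_real mult.commute)
  qed
qed

text \<open>Symmetrizing cancels the first-order terms, so only the continuity of the derivatives is
  needed to get \<open>o(h)\<close>.\<close>

lemma symmetric_difference_bound:
  assumes f: "x_deriv f f'" and g: "x_deriv g g'" and "e > 0"
  obtains d where "d > 0"
    "\<And>x h. 0 < h \<Longrightarrow> h < d \<Longrightarrow> {x, x - q * h, x + q * h, x - p * h, x + p * h} \<subseteq> {0..1} \<Longrightarrow>
      cmod (cf f k (x - q * h) * cf g l (x + p * h) + cf f k (x + q * h) * cf g l (x - p * h)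
        - 2 * cf f k x * cf g l x) \<le> e * h"
proof -
  \<comment> \<open>Four linearization errors add up to
    \<open>2 * e1 * (wn f k * |p| + wn g l * |q|) * h\<close>, at most half of \<open>e * h\<close>;
    the summand 1 keeps the denominator positive.\<close>
  define e1 where "e1 = e / (4 * (1 + wn f k * \<bar>p\<bar> + wn g l * \<bar>q\<bar>))"
  have pos: "1 + wn f k * \<bar>p\<bar> + wn g l * \<bar>q\<bar> > 0"
    by (intro add_pos_nonneg) auto
  then have "e1 > 0"
    using \<open>e > 0\<close> by (simp add: e1_def)
  obtain d1 where d1: "d1 > 0" "\<And>x y. x \<in> {0..1} \<Longrightarrow> y \<in> {0..1} \<Longrightarrow> \<bar>y - x\<bar> < d1 \<Longrightarrow>
      cmod (cf f k y - cf f k x - of_real (y - x) * cf f' k x) \<le> e1 * \<bar>y - x\<bar>"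
    using x_deriv_linearization[OF f \<open>e1 > 0\<close>, where k = k] by blast
  obtain d2 where d2: "d2 > 0" "\<And>x y. x \<in> {0..1} \<Longrightarrow> y \<in> {0..1} \<Longrightarrow> \<bar>y - x\<bar> < d2 \<Longrightarrow>
      cmod (cf g l y - cf g l x - of_real (y - x) * cf g' l x) \<le> e1 * \<bar>y - x\<bar>"
    using x_deriv_linearization[OF g \<open>e1 > 0\<close>, where k = l] by blast
  define c where "c = \<bar>p\<bar> * \<bar>q\<bar> * wn f' k * wn g' l"
  have "c \<ge> 0" by (simp add: c_def)
  \<comment> \<open>The first bound keeps all displacements inside \<open>d1\<close> and
    \<open>d2\<close>; the second makes the quadratic remainder \<open>2 * c * h * h\<close> at most
    the other half of \<open>e * h\<close>.\<close>
  define d where "d = min (min d1 d2 / (1 + \<bar>p\<bar> + \<bar>q\<bar>)) (e / (4 * (1 + c)))"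
  have "d > 0"
    using d1(1) d2(1) \<open>e > 0\<close> \<open>c \<ge> 0\<close> by (auto simp: d_def intro!: divide_pos_pos add_pos_nonneg)
  then show ?thesis
  proof (rule that)
    fix x h :: real
    assume h: "0 < h" "h < d" and mem: "{x, x - q * h, x + q * h, x - p * h, x + p * h} \<subseteq> {0..1}"
    have s1: "h * (1 + \<bar>p\<bar> + \<bar>q\<bar>) < min d1 d2"
      using h by (simp add: d_def pos_less_divide_eq add_pos_nonneg)
    have s2: "\<bar>r * h\<bar> \<le> h * (1 + \<bar>p\<bar> + \<bar>q\<bar>)" if "r = p \<or> r = q \<or> r = - p \<or> r = - q" for r
      using that h by (auto simp: abs_mult algebra_simps)
    have small: "\<bar>r * h\<bar> < d1 \<and> \<bar>r * h\<bar> < d2"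
      if "r = p \<or> r = q \<or> r = - p \<or> r = - q" for r
      using le_less_trans[OF s2[OF that] s1] by simp
    define V B V1 B1 where "V = cf f k x" and "B = cf g l x" and "V1 = cf f' k x" and "B1 = cf g' l x"
    define a where "a = (\<lambda>r. cf f k (x + r * h) - V)"
    define b where "b = (\<lambda>r. cf g l (x + r * h) - B)"
    have a: "cmod (a r - of_real (r * h) * V1) \<le> e1 * \<bar>r * h\<bar>" if "r = q \<or> r = - q" for r
      using d1(2)[of x "x + r * h"] small[of r] mem that by (auto simp: a_def V_def V1_def)
    have b: "cmod (b r - of_real (r * h) * B1) \<le> e1 * \<bar>r * h\<bar>" if "r = p \<or> r = - p" for r
      using d2(2)[of x "x + r * h"] small[of r] mem that by (auto simp: b_def B_def B1_def)
    have al: "cmod (a r) \<le> wn f' k * \<bar>r * h\<bar>" if "r = q \<or> r = - q" for r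
      using x_deriv_lipschitz[OF f, of "x + r * h" x k] mem that by (auto simp: a_def V_def)
    have bl: "cmod (b r) \<le> wn g' l * \<bar>r * h\<bar>" if "r = p \<or> r = - p" for r
      using x_deriv_lipschitz[OF g, of "x + r * h" x l] mem that by (auto simp: b_def B_def)
    have "cf f k (x - q * h) * cf g l (x + p * h) + cf f k (x + q * h) * cf g l (x - p * h) - 2 * V * B =
        (a (- q) + V) * (b p + B) + (a q + V) * (b (- p) + B) - 2 * V * B"
      by (simp add: a_def b_def)
    \<comment> \<open>The subtracted linear terms at \<open>r\<close> and \<open>- r\<close> cancel,
      so they can be inserted for free.\<close>
    also have "\<dots> = V * ((b p - of_real (p * h) * B1) + (b (- p) - of_real (- p * h) * B1)) +
        B * ((a q - of_real (q * h) * V1) + (a (- q) - of_real (- q * h) * V1)) +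
        (a (- q) * b p + a q * b (- p))"
      by (simp add: algebra_simps)
    also have "cmod \<dots> \<le> wn f k * (e1 * \<bar>p * h\<bar> + e1 * \<bar>- p * h\<bar>) +
        wn g l * (e1 * \<bar>q * h\<bar> + e1 * \<bar>- q * h\<bar>) +
        ((wn f' k * \<bar>- q * h\<bar>) * (wn g' l * \<bar>p * h\<bar>) + (wn f' k * \<bar>q * h\<bar>) * (wn g' l * \<bar>- p * h\<bar>))"
      unfolding V_def B_def
      by (rule order_trans[OF norm_triangle_ineq] add_mono order_trans[OF norm_mult_ineq] mult_mono
          norm_cf_le a b al bl refl disjI1 disjI2 norm_ge_zero mult_nonneg_nonneg abs_ge_zero)+
    also have "\<dots> = (2 * e1 * (wn f k * \<bar>p\<bar> + wn g l * \<bar>q\<bar>)) * h + (2 * c * h) * h"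
      using h by (simp add: abs_mult c_def algebra_simps)
    also have "\<dots> \<le> (e / 2) * h + (e / 2) * h"
    proof (intro add_mono mult_right_mono)
      have P: "2 * (e / (4 * P)) * P = e / 2" if "P > 0" for P
        using that by (simp add: field_simps)
      have "2 * e1 * (wn f k * \<bar>p\<bar> + wn g l * \<bar>q\<bar>) \<le> 2 * e1 * (1 + wn f k * \<bar>p\<bar> + wn g l * \<bar>q\<bar>)"
        using \<open>e1 > 0\<close> by (intro mult_left_mono) auto
      also have "\<dots> = e / 2"
        unfolding e1_def by (rule P[OF pos])
      finally show "2 * e1 * (wn f k * \<bar>p\<bar> + wn g l * \<bar>q\<bar>) \<le> e / 2" .
      have "h * (4 * (1 + c)) \<le> e"
        using h \<open>c \<ge> 0\<close> by (simp add: d_def pos_less_divide_eq)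
      then show "2 * c * h \<le> e / 2"
        using h \<open>c \<ge> 0\<close> by (simp add: algebra_simps)
    qed (use h in auto)
    finally show "cmod (cf f k (x - q * h) * cf g l (x + p * h) + cf f k (x + q * h) * cf g l (x - p * h)
        - 2 * cf f k x * cf g l x) \<le> e * h"
      by (simp add: V_def B_def)
  qed
qed

text \<open>Term \<open>k\<close> of one product is paired with term \<open>i + j - k\<close> of the
  other. In both, \<open>v\<close> has frequency \<open>k - i\<close> and \<open>b\<close> has
  frequency \<open>j - k\<close>, and the two samples of each factor lie symmetrically about
  \<open>node n i j\<close>.\<close>

definition sym_error :: "nat \<Rightarrow> symbol \<Rightarrow> symbol \<Rightarrow> int \<Rightarrow> int \<Rightarrow> int \<Rightarrow> real" where
  "sym_error n v b i k j =
     cmod ((if k \<in> idx n then shift_error n v b i k j else 0) +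
       (if i + j - k \<in> idx n then shift_error n b v i (i + j - k) j else 0))"

lemma sum_shift_error_le_sym_error:
  assumes "i \<in> idx n" "j \<in> idx n"
  shows "cmod (\<Sum>k\<in>idx n. shift_error n v b i k j + shift_error n b v i k j) \<le>
    (\<Sum>k\<in>{- int n..2 * int n}. sym_error n v b i k j)"
proof -
  \<comment> \<open>If \<open>i + j - k\<close> is an index, \<open>k\<close> itself may run from
    \<open>- n\<close> to \<open>2 * n\<close>.\<close>
  let ?R = "{- int n..2 * int n}"
  have "(\<Sum>k\<in>idx n. shift_error n v b i k j) = (\<Sum>k\<in>?R. if k \<in> idx n then shift_error n v b i k j else 0)"
    by (rule sum.mono_neutral_cong_left) auto
  moreover have "(\<Sum>k\<in>idx n. shift_error n b v i k j) =
      (\<Sum>k\<in>{k \<in> ?R. i + j - k \<in> idx n}. shift_error n b v i (i + j - k) j)"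
    by (rule sum.reindex_bij_witness[of _ "\<lambda>k. i + j - k" "\<lambda>k. i + j - k"]) (use assms in auto)
  moreover have "\<dots> = (\<Sum>k\<in>?R. if i + j - k \<in> idx n then shift_error n b v i (i + j - k) j else 0)"
    by (rule sum.mono_neutral_cong_left) auto
  ultimately show ?thesis
    unfolding sum.distrib sym_error_def by (simp add: sum.distrib[symmetric] norm_sum)
qed

text \<open>All positions \<open>i\<close> for one pair of frequencies. Bounded in \<open>n\<close>
  by a summable function of the pair, it reduces the claim to one pair at a time.\<close>

definition diag_error :: "nat \<Rightarrow> symbol \<Rightarrow> symbol \<Rightarrow> int \<times> int \<Rightarrow> real" where
  "diag_error n v b = (\<lambda>(p, q). \<Sum>i\<in>idx n.
     if i + p + q \<in> idx n then sym_error n v b i (i + p) (i + p + q) else 0)"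

lemma sum_shift_error_le_diag_error:
  "(\<Sum>i\<in>idx n. \<Sum>j\<in>idx n. cmod (\<Sum>k\<in>idx n. shift_error n v b i k j + shift_error n b v i k j)) \<le>
    (\<Sum>pq\<in>{- 2 * int n..2 * int n} \<times> {- 2 * int n..2 * int n}. diag_error n v b pq)"
proof -
  let ?R = "{- int n..2 * int n}" and ?B = "{- 2 * int n..2 * int n} \<times> {- 2 * int n..2 * int n}"
  let ?f = "\<lambda>i (p, q). if i + p + q \<in> idx n then sym_error n v b i (i + p) (i + p + q) else 0"
  have nonneg: "0 \<le> ?f i pq" for i pq
    by (auto simp: sym_error_def split: prod.splits)
  have *: "(\<Sum>j\<in>idx n. \<Sum>k\<in>?R. sym_error n v b i k j) \<le> (\<Sum>pq\<in>?B. ?f i pq)" if "i \<in> idx n" for i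
  proof -
    have "(\<Sum>j\<in>idx n. \<Sum>k\<in>?R. sym_error n v b i k j) = (\<Sum>(j, k)\<in>idx n \<times> ?R. sym_error n v b i k j)"
      by (rule sum.cartesian_product)
    also have "\<dots> = (\<Sum>pq\<in>{(p, q) \<in> ?B. i + p \<in> ?R \<and> i + p + q \<in> idx n}. ?f i pq)"
      by (rule sum.reindex_bij_witness[of _ "\<lambda>(p, q). (i + p + q, i + p)" "\<lambda>(j, k). (k - i, j - k)"])
        (use that in auto)
    also have "\<dots> \<le> (\<Sum>pq\<in>?B. ?f i pq)"
      using nonneg by (intro sum_mono2) auto
    finally show ?thesis .
  qed
  have "(\<Sum>i\<in>idx n. \<Sum>j\<in>idx n. cmod (\<Sum>k\<in>idx n. shift_error n v b i k j + shift_error n b v i k j)) \<le>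
      (\<Sum>i\<in>idx n. \<Sum>j\<in>idx n. \<Sum>k\<in>?R. sym_error n v b i k j)"
    by (intro sum_mono sum_shift_error_le_sym_error)
  also have "\<dots> \<le> (\<Sum>i\<in>idx n. \<Sum>pq\<in>?B. ?f i pq)"
    by (intro sum_mono *)
  also have "\<dots> = (\<Sum>pq\<in>?B. diag_error n v b pq)"
    by (subst sum.swap) (simp add: diag_error_def case_prod_unfold)
  finally show ?thesis .
qed

lemma sym_error_le:
  assumes v: "x_deriv v vx" "t_deriv v vt" and b: "x_deriv b bx" "t_deriv b bt"
    and i: "i \<in> idx n" "i + p + q \<in> idx n"
  shows "sym_error n v b i (i + p) (i + p + q) \<le> (wn vx p * wn bt q + wn vt p * wn bx q) / real (n + 1)"
proof -
  let ?A = "(wn vx p * wn bt q + wn vt p * wn bx q) / real (2 * n + 2)"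
  have "cmod (if i + p \<in> idx n then shift_error n v b i (i + p) (i + p + q) else 0) \<le> ?A"
    using shift_error_le[OF v b i, of "i + p"] by auto
  moreover have "cmod (if i + (i + p + q) - (i + p) \<in> idx n then
      shift_error n b v i (i + (i + p + q) - (i + p)) (i + p + q) else 0) \<le> ?A"
    using shift_error_le[OF b v i, of "i + q"] by (auto simp: algebra_simps)
  ultimately have "sym_error n v b i (i + p) (i + p + q) \<le> ?A + ?A"
    unfolding sym_error_def by (rule norm_triangle_mono)
  also have "\<dots> = (wn vx p * wn bt q + wn vt p * wn bx q) / real (n + 1)"
  proof -
    have "real (2 * n + 2) = 2 * real (n + 1)"
      by simp
    moreover have "c / (2 * m) + c / (2 * m) = c / m" for c m :: real
      by simp
    ultimately show ?thesis by (simp only:)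
  qed
  finally show ?thesis .
qed

lemma diag_error_le:
  assumes v: "x_deriv v vx" "t_deriv v vt" and b: "x_deriv b bx" "t_deriv b bt"
  shows "diag_error n v b (p, q) \<le> wn vx p * wn bt q + wn vt p * wn bx q"
proof -
  let ?A = "wn vx p * wn bt q + wn vt p * wn bx q"
  have "diag_error n v b (p, q) \<le> (\<Sum>i\<in>idx n. ?A / real (n + 1))"
    unfolding diag_error_def prod.case using sym_error_le[OF v b] by (intro sum_mono) auto
  also have "\<dots> = ?A"
    by (simp add: nat_add_distrib)
  finally show ?thesis .
qed

text \<open>Where both intermediate indices are in range, symmetry makes the error o(1/n), and there
  are at most \<open>n + 1\<close> such positions. At most |p| + |q| positions lack a partner, and
  these are O(1/n) each.\<close>

lemma diag_error_tendsto:
  assumes v: "x_deriv v vx" "t_deriv v vt" and b: "x_deriv b bx" "t_deriv b bt"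
  shows "(\<lambda>n. diag_error n v b (p, q)) \<longlonglongrightarrow> 0"
proof (rule LIMSEQ_I)
  fix e :: real assume "e > 0"
  let ?A = "wn vx p * wn bt q + wn vt p * wn bx q"
  let ?p = "real_of_int p" and ?q = "real_of_int q"
  obtain d where d: "d > 0"
    "\<And>x h. 0 < h \<Longrightarrow> h < d \<Longrightarrow> {x, x - ?q * h, x + ?q * h, x - ?p * h, x + ?p * h} \<subseteq> {0..1} \<Longrightarrow>
      cmod (cf v p (x - ?q * h) * cf b q (x + ?p * h) + cf v p (x + ?q * h) * cf b q (x - ?p * h)
        - 2 * cf v p x * cf b q x) \<le> e * h"
    using symmetric_difference_bound[OF v(1) b(1) \<open>e > 0\<close>, where p = ?p and q = ?q and k = p and l = q] by blast
  have "(\<lambda>n. 1 / real (2 * n + 2)) \<longlonglongrightarrow> 0" "(\<lambda>n. (\<bar>?p\<bar> + \<bar>?q\<bar>) * ?A / real (n + 1)) \<longlonglongrightarrow> 0"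
    by real_asymp+
  then have "\<forall>\<^sub>F n in sequentially. 1 / real (2 * n + 2) < d \<and> (\<bar>?p\<bar> + \<bar>?q\<bar>) * ?A / real (n + 1) < e / 2"
    using \<open>d > 0\<close> \<open>e > 0\<close> by (intro eventually_conj order_tendstoD) auto
  then obtain N where N: "\<And>n. n \<ge> N \<Longrightarrow> 1 / real (2 * n + 2) < d"
    "\<And>n. n \<ge> N \<Longrightarrow> (\<bar>?p\<bar> + \<bar>?q\<bar>) * ?A / real (n + 1) < e / 2"
    unfolding eventually_sequentially by blast
  have "diag_error n v b (p, q) < e" if "n \<ge> N" for n
  proof -
    define h where "h = 1 / real (2 * n + 2)"
    have h: "0 < h" "h < d"
      using N(1)[OF that] by (simp_all add: h_def)
    let ?out = "\<lambda>r i. if i + r \<notin> idx n then ?A / real (n + 1) else 0"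
    have A0: "?A / real (n + 1) \<ge> 0"
      by (intro divide_nonneg_nonneg add_nonneg_nonneg mult_nonneg_nonneg) auto
    have term_le: "(if i + p + q \<in> idx n then sym_error n v b i (i + p) (i + p + q) else 0) \<le>
        e * h + (?out p i + ?out q i)" if i: "i \<in> idx n" for i
    proof -
      consider "i + p + q \<notin> idx n" | "i + p + q \<in> idx n" "i + p \<notin> idx n \<or> i + q \<notin> idx n"
        | "i + p + q \<in> idx n" "i + p \<in> idx n" "i + q \<in> idx n"
        by blast
      then show ?thesis
      proof cases
        case 1
        then have "(if i + p + q \<in> idx n then sym_error n v b i (i + p) (i + p + q) else 0) = 0"
          by (rule if_not_P)
        then show ?thesis
          using h \<open>e > 0\<close> A0 by simp
      next
        case 2
        have "sym_error n v b i (i + p) (i + p + q) \<le> ?A / real (n + 1)"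
          by (rule sym_error_le[OF v b i 2(1)])
        also have "\<dots> \<le> ?out p i + ?out q i"
          using 2(2) A0 by auto
        also have "\<dots> \<le> e * h + (?out p i + ?out q i)"
          using h \<open>e > 0\<close> by simp
        finally show ?thesis
          using 2(1) by simp
      next
        case 3
        let ?x = "node n i (i + p + q)"
        have node_h: "node n a b = of_int (a + b) * h" for a b
          by (simp add: node_def h_def)
        have nodes: "node n i (i + p) = ?x - ?q * h" "node n (i + p) (i + p + q) = ?x + ?p * h"
          "node n i (i + q) = ?x - ?p * h" "node n (i + q) (i + p + q) = ?x + ?q * h"
          by (simp_all add: node_h algebra_simps)
        have mem: "{?x, ?x - ?q * h, ?x + ?q * h, ?x - ?p * h, ?x + ?p * h} \<subseteq> {0..1}"
          unfolding nodes[symmetric] using i 3 by (simp only: insert_subset node_in empty_subsetI simp_thms)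
        have "sym_error n v b i (i + p) (i + p + q) =
            cmod (shift_error n v b i (i + p) (i + p + q) + shift_error n b v i (i + q) (i + p + q))"
          using 3 by (simp add: sym_error_def algebra_simps)
        also have "shift_error n v b i (i + p) (i + p + q) + shift_error n b v i (i + q) (i + p + q) =
            cf v p (?x - ?q * h) * cf b q (?x + ?p * h) + cf v p (?x + ?q * h) * cf b q (?x - ?p * h)
              - 2 * cf v p ?x * cf b q ?x"
          unfolding shift_error_def nodes by (simp add: algebra_simps)
        also have "cmod \<dots> \<le> e * h"
          by (rule d(2)[OF h mem])
        finally show ?thesis
          using 3 by simp
      qed
    qed
    have "diag_error n v b (p, q) \<le> (\<Sum>i\<in>idx n. e * h + (?out p i + ?out q i))"
      unfolding diag_error_def prod.case by (intro sum_mono term_le)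
    also have "\<dots> = real (n + 1) * (e * h) + ((\<Sum>i\<in>idx n. ?out p i) + (\<Sum>i\<in>idx n. ?out q i))"
      by (simp add: sum.distrib nat_add_distrib)
    also have "real (n + 1) * (e * h) = e / 2"
      by (simp add: h_def field_simps)
    also have "(\<Sum>i\<in>idx n. ?out p i) + (\<Sum>i\<in>idx n. ?out q i) \<le>
        \<bar>?p\<bar> * (?A / real (n + 1)) + \<bar>?q\<bar> * (?A / real (n + 1))"
    proof -
      have "(\<Sum>i\<in>idx n. ?out r i) \<le> \<bar>real_of_int r\<bar> * (?A / real (n + 1))" for r
      proof -
        have "(\<Sum>i\<in>idx n. ?out r i) = (\<Sum>i\<in>{i \<in> idx n. i + r \<notin> idx n}. ?A / real (n + 1))"
          by (rule sum.mono_neutral_cong_right) auto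
        also have "\<dots> = real (card {i \<in> idx n. i + r \<notin> idx n}) * (?A / real (n + 1))"
          by simp
        also have "\<dots> \<le> real (nat \<bar>r\<bar>) * (?A / real (n + 1))"
          using card_shifted_out[of n r] A0 by (intro mult_right_mono) auto
        finally show ?thesis by simp
      qed
      then show ?thesis by (intro add_mono)
    qed
    also have "e / 2 + (\<bar>?p\<bar> * (?A / real (n + 1)) + \<bar>?q\<bar> * (?A / real (n + 1))) =
        e / 2 + (\<bar>?p\<bar> + \<bar>?q\<bar>) * ?A / real (n + 1)"
      by (simp only: distrib_right times_divide_eq_right add_divide_distrib[symmetric])
    also have "\<dots> < e"
      using N(2)[OF that] by linarith
    finally show ?thesis by simp
  qed
  moreover have "0 \<le> diag_error n v b (p, q)" for n
    by (auto simp: diag_error_def sym_error_def intro!: sum_nonneg)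
  ultimately show "\<exists>N. \<forall>n\<ge>N. norm (diag_error n v b (p, q) - 0) < e"
    by (intro exI[of _ N]) simp
qed

text \<open>Dominated convergence over pairs of frequencies, with the majorant of
  \<open>diag_error_le\<close>.\<close>

lemma symmetrized_shift_error_tendsto:
  assumes v: "x_deriv v vx" "t_deriv v vt" and b: "x_deriv b bx" "t_deriv b bt"
  shows "(\<lambda>n. \<Sum>i\<in>idx n. \<Sum>j\<in>idx n.
    cmod (\<Sum>k\<in>idx n. shift_error n v b i k j + shift_error n b v i k j)) \<longlonglongrightarrow> 0"
proof (rule tendsto_sandwich[OF _ _ tendsto_const])
  let ?g = "\<lambda>(p, q). wn vx p * wn bt q + wn vt p * wn bx q"
  show "(\<lambda>n. \<Sum>pq\<in>{- 2 * int n..2 * int n} \<times> {- 2 * int n..2 * int n}. diag_error n v b pq) \<longlonglongrightarrow> 0"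
  proof (rule tannery_null_sum)
    show "?g summable_on UNIV"
      using summable_on_add[OF
          has_sum_imp_summable[OF has_sum_product[OF has_sum_norm_wcoeff[of vx] has_sum_norm_wcoeff[of bt]]]
          has_sum_imp_summable[OF has_sum_product[OF has_sum_norm_wcoeff[of vt] has_sum_norm_wcoeff[of bx]]]]
      by (simp add: case_prod_unfold)
    show "0 \<le> diag_error n v b pq \<and> diag_error n v b pq \<le> ?g pq" for n pq
      using diag_error_le[OF v b, of n "fst pq" "snd pq"]
      by (auto simp: diag_error_def sym_error_def case_prod_unfold intro!: sum_nonneg)
    show "(\<lambda>n. if pq \<in> {- 2 * int n..2 * int n} \<times> {- 2 * int n..2 * int n} then diag_error n v b pq else 0)
        \<longlonglongrightarrow> 0" for pq
    proof (rule tendsto_sandwich[OF _ _ tendsto_const])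
      show "(\<lambda>n. diag_error n v b pq) \<longlonglongrightarrow> 0"
        using diag_error_tendsto[OF v b, of "fst pq" "snd pq"] by simp
    qed (auto simp: diag_error_def sym_error_def case_prod_unfold intro!: sum_nonneg always_eventually)
  qed (auto simp: case_prod_unfold)
qed (intro always_eventually allI sum_shift_error_le_diag_error sum_nonneg norm_ge_zero)+

subsection \<open>Corner contributions\<close>

text \<open>With coefficients constant in \<open>x\<close>, \<open>kms n (freeze f y)\<close> is the
  Toeplitz matrix of \<open>f\<close> at \<open>x = y\<close>; its products have no shift
  error.\<close>

definition freeze :: "symbol \<Rightarrow> real \<Rightarrow> symbol" where
  "freeze f y = Wiener (\<lambda>k. const_bcontfun (cf f k y))"

lemma cf_freeze [simp]: "cf (freeze f y) k x = cf f k y"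
  and wn_freeze_le: "wn (freeze f y) k \<le> wn f k"
proof -
  have *: "norm (const_bcontfun (cf f k y) :: real \<Rightarrow>\<^sub>C complex) \<le> wn f k" for k
    by (rule norm_bound) (simp add: norm_cf_le)
  have "(\<lambda>k. norm (const_bcontfun (cf f k y) :: real \<Rightarrow>\<^sub>C complex)) summable_on UNIV"
    by (rule summable_on_comparison_test[OF wcoeff_summable[of f]]) (use * in auto)
  then have "wcoeff (freeze f y) = (\<lambda>k. const_bcontfun (cf f k y))"
    unfolding freeze_def by (simp add: Wiener_inverse)
  then show "cf (freeze f y) k x = cf f k y" "wn (freeze f y) k \<le> wn f k"
    using * by (simp_all add: cf_def)
qed

lemma freeze_mult: "freeze (f * g) y = freeze f y * freeze g y"
proof (rule symbol_eqI)
  fix k x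
  show "cf (freeze (f * g) y) k x = cf (freeze f y * freeze g y) k x"
    using cf_mult[of "freeze f y" x "freeze g y" k] cf_mult[of f y g k] has_sum_unique by fastforce
qed

lemma freeze_one: "freeze 1 y = 1"
  by (rule symbol_eqI) simp

lemma kms_freeze_mult:
  "kms n (freeze f y) * kms n (freeze g y) + imat n (gap n (freeze f y) (freeze g y)) =
     kms n (freeze (f * g) y)"
proof -
  have "shift_error n (freeze f y) (freeze g y) i k j = 0" for i k j
    by (simp add: shift_error_def)
  then show ?thesis
    unfolding kms_mult by (simp add: kms_def imat_add freeze_mult)
qed

lemma kms_freeze_mult_upper:
  assumes "upper f" "upper g"
  shows "kms n (freeze f y) * kms n (freeze g y) = kms n (freeze (f * g) y)"
proof -
  have "gap n (freeze f y) (freeze g y) i j = 0" if "i \<in> idx n" "j \<in> idx n" for i j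
    unfolding gap_def
  proof (rule infsum_0)
    fix k assume "k \<in> - idx n"
    then have "k - i < 0 \<or> j - k < 0" using that by auto
    then show "cf (freeze f y) (k - i) (node n i j) * cf (freeze g y) (j - k) (node n i j) = 0"
      using assms by (auto simp: upper_def)
  qed
  then have "imat n (gap n (freeze f y) (freeze g y)) = imat n (\<lambda>i j. 0)"
    by (intro imat_eqI) simp
  then show ?thesis
    using kms_freeze_mult[of n f y g] by (simp add: kms_def imat_mult imat_add)
qed

text \<open>For \<open>k > n\<close> the frequency \<open>k - i\<close> is positive and
  \<open>v\<close> vanishes there: only the corner at index 0 survives.\<close>

lemma gap_lower:
  assumes "lower v" "i \<in> idx n"
  shows "gap n v f i j = (\<Sum>\<^sub>\<infinity>k\<in>{..<0}. cf v (k - i) (node n i j) * cf f (j - k) (node n i j))"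
  unfolding gap_def
  by (rule infsum_cong_neutral) (use assms in \<open>auto simp: lower_def\<close>)

text \<open>A frequency \<open>p < 0\<close> is attained by exactly \<open>- p\<close> pairs
  \<open>(i, i + p)\<close> with \<open>i >= 0 > i + p\<close>, so the total is a part of the norm
  of the \<open>t\<close>-derivative.\<close>

lemma corner_weights_summable:
  assumes "t_deriv v vt"
  shows "(\<lambda>(i, k). if 0 \<le> i \<and> k < 0 then wn v (k - i) else 0) summable_on (UNIV :: (int \<times> int) set)"
proof -
  have "(\<lambda>(p, i). if 0 \<le> i \<and> i + p < 0 then wn v p else 0) summable_on (UNIV :: int set) \<times> (UNIV :: int set)"
  proof (rule summable_on_SigmaI[where g = "\<lambda>p. real (nat (- p)) * wn v p"])
    fix p :: int
    show "((\<lambda>i. case (p, i) of (p, i) \<Rightarrow> if 0 \<le> i \<and> i + p < 0 then wn v p else 0) has_sum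
        real (nat (- p)) * wn v p) UNIV"
      by (rule has_sum_finite_neutralI[of "{0..<- p}"]) auto
  next
    show "(\<lambda>p. real (nat (- p)) * wn v p) summable_on UNIV"
      by (rule summable_on_comparison_test[OF wcoeff_summable[of vt]])
        (auto simp: t_deriv_wn[OF assms] intro!: mult_right_mono)
  qed auto
  also have "?this \<longleftrightarrow> ?thesis"
    unfolding UNIV_Times_UNIV
    by (rule summable_on_reindex_bij_witness[of _ "\<lambda>(i, k). (k - i, i)" "\<lambda>(p, i). (i, i + p)"]) auto
  finally show ?thesis .
qed

text \<open>Dominated convergence in the coordinates \<open>(i, k)\<close> and
  \<open>l = j - k\<close>, where the majorant splits: corner weights of \<open>v\<close> over
  \<open>(i, k)\<close>, and \<open>B\<close> over \<open>l\<close>.\<close>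

lemma corner_tannery:
  fixes F :: "nat \<Rightarrow> int \<Rightarrow> int \<Rightarrow> int \<Rightarrow> real"
  assumes v: "t_deriv v vt" and B: "B summable_on UNIV" "\<And>l. B l \<ge> 0"
    and le: "\<And>n i j k. i \<in> idx n \<Longrightarrow> j \<in> idx n \<Longrightarrow> k < 0 \<Longrightarrow> 0 \<le> F n i k j \<and> F n i k j \<le> wn v (k - i) * B (j - k)"
    and lim: "\<And>i j k. 0 \<le> i \<Longrightarrow> 0 \<le> j \<Longrightarrow> k < 0 \<Longrightarrow> (\<lambda>n. F n i k j) \<longlonglongrightarrow> 0"
  shows "(\<lambda>n. \<Sum>i\<in>idx n. \<Sum>j\<in>idx n. \<Sum>\<^sub>\<infinity>k\<in>{..<0}. F n i k j) \<longlonglongrightarrow> 0"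
proof -
  let ?w = "\<lambda>(i :: int, k :: int). if 0 \<le> i \<and> k < 0 then wn v (k - i) else 0"
  define G where "G = (\<lambda>n (x, l). case x of (i, k) \<Rightarrow>
    if i \<in> idx n \<and> k < 0 \<and> k + l \<in> idx n then F n i k (k + l) else 0)"
  let ?g = "\<lambda>(x, l). ?w x * B l"
  have g: "?g summable_on UNIV \<times> UNIV"
    by (rule has_sum_imp_summable[OF has_sum_product[OF has_sum_infsum has_sum_infsum]])
      (use corner_weights_summable[OF v] B in auto)
  have G: "0 \<le> G n x \<and> G n x \<le> ?g x" for n x
  proof -
    obtain i k l where x: "x = ((i, k), l)" by (metis surj_pair)
    show ?thesis
      using le[of i n "k + l" k] B(2) by (auto simp: x G_def)
  qed
  have Gs: "G n summable_on A" for n A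
    by (rule summable_on_subset[of _ UNIV])
      (use summable_on_comparison_test[OF g[unfolded UNIV_Times_UNIV], of "G n"] G in auto)
  have lim0: "(\<lambda>n. \<Sum>\<^sub>\<infinity>x. G n x) \<longlonglongrightarrow> 0"
  proof (rule tannery_null[OF g[unfolded UNIV_Times_UNIV] G])
    fix x :: "(int \<times> int) \<times> int"
    obtain i k l where x: "x = ((i, k), l)" by (metis surj_pair)
    show "(\<lambda>n. G n x) \<longlonglongrightarrow> 0"
    proof (cases "0 \<le> i \<and> k < 0 \<and> 0 \<le> k + l")
      case True
      then have l: "(\<lambda>n. F n i k (k + l)) \<longlonglongrightarrow> 0"
        by (intro lim) auto
      show ?thesis
        by (rule Lim_null_comparison[OF _ tendsto_rabs_zero[OF l]])
          (auto simp: x G_def intro!: always_eventually)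
    next
      case False
      then have "G n x = 0" for n by (auto simp: x G_def)
      then show ?thesis by simp
    qed
  qed
  have eq: "(\<Sum>i\<in>idx n. \<Sum>j\<in>idx n. \<Sum>\<^sub>\<infinity>k\<in>{..<0}. F n i k j) = (\<Sum>\<^sub>\<infinity>x. G n x)" for n
  proof -
    let ?A = "(idx n \<times> idx n) \<times> {..<0 :: int}"
    let ?H = "\<lambda>((i, j), k). F n i k j"
    have bij: "(?H has_sum s) ?A \<longleftrightarrow> (G n has_sum s) UNIV" for s
    proof -
      have "(?H has_sum s) ?A \<longleftrightarrow> (G n has_sum s) {((i, k), l). i \<in> idx n \<and> k < 0 \<and> k + l \<in> idx n}"
        by (rule has_sum_reindex_bij_witness[of _ "\<lambda>((i, k), l). ((i, k + l), k)" "\<lambda>((i, j), k). ((i, k), j - k)"])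
          (auto simp: G_def)
      also have "\<dots> \<longleftrightarrow> (G n has_sum s) UNIV"
        by (rule has_sum_cong_neutral) (auto simp: G_def split: if_splits)
      finally show ?thesis .
    qed
    have H: "(?H has_sum (\<Sum>\<^sub>\<infinity>x. G n x)) ?A"
      unfolding bij using Gs by simp
    have "(\<Sum>\<^sub>\<infinity>x. G n x) = infsum ?H ?A"
      using infsumI[OF H] by simp
    also have "\<dots> = (\<Sum>\<^sub>\<infinity>ij\<in>idx n \<times> idx n. \<Sum>\<^sub>\<infinity>k\<in>{..<0}. ?H (ij, k))"
      by (rule infsum_Sigma_banach[symmetric]) (rule has_sum_imp_summable[OF H])
    also have "\<dots> = (\<Sum>i\<in>idx n. \<Sum>j\<in>idx n. \<Sum>\<^sub>\<infinity>k\<in>{..<0}. F n i k j)"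
      by (simp add: sum.cartesian_product case_prod_unfold)
    finally show ?thesis by simp
  qed
  show ?thesis
    unfolding eq by (rule lim0)
qed

text \<open>Offset \<open>d\<close> occurs \<open>n + 1\<close> times minus \<open>N n d\<close>.
  The factor \<open>n + 1\<close> multiplies the total sum, which is 0, and \<open>N n d\<close>
  becomes |d| as soon as \<open>n >= |d|\<close>.\<close>

lemma toeplitz_sum_tendsto:
  fixes c :: "int \<Rightarrow> complex"
  assumes sum0: "(c has_sum 0) UNIV" and wsum: "((\<lambda>d. of_int \<bar>d\<bar> * c d) has_sum L) UNIV"
    and abs: "(\<lambda>d. real_of_int \<bar>d\<bar> * cmod (c d)) summable_on UNIV"
  shows "(\<lambda>n. \<Sum>i\<in>idx n. \<Sum>j\<in>idx n. c (j - i)) \<longlonglongrightarrow> - L"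
proof -
  define N where "N = (\<lambda>n d. card {i \<in> idx n. i + d \<notin> idx n})"
  have sums: "((\<lambda>d. - (of_nat (N n d) * c d)) has_sum (\<Sum>i\<in>idx n. \<Sum>j\<in>idx n. c (j - i))) UNIV" for n
  proof -
    have "((\<lambda>d. if i + d \<in> idx n then c d else 0) has_sum (\<Sum>j\<in>idx n. c (j - i))) UNIV" for i
    proof -
      have "((\<lambda>j. c (j - i)) has_sum (\<Sum>j\<in>idx n. c (j - i))) (idx n)"
        by (rule has_sum_finite) simp
      also have "?this \<longleftrightarrow> (c has_sum (\<Sum>j\<in>idx n. c (j - i))) {d. i + d \<in> idx n}"
        by (rule has_sum_reindex_bij_witness[of _ "\<lambda>d. i + d" "\<lambda>j. j - i"]) auto
      also have "\<dots> \<longleftrightarrow> ?thesis"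
        by (rule has_sum_cong_neutral) auto
      finally show ?thesis .
    qed
    from has_sum_add[OF this has_sum_uminusI[OF sum0]]
    have "((\<lambda>d. (if i + d \<in> idx n then c d else 0) - c d) has_sum (\<Sum>j\<in>idx n. c (j - i))) UNIV" for i
      by simp
    then have "((\<lambda>d. \<Sum>i\<in>idx n. (if i + d \<in> idx n then c d else 0) - c d) has_sum
        (\<Sum>i\<in>idx n. \<Sum>j\<in>idx n. c (j - i))) UNIV"
      by (intro has_sum_finite_sum) auto
    moreover have "(\<Sum>i\<in>idx n. (if i + d \<in> idx n then c d else 0) - c d) = - (of_nat (N n d) * c d)" for d
    proof -
      have "(\<Sum>i\<in>idx n. (if i + d \<in> idx n then c d else 0) - c d) =
          (\<Sum>i\<in>{i \<in> idx n. i + d \<notin> idx n}. - c d)"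
        by (rule sum.mono_neutral_cong_right) auto
      then show ?thesis by (simp add: N_def)
    qed
    ultimately show ?thesis by simp
  qed
  have N_le: "real (N n d) \<le> real_of_int \<bar>d\<bar>" for n d
    using card_shifted_out[of n d] by (simp add: N_def)
  have N_eq: "N n d = nat \<bar>d\<bar>" if "\<bar>d\<bar> \<le> int n" for n d
  proof (cases "d \<ge> 0")
    case True
    then have "{i \<in> idx n. i + d \<notin> idx n} = {int n - d + 1..int n}"
      using that by auto
    then show ?thesis using True by (simp add: N_def)
  next
    case False
    then have "{i \<in> idx n. i + d \<notin> idx n} = {0..- d - 1}"
      using that by auto
    then show ?thesis using False by (simp add: N_def)
  qed
  have lim: "(\<lambda>n. \<Sum>\<^sub>\<infinity>d. (real_of_int \<bar>d\<bar> - real (N n d)) * cmod (c d)) \<longlonglongrightarrow> 0"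
  proof (rule tannery_null[OF abs])
    show "0 \<le> (real_of_int \<bar>d\<bar> - real (N n d)) * cmod (c d) \<and>
        (real_of_int \<bar>d\<bar> - real (N n d)) * cmod (c d) \<le> real_of_int \<bar>d\<bar> * cmod (c d)" for n d
      using N_le[of n d] by (auto intro!: mult_right_mono)
    fix d
    have "\<forall>\<^sub>F n in sequentially. n \<ge> nat \<bar>d\<bar>"
      by (rule eventually_ge_at_top)
    then have "\<forall>\<^sub>F n in sequentially. (real_of_int \<bar>d\<bar> - real (N n d)) * cmod (c d) = 0"
      by (rule eventually_mono) (subst N_eq, auto)
    then show "(\<lambda>n. (real_of_int \<bar>d\<bar> - real (N n d)) * cmod (c d)) \<longlonglongrightarrow> 0"
      by (rule tendsto_eventually)
  qed
  have le: "norm ((\<Sum>i\<in>idx n. \<Sum>j\<in>idx n. c (j - i)) + L) \<le>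
      (\<Sum>\<^sub>\<infinity>d. (real_of_int \<bar>d\<bar> - real (N n d)) * cmod (c d))" for n
  proof (rule norm_infsum_le[OF has_sum_add[OF sums wsum] has_sum_infsum])
    show "(\<lambda>d. (real_of_int \<bar>d\<bar> - real (N n d)) * cmod (c d)) summable_on UNIV"
      by (rule summable_on_comparison_test[OF abs]) (use N_le in \<open>auto intro!: mult_right_mono\<close>)
    fix d
    have "- (of_nat m * z) + of_real A * z = of_real (A - real m) * z" for m A and z :: complex
      by (simp add: algebra_simps)
    from this[of "N n d" "c d" "real_of_int \<bar>d\<bar>"]
    have "- (of_nat (N n d) * c d) + of_int \<bar>d\<bar> * c d = of_real (real_of_int \<bar>d\<bar> - real (N n d)) * c d"
      unfolding of_real_of_int_eq .
    then show "cmod (- (of_nat (N n d) * c d) + of_int \<bar>d\<bar> * c d) \<le> (real_of_int \<bar>d\<bar> - real (N n d)) * cmod (c d)"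
      using N_le[of n d] by (simp only: norm_mult norm_of_real abs_of_nonneg diff_ge_0_iff_ge order_refl)
  qed
  have "\<forall>\<^sub>F n in sequentially. norm ((\<Sum>i\<in>idx n. \<Sum>j\<in>idx n. c (j - i)) + L) \<le>
      (\<Sum>\<^sub>\<infinity>d. (real_of_int \<bar>d\<bar> - real (N n d)) * cmod (c d))"
    using le by (intro always_eventually allI)
  from Lim_null_comparison[OF this lim]
  have "(\<lambda>n. (\<Sum>i\<in>idx n. \<Sum>j\<in>idx n. c (j - i)) + L) \<longlonglongrightarrow> 0" .
  then show ?thesis
    using tendsto_add_const_iff[of "- L" "\<lambda>n. (\<Sum>i\<in>idx n. \<Sum>j\<in>idx n. c (j - i)) + L" 0 sequentially]
    by (simp add: add.commute)
qed

lemma mtrace_frozen_corner_tendsto: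
  assumes v: "lower v" "\<And>x. cf v 0 x = 0" and X: "upper X" "upper X'" "X * X' = 1" and t: "t_deriv X' X't"
  shows "(\<lambda>n. mtrace (kms n (freeze X' x) * imat n (gap n (freeze v x) (freeze X x)))) \<longlonglongrightarrow>
    - cf (X't * (v * X)) 0 x"
proof -
  let ?c = "\<lambda>d. cf X' d x * cf (v * X) (- d) x"
  have "mtrace (kms n (freeze X' x) * imat n (gap n (freeze v x) (freeze X x))) =
      (\<Sum>i\<in>idx n. \<Sum>j\<in>idx n. ?c (j - i))" for n
  proof -
    let ?P' = "kms n (freeze X' x)" and ?V = "kms n (freeze v x)" and ?P = "kms n (freeze X x)"
      and ?C = "imat n (gap n (freeze v x) (freeze X x))"
    have PP': "?P * ?P' = 1\<^sub>m (n + 1)"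
      using kms_freeze_mult_upper[OF X(1,2)] X(3) by (simp add: freeze_one kms_one)
    have "?P' * kms n (freeze (v * X) x) = ?P' * (?V * ?P) + ?P' * ?C"
      unfolding kms_freeze_mult[symmetric]
      by (rule mult_add_distrib_mat[of _ "n + 1" "n + 1" _ "n + 1"]) auto
    then have "mtrace (?P' * kms n (freeze (v * X) x)) = mtrace (?P' * (?V * ?P)) + mtrace (?P' * ?C)"
      by (simp only:) (rule mtrace_add[of _ "n + 1"]; intro mult_carrier_mat[of _ _ "n + 1"]; simp)
    moreover have "mtrace (?P' * (?V * ?P)) = mtrace ((?V * ?P) * ?P')"
      by (rule mtrace_mult_comm[of _ "n + 1"]) auto
    moreover have "(?V * ?P) * ?P' = ?V"
      using PP' by (simp add: assoc_mult_mat[of _ "n + 1" "n + 1" _ "n + 1" _ "n + 1"]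
          right_mult_one_mat[of _ "n + 1"] del: One_nat_def add_Suc_right)
    moreover have "mtrace ?V = 0"
      unfolding kms_def mtrace_imat using v(2) by simp
    ultimately have "mtrace (?P' * ?C) = mtrace (?P' * kms n (freeze (v * X) x))"
      by simp
    also have "\<dots> = (\<Sum>i\<in>idx n. \<Sum>j\<in>idx n. ?c (j - i))"
      unfolding kms_def imat_mult mtrace_imat by simp
    finally show ?thesis .
  qed
  moreover have "(\<lambda>n. \<Sum>i\<in>idx n. \<Sum>j\<in>idx n. ?c (j - i)) \<longlonglongrightarrow> - cf (X't * (v * X)) 0 x"
  proof (rule toeplitz_sum_tendsto)
    have "X' * (v * X) = (X * X') * v"
      by (simp add: mult_ac)
    then have "X' * (v * X) = v"
      using X(3) by simp
    then show "(?c has_sum 0) UNIV"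
      using cf_mult[of X' x "v * X" 0] v(2)[of x] by simp
    have "of_int \<bar>d\<bar> * ?c d = cf X't d x * cf (v * X) (0 - d) x" for d
      using X(2) t_derivD[OF t, of d x] by (cases "d \<ge> 0") (auto simp: upper_def)
    then show "((\<lambda>d. of_int \<bar>d\<bar> * ?c d) has_sum cf (X't * (v * X)) 0 x) UNIV"
      using cf_mult[of X't x "v * X" 0] by (simp only:)
    show "(\<lambda>d. real_of_int \<bar>d\<bar> * cmod (?c d)) summable_on UNIV"
    proof (rule summable_on_comparison_test[OF convolution_norm_summable[of X't "v * X" 0]])
      fix d
      have "real_of_int \<bar>d\<bar> * cmod (?c d) = real_of_int \<bar>d\<bar> * (cmod (cf X' d x) * cmod (cf (v * X) (- d) x))"
        by (simp add: norm_mult)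
      also have "\<dots> \<le> real_of_int \<bar>d\<bar> * (wn X' d * wn (v * X) (- d))"
        by (intro mult_left_mono mult_mono norm_cf_le) auto
      also have "\<dots> = wn X't d * wn (v * X) (0 - d)"
        by (simp add: t_deriv_wn[OF t])
      finally show "real_of_int \<bar>d\<bar> * cmod (?c d) \<le> wn X't d * wn (v * X) (0 - d)" .
    qed simp
  qed
  ultimately show ?thesis by simp
qed

text \<open>\<open>Y\<close> vanishes unless \<open>m >= j >= 0\<close>, so the sum over indices
  already equals the symmetric partial sum of the convolution.\<close>

lemma partial_product_tendsto:
  assumes "lower Y" "0 \<le> j"
  shows "(\<lambda>n. \<Sum>m\<in>idx n. cf X (m - k) x * cf Y (j - m) x) \<longlonglongrightarrow> cf (X * Y) (j - k) x"
proof -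
  have "(\<Sum>m\<in>{- int n..int n}. cf X (m - k) x * cf Y (j - m) x) = (\<Sum>m\<in>idx n. cf X (m - k) x * cf Y (j - m) x)" for n
    by (rule sum.mono_neutral_right) (use assms in \<open>auto simp: lower_def\<close>)
  then show ?thesis
    using has_sum_int_limit[OF cf_mult_shift[of X k x Y j]] by simp
qed

lemma partial_product_le:
  "cmod (\<Sum>m\<in>idx n. cf X (m - k) x * cf Y (j - m) x) \<le> (\<Sum>\<^sub>\<infinity>p. wn X p * wn Y (j - k - p))"
proof -
  have "cmod (\<Sum>m\<in>idx n. cf X (m - k) x * cf Y (j - m) x) \<le> (\<Sum>m\<in>idx n. wn X (m - k) * wn Y (j - m))"
    by (rule sum_norm_le) (auto simp: norm_mult intro!: mult_mono norm_cf_le)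
  also have "\<dots> \<le> (\<Sum>\<^sub>\<infinity>m. wn X (m - k) * wn Y (j - m))"
    by (rule finite_sum_le_infsum[OF wn_mult_shift_summable]) auto
  also have "\<dots> = (\<Sum>\<^sub>\<infinity>p. wn X p * wn Y (j - k - p))"
    by (rule infsum_reindex_bij_witness[of _ "\<lambda>p. p + k" "\<lambda>m. m - k"]) auto
  finally show ?thesis .
qed

lemma convolution_bound_summable:
  "(\<lambda>l. wn b l + (\<Sum>\<^sub>\<infinity>p. wn X p * wn Y (l - p))) summable_on UNIV"
  using summable_on_Sigma_banach[OF has_sum_imp_summable[OF convolution_norms[of X Y]]]
  by (intro summable_on_add wcoeff_summable) simp
lemma corner_trace_tendsto:
  fixes y :: "nat \<Rightarrow> int \<Rightarrow> int \<Rightarrow> real" and S :: "nat \<Rightarrow> int \<Rightarrow> int \<Rightarrow> complex"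
  assumes y: "\<And>i j. 0 \<le> i \<Longrightarrow> 0 \<le> j \<Longrightarrow> (\<lambda>n. y n i j) \<longlonglongrightarrow> x"
    and v: "lower v" "\<And>x. cf v 0 x = 0" "t_deriv v vt"
    and X: "upper X" "upper X'" "X * X' = 1" "t_deriv X' X't" and Y: "lower Y" and b: "b = X * Y"
    and S: "\<And>n. n \<ge> n0 \<Longrightarrow> imat n (\<lambda>i j. cf b (j - i) (y n i j)) * imat n (S n) = 1\<^sub>m (n + 1)"
      "\<And>n. n \<ge> n0 \<Longrightarrow> row_le (imat n (S n)) \<kappa>"
  shows "(\<lambda>n. mtrace (imat n (S n) * imat n (\<lambda>i j.
      \<Sum>\<^sub>\<infinity>k\<in>{..<0}. cf v (k - i) (y n i j) * cf b (j - k) (y n i j)))) \<longlonglongrightarrow> - cf (X't * (v * X)) 0 x"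
proof -
  define T where "T = (\<lambda>n i j. cf b (j - i) (y n i j))"
  define C where "C = (\<lambda>n i j. \<Sum>\<^sub>\<infinity>k\<in>{..<0}. cf v (k - i) (y n i j) * cf b (j - k) (y n i j))"
  define P P' W where "P = (\<lambda>n. kms n (freeze X x))" and "P' = (\<lambda>n. kms n (freeze X' x))"
    and "W = (\<lambda>n. kms n (freeze Y x))"
  define D where "D = (\<lambda>n. imat n (gap n (freeze v x) (freeze X x)))"
  define Z where "Z = (\<lambda>n k j. \<Sum>m\<in>idx n. cf X (m - k) x * cf Y (j - m) x)"
  \<comment> \<open>\<open>B\<close> dominates, for all \<open>n\<close>, both the coefficients of
    \<open>b\<close> and the entries \<open>Z\<close> of the truncated product
    \<open>P n * W n\<close>; as a sum of an l^1 sequence and a convolution of such it is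
    summable.\<close>
  define h where "h = (\<lambda>l. \<Sum>\<^sub>\<infinity>p. wn X p * wn Y (l - p))"
  define B where "B = (\<lambda>l. wn b l + h l)"
  have h0: "h l \<ge> 0" for l
    unfolding h_def by (rule infsum_nonneg) auto
  have B0: "B l \<ge> 0" for l
    using h0[of l] by (simp add: B_def)
  have Bs: "B summable_on UNIV"
    using convolution_bound_summable[of b X Y] unfolding B_def h_def .
  have Z_le: "cmod (Z n k j) \<le> h (j - k)" for n k j
    unfolding Z_def h_def by (rule partial_product_le)
  have Z_lim: "(\<lambda>n. Z n k j) \<longlonglongrightarrow> cf b (j - k) x" if "0 \<le> j" for k j
    unfolding Z_def b by (rule partial_product_tendsto[OF Y that])
  have cf_lim: "(\<lambda>n. cf f k (y n i j)) \<longlonglongrightarrow> cf f k x" if "0 \<le> i" "0 \<le> j" for f k i j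
  proof (rule continuous_on_tendsto_compose[OF _ y[OF that]])
    show "continuous_on UNIV (cf f k)" by (rule continuous_on_cf)
  qed auto
  have carr [simp]: "P n \<in> carrier_mat (n + 1) (n + 1)" "P' n \<in> carrier_mat (n + 1) (n + 1)"
    "W n \<in> carrier_mat (n + 1) (n + 1)" "D n \<in> carrier_mat (n + 1) (n + 1)" for n
    by (simp_all add: P_def P'_def W_def D_def)
  have gap_eq: "gap n (freeze v x) (freeze X x) i m = (\<Sum>\<^sub>\<infinity>k\<in>{..<0}. cf v (k - i) x * cf X (m - k) x)"
    if "i \<in> idx n" for n i m
    using gap_lower[of "freeze v x" i n "freeze X x" m] that v(1) by (simp add: lower_def)
  have neg_summable: "(\<lambda>k. cf f (k - i) z * cf g (j - k) z) summable_on A" for f g i j z and A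
    by (rule summable_on_subset[OF has_sum_imp_summable[OF cf_mult_shift]]) auto

  have DW: "D n * W n = imat n (\<lambda>i j. \<Sum>\<^sub>\<infinity>k\<in>{..<0}. cf v (k - i) x * Z n k j)" for n
    unfolding D_def W_def kms_def imat_mult
  proof (rule imat_eqI)
    fix i j assume ij: "i \<in> idx n" "j \<in> idx n"
    have "((\<lambda>k. \<Sum>m\<in>idx n. (cf v (k - i) x * cf X (m - k) x) * cf Y (j - m) x) has_sum
        (\<Sum>m\<in>idx n. gap n (freeze v x) (freeze X x) i m * cf Y (j - m) x)) {..<0}"
      unfolding gap_eq[OF ij(1)]
      by (intro has_sum_finite_sum has_sum_cmult_left has_sum_infsum neg_summable) auto
    then show "(\<Sum>k\<in>idx n. gap n (freeze v x) (freeze X x) i k * cf (freeze Y x) (j - k) (node n k j)) =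
        (\<Sum>\<^sub>\<infinity>k\<in>{..<0}. cf v (k - i) x * Z n k j)"
      by (simp add: infsumI Z_def sum_distrib_left mult.assoc)
  qed
  \<comment> \<open>Entrywise the corner matrix and \<open>D n * W n\<close> have the same limit,
    and \<open>corner_tannery\<close> sums the differences.\<close>
  have first: "(\<lambda>n. entry_norm (imat n (C n) - D n * W n)) \<longlonglongrightarrow> 0"
  proof -
    let ?F = "\<lambda>n i k j. cmod (cf v (k - i) (y n i j) * cf b (j - k) (y n i j) - cf v (k - i) x * Z n k j)"
    have F_le: "?F n i k j \<le> wn v (k - i) * B (j - k)" for n i j k
    proof -
      have "?F n i k j \<le> wn v (k - i) * wn b (j - k) + wn v (k - i) * h (j - k)"
        by (rule order_trans[OF norm_triangle_ineq4])
          (auto simp: norm_mult intro!: add_mono mult_mono norm_cf_le Z_le)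
      then show ?thesis by (simp add: B_def distrib_left)
    qed
    have F_lim: "(\<lambda>n. \<Sum>i\<in>idx n. \<Sum>j\<in>idx n. \<Sum>\<^sub>\<infinity>k\<in>{..<0}. ?F n i k j) \<longlonglongrightarrow> 0"
    proof (rule corner_tannery[OF v(3) Bs B0])
      show "(\<lambda>n. ?F n i k j) \<longlonglongrightarrow> 0" if "0 \<le> i" "0 \<le> j" for i j k
      proof -
        have "(\<lambda>n. cf v (k - i) (y n i j) * cf b (j - k) (y n i j) - cf v (k - i) x * Z n k j) \<longlonglongrightarrow>
            cf v (k - i) x * cf b (j - k) x - cf v (k - i) x * cf b (j - k) x"
          by (intro tendsto_intros cf_lim Z_lim that)
        then show ?thesis
          by (intro tendsto_norm_zero) simp
      qed
    qed (use F_le in auto)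
    have "entry_norm (imat n (C n) - D n * W n) \<le>
        (\<Sum>i\<in>idx n. \<Sum>j\<in>idx n. \<Sum>\<^sub>\<infinity>k\<in>{..<0}. ?F n i k j)" for n
      unfolding DW imat_minus entry_norm_imat
    proof (intro sum_mono)
      fix i j assume ij: "i \<in> idx n" "j \<in> idx n"
      let ?G = "\<lambda>k. wn v (k - i) * B (j - k)"
      have "(\<lambda>k. wn v (k - i) * h (j - k)) summable_on UNIV"
      proof (rule summable_on_comparison_test)
        have "(\<lambda>k. wn v (k - i) * (norm X * norm Y)) summable_on UNIV"
          using has_sum_shift[of "wn v" i] has_sum_norm_wcoeff[of v]
          by (intro summable_on_cmult_left) (auto simp: summable_on_def)
        then show "(\<lambda>k. wn v (k - i) * (norm X * norm Y)) summable_on UNIV" .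
        have "h l \<le> norm X * norm Y" for l
        proof -
          have "(h has_sum norm X * norm Y) UNIV"
            using has_sum_SigmaD[OF convolution_norms[of X Y], of h] convolution_norm_summable[of X Y]
            by (simp add: h_def)
          then have "(\<Sum>l\<in>{l}. h l) \<le> norm X * norm Y"
            by (rule finite_sum_le_has_sum) (use h0 in auto)
          then show ?thesis by simp
        qed
        then show "wn v (k - i) * h (j - k) \<le> wn v (k - i) * (norm X * norm Y)" for k
          by (intro mult_left_mono) auto
      qed (use h0 in auto)
      then have Gs: "?G summable_on {..<0}"
        unfolding B_def distrib_left
        by (intro summable_on_add wn_mult_shift_summable) (auto intro: summable_on_subset)

      have Fs: "(\<lambda>k. ?F n i k j) summable_on {..<0}"
        by (rule summable_on_comparison_test[OF Gs]) (use F_le in auto)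
      have Zs: "(\<lambda>k. cf v (k - i) x * Z n k j) summable_on {..<0}"
        by (rule abs_summable_summable, rule summable_on_comparison_test[OF Gs])
          (use B0 in \<open>auto simp: norm_mult B_def intro!: mult_mono norm_cf_le order_trans[OF Z_le]\<close>)
      have C_eq: "C n i j - (\<Sum>\<^sub>\<infinity>k\<in>{..<0}. cf v (k - i) x * Z n k j) =
          (\<Sum>\<^sub>\<infinity>k\<in>{..<0}. cf v (k - i) (y n i j) * cf b (j - k) (y n i j) - cf v (k - i) x * Z n k j)"
        unfolding C_def
        using infsumI[OF has_sum_add[OF has_sum_infsum[OF neg_summable] has_sum_uminusI[OF has_sum_infsum[OF Zs]]]]
        by simp
      show "cmod (C n i j - (\<Sum>\<^sub>\<infinity>k\<in>{..<0}. cf v (k - i) x * Z n k j)) \<le> (\<Sum>\<^sub>\<infinity>k\<in>{..<0}. ?F n i k j)"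
        unfolding C_eq by (rule norm_infsum_bound) (use Fs in simp)
    qed
    moreover have "entry_norm A \<ge> 0" for A
      by (simp add: entry_norm_def sum_nonneg)
    ultimately have "\<forall>\<^sub>F n in sequentially. norm (entry_norm (imat n (C n) - D n * W n)) \<le>
        (\<Sum>i\<in>idx n. \<Sum>j\<in>idx n. \<Sum>\<^sub>\<infinity>k\<in>{..<0}. ?F n i k j)"
      by (intro always_eventually allI) (simp only: real_norm_def abs_of_nonneg)
    from Lim_null_comparison[OF this F_lim] show ?thesis .
  qed

  \<comment> \<open>Row sums of the difference of \<open>P n * W n\<close> and the true matrix:
    bounded by \<open>\<rho>\<close> in every row, but shown to vanish in the limit only for a fixed
    row.\<close>
  define r where "r = (\<lambda>n i. \<Sum>j\<in>idx n. cmod (Z n i j - T n i j))"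
  have diff_le: "cmod (Z n i j - T n i j) \<le> B (j - i)" for n i j
    unfolding B_def T_def using norm_triangle_ineq4[of "Z n i j" "cf b (j - i) (y n i j)"]
      Z_le[of n i j] norm_cf_le[of b "j - i" "y n i j"] by linarith
  have r0: "r n i \<ge> 0" for n i
    by (simp add: r_def sum_nonneg)
  define \<rho> where "\<rho> = (\<Sum>\<^sub>\<infinity>l. B l)"
  have r_le: "r n i \<le> \<rho>" for n i
  proof -
    have "r n i \<le> (\<Sum>j\<in>idx n. B (j - i))"
      unfolding r_def by (intro sum_mono diff_le)
    also have "\<dots> = sum B ((\<lambda>j. j - i) ` idx n)"
      by (subst sum.reindex) (auto simp: inj_on_def)
    also have "\<dots> \<le> \<rho>"
      unfolding \<rho>_def by (rule finite_sum_le_infsum[OF Bs]) (use B0 in auto)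
    finally show ?thesis .
  qed
  have \<rho>0: "\<rho> \<ge> 0"
    using r0[of 0 0] r_le[of 0 0] by linarith
  have r_lim: "(\<lambda>n. r n i) \<longlonglongrightarrow> 0" if "0 \<le> i" for i
    unfolding r_def
  proof (rule tannery_null_sum)
    show "(\<lambda>j. B (j - i)) summable_on UNIV"
      using Bs has_sum_shift[of B i] by (auto simp: summable_on_def)
    fix j
    show "(\<lambda>n. if j \<in> idx n then cmod (Z n i j - T n i j) else 0) \<longlonglongrightarrow> 0"
    proof (cases "0 \<le> j")
      case True
      have "(\<lambda>n. Z n i j - T n i j) \<longlonglongrightarrow> cf b (j - i) x - cf b (j - i) x"
        unfolding T_def by (intro tendsto_intros cf_lim Z_lim that True)
      then have "(\<lambda>n. cmod (Z n i j - T n i j)) \<longlonglongrightarrow> 0"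
        by (intro tendsto_norm_zero) simp
      then show ?thesis
        by (rule Lim_null_comparison[rotated]) (auto intro!: always_eventually)
    qed simp
  qed (use diff_le B0 in auto)
  \<comment> \<open>Up to \<open>\<kappa>\<close>, this will bound the entries in row
    \<open>m\<close> of \<open>P' n\<close> times the difference times the inverse.\<close>
  define R where "R = (\<lambda>n m. \<Sum>i\<in>idx n. wn X' (i - m) * r n i)"
  have R0: "R n m \<ge> 0" for n m
    using r0 by (simp add: R_def sum_nonneg)
  have R_le: "R n m \<le> norm X' * \<rho>" for n m
  proof -
    have "R n m \<le> (\<Sum>i\<in>idx n. wn X' (i - m)) * \<rho>"
      unfolding R_def sum_distrib_right by (intro sum_mono mult_left_mono r_le) auto
    also have "\<dots> \<le> norm X' * \<rho>"
      using \<rho>0 by (intro mult_right_mono sum_wn_le) (auto simp: inj_on_def)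
    finally show ?thesis .
  qed
  have R_lim: "(\<lambda>n. R n m) \<longlonglongrightarrow> 0" for m
    unfolding R_def
  proof (rule tannery_null_sum)
    show "(\<lambda>i. wn X' (i - m) * \<rho>) summable_on UNIV"
      using has_sum_shift[of "wn X'" m] has_sum_norm_wcoeff[of X']
      by (intro summable_on_cmult_left) (auto simp: summable_on_def)
    fix i
    show "(\<lambda>n. if i \<in> idx n then wn X' (i - m) * r n i else 0) \<longlonglongrightarrow> 0"
    proof (cases "0 \<le> i")
      case True
      then have "(\<lambda>n. wn X' (i - m) * r n i) \<longlonglongrightarrow> 0"
        by (intro tendsto_mult_right_zero r_lim)
      then show ?thesis
        by (rule Lim_null_comparison[rotated]) (use r0 in \<open>auto intro!: always_eventually\<close>)
    qed simp
  qed (use r0 r_le \<rho>0 in \<open>auto intro!: mult_left_mono\<close>)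
  \<comment> \<open>Up to \<open>\<kappa>\<close>, a majorant of the remaining trace. Since the
    entries of \<open>D n\<close> are dominated by corner weights, convergence of
    \<open>R n m\<close> for each fixed \<open>m\<close> is enough.\<close>
  define Q where "Q = (\<lambda>n. \<Sum>k\<in>idx n. \<Sum>m\<in>idx n. \<Sum>\<^sub>\<infinity>l\<in>{..<0}. wn v (l - k) * (R n m * wn X (m - l)))"
  have Q_lim: "Q \<longlonglongrightarrow> 0"
    unfolding Q_def
  proof (rule corner_tannery[OF v(3), where B = "\<lambda>l. norm X' * \<rho> * wn X l"])
    show "(\<lambda>l. norm X' * \<rho> * wn X l) summable_on UNIV"
      by (intro summable_on_cmult_right wcoeff_summable)
    show "0 \<le> wn v (k - i) * (R n j * wn X (j - k)) \<and>
        wn v (k - i) * (R n j * wn X (j - k)) \<le> wn v (k - i) * (norm X' * \<rho> * wn X (j - k))" for n i j k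
      using R0 R_le by (auto intro!: mult_left_mono mult_right_mono)
    show "(\<lambda>n. wn v (k - i) * (R n j * wn X (j - k))) \<longlonglongrightarrow> 0" for i j k
      by (intro tendsto_mult_right_zero tendsto_mult_left_zero R_lim)
  qed (use \<rho>0 in auto)

  have bound: "cmod (mtrace (imat n (S n) * imat n (C n)) - mtrace (P' n * D n)) \<le>
      \<kappa> * entry_norm (imat n (C n) - D n * W n) + \<kappa> * Q n" if n: "n \<ge> n0" for n
  proof -
    let ?S = "imat n (S n)" and ?C = "imat n (C n)" and ?T = "imat n (T n)"
    define N where "N = n + 1"
    let ?\<Delta> = "P n * W n - ?T"
    have imat_c [simp]: "imat n F \<in> carrier_mat N N" for F
      by (simp add: N_def)
    have carr_N [simp]: "P n \<in> carrier_mat N N" "P' n \<in> carrier_mat N N" "W n \<in> carrier_mat N N"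
      "D n \<in> carrier_mat N N"
      unfolding N_def by (rule carr)+
    have mult_c [simp]: "A * B \<in> carrier_mat N N" if "A \<in> carrier_mat N N" "B \<in> carrier_mat N N"
      for A B :: "complex mat"
      using that by (rule mult_carrier_mat)
    have minus_c [simp]: "A - B \<in> carrier_mat N N" if "B \<in> carrier_mat N N" for A B :: "complex mat"
      using that by (rule minus_carrier_mat)
    note assoc = assoc_mult_mat[of _ N N _ N _ N]
    have TS: "?T * ?S = 1\<^sub>m N"
      using S(1)[OF n] unfolding T_def N_def .
    have PP: "P' n * P n = 1\<^sub>m N"
      using kms_freeze_mult_upper[OF X(2,1), of n x] X(3)
      by (simp add: P_def P'_def N_def mult.commute freeze_one kms_one)
    have \<kappa>0: "\<kappa> \<ge> 0"
    proof -
      have "0 \<le> (\<Sum>j\<in>idx n. cmod (S n 0 j))"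
        by (simp add: sum_nonneg)
      also have "\<dots> \<le> \<kappa>"
        using S(2)[OF n] by (auto simp: row_le_imat)
      finally show ?thesis .
    qed
    \<comment> \<open>As \<open>?T * ?S\<close> is the identity and \<open>P' n\<close> inverts
      \<open>P n\<close>, \<open>e1\<close> and \<open>e2\<close> exhibit \<open>W n * ?S\<close> as
      \<open>P' n\<close> plus a correction containing the difference matrix.\<close>
    have e1: "?\<Delta> * ?S = P n * (W n * ?S) - 1\<^sub>m N"
      by (subst minus_mult_distrib_mat[of _ N N _ _ N]) (auto simp: assoc TS)
    have e2: "P' n * (?\<Delta> * ?S) = W n * ?S - P' n"
    proof -
      have "P' n * (?\<Delta> * ?S) = P' n * (P n * (W n * ?S)) - P' n * 1\<^sub>m N"
        unfolding e1 by (rule mult_minus_distrib_mat[of _ N N _ N]) auto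
      also have "P' n * (P n * (W n * ?S)) = (P' n * P n) * (W n * ?S)"
        by (rule assoc[symmetric]) auto
      also have "\<dots> = W n * ?S"
        unfolding PP by (rule left_mult_one_mat[of _ N N]) auto
      also have "P' n * 1\<^sub>m N = P' n"
        by (rule right_mult_one_mat[of _ N N]) auto
      finally show ?thesis .
    qed
    have "mtrace (?S * (D n * W n)) = mtrace ((W n * ?S) * D n)"
    proof -
      have "mtrace (?S * (D n * W n)) = mtrace ((?S * D n) * W n)"
        by (subst assoc[symmetric]) auto
      also have "\<dots> = mtrace (W n * (?S * D n))"
        by (rule mtrace_mult_comm[of _ N]) auto
      also have "W n * (?S * D n) = (W n * ?S) * D n"
        by (rule assoc[symmetric]) auto
      finally show ?thesis .
    qed
    also have "W n * ?S = P' n + P' n * (?\<Delta> * ?S)"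
      unfolding e2 using carrier_matD[OF carr_N(2)] carrier_matD[OF carr_N(3)]
      by (intro eq_matI) (auto simp: N_def)
    also have "mtrace ((P' n + P' n * (?\<Delta> * ?S)) * D n) =
        mtrace (P' n * D n) + mtrace ((P' n * (?\<Delta> * ?S)) * D n)"
      by (subst add_mult_distrib_mat[of _ N N _ _ N]) (auto intro!: mtrace_add[of _ N])
    finally have split2: "mtrace (?S * (D n * W n)) =
        mtrace (P' n * D n) + mtrace ((P' n * (?\<Delta> * ?S)) * D n)" .
    have "?C = (?C - D n * W n) + D n * W n"
      using carrier_matD[OF carr_N(3)] carrier_matD[OF carr_N(4)]
      by (intro eq_matI) (auto simp: N_def)
    then have "?S * ?C = ?S * ((?C - D n * W n) + D n * W n)"
      by simp
    also have "\<dots> = ?S * (?C - D n * W n) + ?S * (D n * W n)"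
      by (rule mult_add_distrib_mat[of _ N N _ N]) auto
    finally have "mtrace (?S * ?C) = mtrace (?S * (?C - D n * W n)) + mtrace (?S * (D n * W n))"
      by (simp only:) (rule mtrace_add[of _ N]; auto)
    then have eq: "mtrace (?S * ?C) - mtrace (P' n * D n) =
        mtrace (?S * (?C - D n * W n)) + mtrace ((P' n * (?\<Delta> * ?S)) * D n)"
      unfolding split2 by simp
    have le1: "cmod (mtrace (?S * (?C - D n * W n))) \<le> \<kappa> * entry_norm (?C - D n * W n)"
      by (rule norm_mtrace_mult_le[of _ N]) (use S(2)[OF n] in auto)
    have \<Delta>: "?\<Delta> = imat n (\<lambda>i j. Z n i j - T n i j)"
      unfolding P_def W_def kms_def imat_mult imat_minus by (rule imat_eqI) (simp add: Z_def)
    define M where "M = (\<lambda>m k. \<Sum>i\<in>idx n. cf X' (i - m) x * (\<Sum>j\<in>idx n. (Z n i j - T n i j) * S n j k))"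
    have M: "P' n * (?\<Delta> * ?S) = imat n M"
      unfolding \<Delta> unfolding P'_def kms_def imat_mult M_def by (rule imat_eqI) simp
    have M_le: "cmod (M m k) \<le> \<kappa> * R n m" if "k \<in> idx n" "m \<in> idx n" for m k
    proof -
      have "cmod (M m k) \<le> (\<Sum>i\<in>idx n. wn X' (i - m) * (\<Sum>j\<in>idx n. cmod (Z n i j - T n i j) * \<kappa>))"
        unfolding M_def
      proof (rule sum_norm_le)
        fix i assume "i \<in> idx n"
        have "cmod (S n j k) \<le> \<kappa>" if "j \<in> idx n" for j
        proof -
          have "cmod (S n j k) \<le> (\<Sum>k\<in>idx n. cmod (S n j k))"
            by (rule member_le_sum) (use \<open>k \<in> idx n\<close> in auto)
          also have "\<dots> \<le> \<kappa>"
            using S(2)[OF n] that by (auto simp: row_le_imat)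
          finally show ?thesis .
        qed
        then show "cmod (cf X' (i - m) x * (\<Sum>j\<in>idx n. (Z n i j - T n i j) * S n j k)) \<le>
            wn X' (i - m) * (\<Sum>j\<in>idx n. cmod (Z n i j - T n i j) * \<kappa>)"
          unfolding norm_mult
          by (intro mult_mono norm_cf_le sum_norm_le) (auto simp: norm_mult intro!: mult_left_mono)
      qed
      also have "\<dots> = \<kappa> * R n m"
        unfolding R_def r_def by (simp add: sum_distrib_left sum_distrib_right mult_ac)
      finally show ?thesis .
    qed
    have D_le: "cmod (gap n (freeze v x) (freeze X x) k m) \<le> (\<Sum>\<^sub>\<infinity>l\<in>{..<0}. wn v (l - k) * wn X (m - l))"
      if "k \<in> idx n" for k m
      unfolding gap_eq[OF that]
      by (rule norm_infsum_le[OF has_sum_infsum[OF neg_summable] has_sum_infsum[OF wn_mult_shift_summable]])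
        (auto simp: norm_mult intro!: mult_mono norm_cf_le)
    have "mtrace ((P' n * (?\<Delta> * ?S)) * D n) =
        (\<Sum>m\<in>idx n. \<Sum>k\<in>idx n. M m k * gap n (freeze v x) (freeze X x) k m)"
      unfolding M D_def imat_mult mtrace_imat ..
    also have "cmod \<dots> \<le> (\<Sum>m\<in>idx n. \<Sum>k\<in>idx n. (\<kappa> * R n m) * (\<Sum>\<^sub>\<infinity>l\<in>{..<0}. wn v (l - k) * wn X (m - l)))"
      using M_le D_le R0 \<kappa>0 by (intro sum_norm_le) (auto simp: norm_mult intro!: mult_mono)
    also have "\<dots> = \<kappa> * Q n"
    proof -
      have "R n m * (\<Sum>\<^sub>\<infinity>l\<in>{..<0}. wn v (l - k) * wn X (m - l)) =
          (\<Sum>\<^sub>\<infinity>l\<in>{..<0}. wn v (l - k) * (R n m * wn X (m - l)))" for k m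
        unfolding infsum_cmult_right'[symmetric] by (simp only: mult.left_commute)
      then have "(\<Sum>m\<in>idx n. \<Sum>k\<in>idx n. (\<kappa> * R n m) * (\<Sum>\<^sub>\<infinity>l\<in>{..<0}. wn v (l - k) * wn X (m - l))) =
          (\<Sum>m\<in>idx n. \<Sum>k\<in>idx n. \<kappa> * (\<Sum>\<^sub>\<infinity>l\<in>{..<0}. wn v (l - k) * (R n m * wn X (m - l))))"
        by (simp only: mult.assoc)
      also have "\<dots> = (\<Sum>k\<in>idx n. \<Sum>m\<in>idx n. \<kappa> * (\<Sum>\<^sub>\<infinity>l\<in>{..<0}. wn v (l - k) * (R n m * wn X (m - l))))"
        by (rule sum.swap)
      also have "\<dots> = \<kappa> * Q n"
        by (simp only: Q_def sum_distrib_left)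
      finally show ?thesis .
    qed
    finally show ?thesis
      unfolding eq using le1 by (intro norm_triangle_mono)
  qed
  have "(\<lambda>n. \<kappa> * entry_norm (imat n (C n) - D n * W n) + \<kappa> * Q n) \<longlonglongrightarrow> \<kappa> * 0 + \<kappa> * 0"
    by (intro tendsto_intros first Q_lim)
  then have "(\<lambda>n. \<kappa> * entry_norm (imat n (C n) - D n * W n) + \<kappa> * Q n) \<longlonglongrightarrow> 0"
    by simp
  then have "(\<lambda>n. mtrace (imat n (S n) * imat n (C n)) - mtrace (P' n * D n)) \<longlonglongrightarrow> 0"
    by (rule Lim_null_comparison[rotated]) (use bound in \<open>auto simp: eventually_sequentially\<close>)
  moreover have "(\<lambda>n. mtrace (P' n * D n)) \<longlonglongrightarrow> - cf (X't * (v * X)) 0 x"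
    unfolding P'_def D_def by (rule mtrace_frozen_corner_tendsto[OF v(1,2) X])
  ultimately show ?thesis
    unfolding C_def using Lim_transform by fastforce
qed

text \<open>Reflecting in the antidiagonal turns the corner at \<open>(n, n)\<close> into one at \<open>(0, 0)\<close> and keeps the
  difference of the indices, so both corners are covered by \<open>corner_trace_tendsto\<close>.\<close>

definition flip :: "nat \<Rightarrow> (int \<Rightarrow> int \<Rightarrow> complex) \<Rightarrow> int \<Rightarrow> int \<Rightarrow> complex" where
  "flip n F i j = F (int n - j) (int n - i)"

lemma sum_idx_flip: "(\<Sum>k\<in>idx n. f (int n - k)) = (\<Sum>k\<in>idx n. f k)"
  by (rule sum.reindex_bij_witness[of _ "\<lambda>k. int n - k" "\<lambda>k. int n - k"]) auto

text \<open>Reflection in the antidiagonal reverses products, so a left inverse becomes a right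
  inverse.\<close>

lemma flip_mult_one:
  assumes "imat n G * imat n F = 1\<^sub>m (n + 1)"
  shows "imat n (flip n F) * imat n (flip n G) = 1\<^sub>m (n + 1)"
  unfolding imat_mult imat_one
proof (rule imat_eqI)
  fix i j assume ij: "i \<in> idx n" "j \<in> idx n"
  have "(\<Sum>k\<in>idx n. flip n F i k * flip n G k j) = (\<Sum>k\<in>idx n. G (int n - j) k * F k (int n - i))"
    unfolding sum_idx_flip[of "\<lambda>k. G (int n - j) k * F k (int n - i)" n, symmetric]
    by (simp add: flip_def mult.commute)
  also have "\<dots> = (imat n G * imat n F) $$ (nat (int n - j), nat (int n - i))"
    unfolding imat_mult by (subst index_imat) (use ij in auto)
  also have "\<dots> = (if i = j then 1 else 0)"
    unfolding assms using ij by auto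
  finally show "(\<Sum>k\<in>idx n. flip n F i k * flip n G k j) = (if i = j then 1 else 0)" .
qed

lemma mtrace_flip: "mtrace (imat n (flip n F) * imat n (flip n G)) = mtrace (imat n F * imat n G)"
proof -
  have "mtrace (imat n (flip n F) * imat n (flip n G)) =
      (\<Sum>i\<in>idx n. \<Sum>j\<in>idx n. F (int n - j) (int n - i) * G (int n - i) (int n - j))"
    unfolding imat_mult mtrace_imat by (simp add: flip_def)
  also have "\<dots> = (\<Sum>i\<in>idx n. \<Sum>j\<in>idx n. F j i * G i j)"
    unfolding sum_idx_flip[of "\<lambda>j. F j (int n - _) * G (int n - _) j"]
    by (rule sum_idx_flip[of "\<lambda>i. \<Sum>j\<in>idx n. F j i * G i j"])
  also have "\<dots> = mtrace (imat n F * imat n G)"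
    unfolding imat_mult mtrace_imat by (rule sum.swap)
  finally show ?thesis .
qed

lemma row_le_flip:
  assumes "col_le (imat n F) c"
  shows "row_le (imat n (flip n F)) c"
  unfolding row_le_imat
proof
  fix i assume i: "i \<in> idx n"
  have "(\<Sum>j\<in>idx n. cmod (flip n F i j)) = (\<Sum>j\<in>idx n. cmod (F j (int n - i)))"
    unfolding flip_def by (rule sum_idx_flip[of "\<lambda>j. cmod (F j (int n - i))"])
  also have "\<dots> \<le> c"
    using assms i by (auto simp: col_le_imat)
  finally show "(\<Sum>j\<in>idx n. cmod (flip n F i j)) \<le> c" .
qed

text \<open>With \<open>v\<close> as the second factor only \<open>k > n\<close> survives, and
  \<open>k\<close> to \<open>n - k\<close> carries this range to \<open>k < 0\<close>, the form used
  at the other corner.\<close>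

lemma gap_flip:
  assumes "lower v" "i \<in> idx n" "j \<in> idx n"
  shows "flip n (gap n b v) i j = (\<Sum>\<^sub>\<infinity>k\<in>{..<0}. cf v (k - i) (node n (int n - j) (int n - i)) *
    cf b (j - k) (node n (int n - j) (int n - i)))"
proof -
  let ?x = "node n (int n - j) (int n - i)"
  have "flip n (gap n b v) i j = (\<Sum>\<^sub>\<infinity>k\<in>- idx n. cf b (k - (int n - j)) ?x * cf v (int n - i - k) ?x)"
    by (simp add: flip_def gap_def)
  also have "\<dots> = (\<Sum>\<^sub>\<infinity>k\<in>{int n<..}. cf b (k - (int n - j)) ?x * cf v (int n - i - k) ?x)"
    by (rule infsum_cong_neutral) (use assms in \<open>auto simp: lower_def\<close>)
  also have "\<dots> = (\<Sum>\<^sub>\<infinity>k\<in>{..<0}. cf v (k - i) ?x * cf b (j - k) ?x)"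
    by (rule infsum_reindex_bij_witness[of _ "\<lambda>k. int n - k" "\<lambda>k. int n - k"])
      (auto simp: algebra_simps)
  finally show ?thesis .
qed

subsection \<open>Scalars and size bounds\<close>

text \<open>\<open>symbol\<close> is a real algebra; the complex parameter enters as a constant
  symbol.\<close>

definition cs :: "complex \<Rightarrow> symbol" where
  "cs s = Wiener (\<lambda>k. if k = 0 then const_bcontfun s else 0)"

lemma wcoeff_cs: "wcoeff (cs s) k = (if k = 0 then const_bcontfun s else 0)"
proof -
  have "(\<lambda>k :: int. norm (if k = 0 then const_bcontfun s else 0 :: real \<Rightarrow>\<^sub>C complex)) summable_on UNIV"
    by (rule finite_nonzero_values_imp_summable_on) (simp add: Collect_conv_if)
  then show ?thesis
    unfolding cs_def by (simp add: Wiener_inverse)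
qed

lemma cf_cs_mult [simp]: "cf (cs s * f) k x = s * cf f k x"
proof -
  have "((\<lambda>p. cf (cs s) p x * cf f (k - p) x) has_sum s * cf f k x) UNIV"
    by (rule has_sum_finite_neutralI[of "{0}"]) (auto simp: cf_def wcoeff_cs)
  then show ?thesis
    using cf_mult[of "cs s" x f k] has_sum_unique by blast
qed

lemma cs_power: "(cs s * v) ^ n = cs (s ^ n) * v ^ n"
proof -
  have "cs s * (cs r * f) = cs (s * r) * f" for r f
    by (rule symbol_eqI) (simp add: mult.assoc)
  then have step: "(cs s * v) * (cs r * f) = cs (s * r) * (v * f)" for r f
    by (metis mult.assoc mult.left_commute)
  have "cs 1 = 1"
    by (rule symbol_eqI) (simp add: cf_def wcoeff_cs wcoeff_one)
  then show ?thesis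
    by (induction n) (simp_all add: step)
qed

lemma norm_cs_mult: "norm (cs s * f) \<le> cmod s * norm f"
proof -
  have "norm (cs s) \<le> cmod s"
  proof -
    have "((\<lambda>k. wn (cs s) k) has_sum norm (const_bcontfun s :: real \<Rightarrow>\<^sub>C complex)) UNIV"
      by (rule has_sum_finite_neutralI[of "{0}"]) (auto simp: wcoeff_cs)
    then have "norm (cs s) = norm (const_bcontfun s :: real \<Rightarrow>\<^sub>C complex)"
      using has_sum_norm_wcoeff has_sum_unique by blast
    also have "\<dots> \<le> cmod s"
      by (rule norm_bound) simp
    finally show ?thesis .
  qed
  then show ?thesis
    by (meson mult_right_mono norm_ge_zero norm_mult_ineq order_trans)
qed

lemma t_deriv_cs_mult: "t_deriv f g \<Longrightarrow> t_deriv (cs s * f) (cs s * g)"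
  by (simp add: t_deriv_def)

lemma x_deriv_cs_mult:
  assumes "x_deriv f g"
  shows "x_deriv (cs s * f) (cs s * g)"
proof -
  have "cf (cs s * f) k = (\<lambda>x. s * cf f k x)" for k
    by auto
  then show ?thesis
    using assms unfolding x_deriv_def by (auto intro!: derivative_eq_intros)
qed

text \<open>In \<open>s\<close> this is an everywhere convergent power series with coefficients
  \<open>cf (f * v ^ n) k x / fact n\<close>, and \<open>diffs\<close> turns them into those of
  \<open>f * v\<close>.\<close>

lemma has_field_derivative_cf_exp:
  "((\<lambda>s. cf (f * exp (cs s * v)) k x) has_field_derivative cf (f * v * exp (cs s * v)) k x) (at s)"
proof -
  define c where "c = (\<lambda>g n. cf (g * v ^ n) k x / fact n)"
  have sums: "(\<lambda>n. c g n * s ^ n) sums cf (g * exp (cs s * v)) k x" for g s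
  proof -
    have "(\<lambda>n. cf (g * ((cs s * v) ^ n /\<^sub>R fact n)) k x) sums cf (g * exp (cs s * v)) k x"
      by (rule bounded_linear.sums[OF bounded_linear_cf sums_mult[OF exp_converges]])
    moreover have "cf (g * ((cs s * v) ^ n /\<^sub>R fact n)) k x = c g n * s ^ n" for n
    proof -
      have "g * ((cs s * v) ^ n /\<^sub>R fact n) = (cs (s ^ n) * (g * v ^ n)) /\<^sub>R fact n"
        unfolding cs_power mult_scaleR_right by (simp only: mult.left_commute)
      then have "cf (g * ((cs s * v) ^ n /\<^sub>R fact n)) k x = inverse (fact n) *\<^sub>R (s ^ n * cf (g * v ^ n) k x)"
        by (simp only: cf_simps cf_cs_mult)
      then show ?thesis
        by (simp add: c_def scaleR_conv_of_real divide_inverse)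
    qed
    ultimately show ?thesis by simp
  qed
  have "((\<lambda>s. \<Sum>n. c f n * s ^ n) has_field_derivative (\<Sum>n. diffs (c f) n * s ^ n)) (at s)"
    by (rule termdiffs_strong_converges_everywhere[OF sums_summable[OF sums]])
  moreover have "diffs (c f) = c (f * v)"
    by (rule ext) (simp add: diffs_def c_def mult.assoc divide_simps del: of_nat_Suc)
  ultimately show ?thesis
    using sums_unique[OF sums] by simp
qed

text \<open>One constant for a symbol and both of its derivatives, which makes the error of a matrix
  product uniform for \<open>s\<close> in a disc.\<close>

definition sbound :: "symbol \<Rightarrow> real \<Rightarrow> bool" where
  "sbound f K \<longleftrightarrow> norm f \<le> K \<and> (\<exists>g. x_deriv f g \<and> norm g \<le> K) \<and> (\<exists>g. t_deriv f g \<and> norm g \<le> K)"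

lemma sbound_mono: "sbound f K \<Longrightarrow> K \<le> L \<Longrightarrow> sbound f L"
  unfolding sbound_def by (meson order_trans)

lemma sbound_nonneg: "sbound f K \<Longrightarrow> 0 \<le> K"
  unfolding sbound_def by (meson norm_ge_zero order_trans)

lemma sbound_mult:
  assumes "sbound f K" "sbound g L"
  shows "sbound (f * g) (2 * (K * L))"
proof -
  have K: "0 \<le> K" "0 \<le> L"
    using assms by (auto intro: sbound_nonneg)
  have prod: "norm (a * b) \<le> K * L" if "norm a \<le> K" "norm b \<le> L" for a b :: symbol
    by (rule order_trans[OF norm_mult_ineq]) (use that K in \<open>auto intro!: mult_mono\<close>)
  have sum: "norm (f * b + a * g) \<le> 2 * (K * L)" if "norm a \<le> K" "norm b \<le> L" for a b
    using norm_triangle_mono[OF prod[of f b] prod[of a g]] that assms by (simp add: sbound_def)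
  have "0 \<le> K * L"
    using K by simp
  then have "norm (f * g) \<le> 2 * (K * L)"
    using prod[of f g] assms unfolding sbound_def by linarith
  then show ?thesis
    using assms sum x_deriv_mult t_deriv_mult unfolding sbound_def by blast
qed

lemma sbound_exp_cs:
  assumes "x_deriv v vx" "t_deriv v vt" "cmod s \<le> r"
  shows "sbound (exp (cs s * v)) ((1 + r * norm vx + r * norm vt) * exp (r * norm v))"
proof -
  have r: "0 \<le> r" using assms(3) norm_ge_zero order_trans by blast
  have le: "norm (cs s * g) \<le> r * norm g" for g
    by (rule order_trans[OF norm_cs_mult]) (use assms(3) in \<open>auto intro!: mult_right_mono\<close>)
  have e: "norm (exp (cs s * v)) \<le> exp (r * norm v)"
    using norm_exp[of "cs s * v"] le[of v] by (meson exp_le_cancel_iff order_trans)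
  have d: "norm (cs s * g * exp (cs s * v)) \<le> (r * norm g) * exp (r * norm v)" for g
    by (rule order_trans[OF norm_mult_ineq]) (use e le r in \<open>auto intro!: mult_mono\<close>)
  have mono: "c * exp (r * norm v) \<le> (1 + r * norm vx + r * norm vt) * exp (r * norm v)"
    if "c = 1 \<or> c = r * norm vx \<or> c = r * norm vt" for c
    using that r by (intro mult_right_mono) auto
  have "norm (exp (cs s * v)) \<le> (1 + r * norm vx + r * norm vt) * exp (r * norm v)"
    using e mono[of 1] by linarith
  moreover have "norm (cs s * vx * exp (cs s * v)) \<le> (1 + r * norm vx + r * norm vt) * exp (r * norm v)"
    using d[of vx] mono[of "r * norm vx"] by linarith
  moreover have "norm (cs s * vt * exp (cs s * v)) \<le> (1 + r * norm vx + r * norm vt) * exp (r * norm v)"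
    using d[of vt] mono[of "r * norm vt"] by linarith
  ultimately show ?thesis
    unfolding sbound_def
  proof (intro conjI exI)
    show "x_deriv (exp (cs s * v)) (cs s * vx * exp (cs s * v))"
      by (intro x_deriv_exp x_deriv_cs_mult assms)
    show "t_deriv (exp (cs s * v)) (cs s * vt * exp (cs s * v))"
      by (intro t_deriv_exp t_deriv_cs_mult assms)
  qed
qed

lemma kms_mult_sbound:
  assumes "sbound f K" "sbound g L"
  obtains E where "E \<in> carrier_mat (n + 1) (n + 1)" "kms n f * kms n g = kms n (f * g) + E"
    "entry_norm E \<le> 3 * (K * L)"
proof -
  obtain fx ft gx gt where f: "x_deriv f fx" "t_deriv f ft" "norm fx \<le> K" "norm ft \<le> K"
    and g: "x_deriv g gx" "t_deriv g gt" "norm gx \<le> L" "norm gt \<le> L"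
    using assms unfolding sbound_def by blast
  have "norm a * norm b \<le> K * L" if "norm a \<le> K" "norm b \<le> L" for a b :: symbol
    using that sbound_nonneg[OF assms(1)] by (intro mult_mono) auto
  from this[OF f(3) g(4)] this[OF f(4) g(3)] this[OF f(4), of g] assms(2)
  have le: "norm fx * norm gt + norm ft * norm gx + norm ft * norm g \<le> 3 * (K * L)"
    by (simp add: sbound_def)
  show ?thesis
    by (rule kms_mult_entry_norm[OF f(1,2) g(1,2), of n]) (use that le in force)
qed

lemma norm_exp_minus_one_le:
  "norm (exp z - 1) \<le> exp (norm z) - 1" for z :: "'a :: {banach, real_normed_algebra_1}"
proof -
  have "(\<lambda>n. w ^ Suc n /\<^sub>R fact (Suc n)) sums (exp w - 1)" for w :: "'b :: {banach, real_normed_algebra_1}"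
    using exp_converges[of w] by (subst sums_Suc_iff) simp
  from this[of z] this[of "norm z"] show ?thesis
  proof (rule norm_sums_le)
    show "norm (z ^ Suc n /\<^sub>R fact (Suc n)) \<le> norm z ^ Suc n /\<^sub>R fact (Suc n)" for n
      using norm_power_ineq[of z "Suc n"] by (simp add: mult_left_mono del: power_Suc fact_Suc)
  qed
qed

subsection \<open>Determinants of exponential symbols\<close>

lemma exp_minus_mult: "exp (- f) * exp f = (1 :: 'a :: {banach, real_normed_algebra_1})"
  using exp_minus_inverse[of "- f"] by simp

lemma x_deriv_uminus: "x_deriv f g \<Longrightarrow> x_deriv (- f) (- g)"
  using x_deriv_scaleR[of f g "- 1"] by simp

lemma t_deriv_uminus: "t_deriv f g \<Longrightarrow> t_deriv (- f) (- g)"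
  by (simp add: t_deriv_def)

lemma sbound_exists:
  assumes "x_deriv f fx" "t_deriv f ft"
  obtains K where "sbound f K"
proof
  show "sbound f (norm f + norm fx + norm ft)"
    unfolding sbound_def by (intro conjI exI[of _ fx] exI[of _ ft]) (use assms in auto)
qed

text \<open>The mean of the logarithm belongs to \<open>u\<close>, so \<open>v0\<close> holds:
  \<open>kms n v\<close> has trace 0 and the matrix of \<open>exp (cs s * v)\<close> has determinant
  1.\<close>

locale kms_factor =
  fixes u v ux ut vx vt :: symbol
  assumes u: "x_deriv u ux" "t_deriv u ut" "upper u"
    and v: "x_deriv v vx" "t_deriv v vt" "lower v" and v0: "\<And>x. cf v 0 x = 0"
begin

definition Y :: "complex \<Rightarrow> symbol" where "Y s = exp (cs s * v)"

definition b :: "complex \<Rightarrow> symbol" where "b s = exp u * Y s"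

definition F :: "nat \<Rightarrow> complex \<Rightarrow> complex" where
  "F n s = Determinant.det (kms n (b s)) * (\<Prod>i\<in>idx n. exp (- cf u 0 (node n i i)))"

lemma eu: "x_deriv (exp u) (ux * exp u)" "t_deriv (exp u) (ut * exp u)" "upper (exp u)"
  using u x_deriv_exp t_deriv_exp upper_exp by blast+

lemma upper_uminus: "upper (- u)"
  using u(3) by (simp add: upper_def)

lemma em: "x_deriv (exp (- u)) (- ux * exp (- u))" "t_deriv (exp (- u)) (- ut * exp (- u))" "upper (exp (- u))"
  using u x_deriv_exp[OF x_deriv_uminus] t_deriv_exp[OF t_deriv_uminus] upper_exp[OF upper_uminus]
  by blast+

lemma lower_cs: "lower (cs s * v)"
  using v(3) by (simp add: lower_def)

lemma Y: "x_deriv (Y s) (cs s * vx * Y s)" "t_deriv (Y s) (cs s * vt * Y s)" "lower (Y s)"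
  unfolding Y_def by (intro x_deriv_exp t_deriv_exp x_deriv_cs_mult t_deriv_cs_mult lower_exp lower_cs v)+

lemma Y_uminus: "Y s * Y (- s) = 1"
proof -
  have "cs (- s) * v = - (cs s * v)"
    by (rule symbol_eqI) simp
  then show ?thesis
    by (simp add: Y_def exp_minus_inverse)
qed

lemma det_Y: "Determinant.det (kms n (Y s)) = 1"
  by (subst det_kms_lower[OF Y(3)]) (simp add: Y_def cf_exp_zero lower_cs v0)

lemma det_em: "Determinant.det (kms n (exp (- u))) = (\<Prod>i\<in>idx n. exp (- cf u 0 (node n i i)))"
  by (simp add: det_kms_upper[OF em(3)] cf_exp_zero upper_uminus)

lemma F_eq: "F n s = Determinant.det (kms n (exp (- u)) * kms n (b s) * kms n (Y (- s)))"
proof -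
  have "Determinant.det (kms n (exp (- u)) * kms n (b s) * kms n (Y (- s))) =
      Determinant.det (kms n (exp (- u)) * kms n (b s)) * Determinant.det (kms n (Y (- s)))"
    by (rule det_mult[of _ "n + 1"]) (auto intro: mult_carrier_mat[of _ _ "n + 1"])
  also have "Determinant.det (kms n (exp (- u)) * kms n (b s)) =
      Determinant.det (kms n (exp (- u))) * Determinant.det (kms n (b s))"
    by (rule det_mult[of _ "n + 1"]) auto
  finally show ?thesis
    by (simp add: F_def det_Y det_em)
qed

text \<open>\<open>exp (- u) * b s = Y s\<close> and \<open>Y s * Y (- s) = 1\<close>, so the triple
  product of \<open>F_eq\<close> is the identity plus errors of bounded entry norm. No inverse of
  \<open>kms n (b s)\<close> occurs, hence every radius \<open>r\<close> is allowed.\<close>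

lemma F_bounded: "\<exists>M. \<forall>n s. cmod s \<le> r \<longrightarrow> cmod (F n s) \<le> M"
proof -
  obtain K1 where K1: "sbound (exp u) K1"
    by (rule sbound_exists[OF eu(1,2)])
  obtain K2 where K2: "sbound (exp (- u)) K2"
    by (rule sbound_exists[OF em(1,2)])
  define K3 where "K3 = (1 + r * norm vx + r * norm vt) * exp (r * norm v)"
  define K where "K = max K1 (max K2 K3)"
  have K: "sbound (exp u) K" "sbound (exp (- u)) K"
    by (auto intro: sbound_mono[OF K1] sbound_mono[OF K2] simp: K_def)
  have KY: "sbound (Y s) K" if "cmod s \<le> r" for s
    unfolding Y_def by (rule sbound_mono[OF sbound_exp_cs[OF v(1,2) that]]) (simp add: K_def K3_def)
  have K0: "K \<ge> 0"
    by (rule sbound_nonneg[OF K(1)])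
  define L where "L = 2 * (K * K)"
  have "cmod (F n s) \<le> exp (3 * (K * K) + 3 * (K * L) * K)" if s: "cmod s \<le> r" for n s
  proof -
    have s': "cmod (- s) \<le> r" using s by simp
    have b: "sbound (b s) L"
      unfolding b_def L_def by (rule sbound_mult[OF K(1) KY[OF s]])
    have "exp (- u) * b s = Y s"
      unfolding b_def by (simp add: mult.assoc[symmetric] exp_minus_mult)
    then obtain E1 where E1: "E1 \<in> carrier_mat (n + 1) (n + 1)"
      "kms n (exp (- u)) * kms n (b s) = kms n (Y s) + E1" "entry_norm E1 \<le> 3 * (K * L)"
      by (metis kms_mult_sbound[OF K(2) b, of n])
    obtain E2 where E2: "E2 \<in> carrier_mat (n + 1) (n + 1)"
      "kms n (Y s) * kms n (Y (- s)) = 1\<^sub>m (n + 1) + E2" "entry_norm E2 \<le> 3 * (K * K)"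
      using kms_mult_sbound[OF KY[OF s] KY[OF s'], of n] unfolding Y_uminus kms_one by metis
    have E3: "E1 * kms n (Y (- s)) \<in> carrier_mat (n + 1) (n + 1)"
      by (rule mult_carrier_mat[OF E1(1)]) simp
    have "kms n (exp (- u)) * kms n (b s) * kms n (Y (- s)) =
        kms n (Y s) * kms n (Y (- s)) + E1 * kms n (Y (- s))"
      unfolding E1(2) by (rule add_mult_distrib_mat[OF _ E1(1)]) auto
    also have "\<dots> = 1\<^sub>m (n + 1) + (E2 + E1 * kms n (Y (- s)))"
      unfolding E2(2) by (rule assoc_add_mat[OF _ E2(1) E3]) auto
    finally have "cmod (F n s) \<le> exp (entry_norm (E2 + E1 * kms n (Y (- s))))"
      unfolding F_eq by (simp only:) (rule norm_det_one_add_le, use E2(1) E3 in auto)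
    also have "entry_norm (E2 + E1 * kms n (Y (- s))) \<le> entry_norm E2 + entry_norm (E1 * kms n (Y (- s)))"
      by (rule entry_norm_add[OF E2(1) E3])
    also have "\<dots> \<le> 3 * (K * K) + entry_norm E1 * norm (Y (- s))"
      by (intro add_mono E2(3) entry_norm_mult_right[OF E1(1) _ row_le_kms]) auto
    also have "\<dots> \<le> 3 * (K * K) + 3 * (K * L) * K"
      using E1(3) KY[OF s'] K0 by (intro add_left_mono mult_mono) (auto simp: sbound_def L_def)
    finally show ?thesis by simp
  qed
  then show ?thesis by blast
qed

text \<open>\<open>kms n (exp (- u))\<close> is an approximate right inverse: its error against
  \<open>kms n (exp u)\<close> is O(1/n) because both symbols are upper, and
  \<open>b s - exp u\<close> is small with \<open>s\<close>. Each contributes at most 1/4, together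
  the 1/2 of \<open>inverse_perturbed_one\<close>.\<close>

lemma kms_b_inverse:
  obtains s0 n0 \<kappa> where "s0 > 0"
    "\<And>n s. n \<ge> n0 \<Longrightarrow> cmod s < s0 \<Longrightarrow> \<exists>S\<in>carrier_mat (n + 1) (n + 1).
      kms n (b s) * S = 1\<^sub>m (n + 1) \<and> S * kms n (b s) = 1\<^sub>m (n + 1) \<and> row_le S \<kappa> \<and> col_le S \<kappa>"
proof -
  define c where "c = norm (ux * exp u) * norm (- ut * exp (- u)) + norm (ut * exp u) * norm (- ux * exp (- u))"
  define e where "e = norm (exp u) * norm (exp (- u))"
  have "(\<lambda>n. c / real (2 * n + 2)) \<longlonglongrightarrow> 0"
    by real_asymp
  then have "\<forall>\<^sub>F n in sequentially. c / real (2 * n + 2) < 1 / 4"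
    by (rule order_tendstoD) simp
  then obtain n0 where n0: "\<And>n. n \<ge> n0 \<Longrightarrow> c / real (2 * n + 2) < 1 / 4"
    unfolding eventually_sequentially by blast
  have "((\<lambda>t. e * (exp (t * norm v) - 1)) \<longlongrightarrow> e * (exp (0 * norm v) - 1)) (at_right 0)"
    by (intro tendsto_intros)
  then have "\<forall>\<^sub>F t in at_right 0. e * (exp (t * norm v) - 1) < 1 / 4"
    by (rule order_tendstoD) simp
  then obtain s1 where s1: "s1 > 0" "\<And>t. 0 < t \<Longrightarrow> t < s1 \<Longrightarrow> e * (exp (t * norm v) - 1) < 1 / 4"
    unfolding eventually_at_right_field by blast
  \<comment> \<open>Half of \<open>s1\<close>, because the estimate holds on the open interval up to
    \<open>s1\<close> only and is needed at \<open>s0\<close> itself.\<close>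
  define s0 where "s0 = s1 / 2"
  have s0: "s0 > 0" "e * (exp (s0 * norm v) - 1) < 1 / 4"
    using s1(1) s1(2)[of s0] by (simp_all add: s0_def)
  define \<kappa> where "\<kappa> = norm (exp (- u)) * 2"
  have "\<exists>S\<in>carrier_mat (n + 1) (n + 1).
      kms n (b s) * S = 1\<^sub>m (n + 1) \<and> S * kms n (b s) = 1\<^sub>m (n + 1) \<and> row_le S \<kappa> \<and> col_le S \<kappa>"
    if n: "n \<ge> n0" and s: "cmod s < s0" for n s
  proof -
    define N where "N = n + 1"
    have cN [simp]: "kms n f \<in> carrier_mat N N" for f
      by (simp add: N_def)
    obtain E where E: "E \<in> carrier_mat N N" "kms n (exp u) * kms n (exp (- u)) = 1\<^sub>m N + E"
      "row_le E (c / real (2 * n + 2))" "col_le E (c / real (2 * n + 2))"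
      using kms_mult_upper[OF eu(1,2) em(1,2) eu(3) em(3), of n]
      unfolding exp_minus_inverse kms_one c_def N_def by metis
    define f where "f = b s - exp u"
    have f: "norm f * norm (exp (- u)) \<le> 1 / 4"
    proof -
      have "f = exp u * (Y s - 1)"
        by (simp add: f_def b_def right_diff_distrib)
      then have "norm f \<le> norm (exp u) * norm (Y s - 1)"
        by (simp add: norm_mult_ineq)
      also have "norm (Y s - 1) \<le> exp (norm (cs s * v)) - 1"
        unfolding Y_def by (rule norm_exp_minus_one_le)
      also have "\<dots> \<le> exp (s0 * norm v) - 1"
        using order_trans[OF norm_cs_mult[of s v] mult_right_mono[of "cmod s" s0 "norm v"]] s by simp
      finally have "norm f \<le> norm (exp u) * (exp (s0 * norm v) - 1)"
        by (simp add: mult_left_mono)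
      then have "norm f * norm (exp (- u)) \<le> norm (exp u) * (exp (s0 * norm v) - 1) * norm (exp (- u))"
        by (rule mult_right_mono) simp
      also have "\<dots> = e * (exp (s0 * norm v) - 1)"
        by (simp add: e_def mult_ac)
      finally show ?thesis using s0(2) by simp
    qed
    define G where "G = E + kms n f * kms n (exp (- u))"
    have c2: "kms n f * kms n (exp (- u)) \<in> carrier_mat N N"
      by (rule mult_carrier_mat[of _ N N _ N]) auto
    then have G: "G \<in> carrier_mat N N"
      by (simp add: G_def)
    have half: "c / real (2 * n + 2) + norm f * norm (exp (- u)) \<le> 1 / 2"
      using n0[OF n] f by linarith
    have "row_le (kms n f * kms n (exp (- u))) (norm f * norm (exp (- u)))"
      by (rule row_le_mult[of _ N]) (auto intro: row_le_kms)
    from row_le_mono[OF row_le_add[OF E(1) c2 E(3) this] half]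
    have rG: "row_le G (1 / 2)"
      unfolding G_def .
    have "col_le (kms n f * kms n (exp (- u))) (norm f * norm (exp (- u)))"
      by (rule col_le_mult[of _ N]) (auto intro: col_le_kms)
    from col_le_mono[OF col_le_add[OF E(1) c2 E(4) this] half]
    have cG: "col_le G (1 / 2)"
      unfolding G_def .
    have bG: "kms n (b s) * kms n (exp (- u)) = 1\<^sub>m N + G"
    proof -
      have "b s = exp u + f"
        by (simp add: f_def)
      then have "kms n (b s) * kms n (exp (- u)) = (kms n (exp u) + kms n f) * kms n (exp (- u))"
        by (simp add: kms_add)
      also have "\<dots> = kms n (exp u) * kms n (exp (- u)) + kms n f * kms n (exp (- u))"
        by (rule add_mult_distrib_mat[of _ N N _ _ N]) auto
      also have "\<dots> = 1\<^sub>m N + G"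
        unfolding E(2) G_def by (rule assoc_add_mat[OF _ E(1) c2]) auto
      finally show ?thesis .
    qed
    obtain S0 where S0: "S0 \<in> carrier_mat N N" "(1\<^sub>m N + G) * S0 = 1\<^sub>m N" "row_le S0 2" "col_le S0 2"
      using inverse_perturbed_one[OF G rG cG] by metis
    define S where "S = kms n (exp (- u)) * S0"
    have S: "S \<in> carrier_mat N N"
      unfolding S_def by (rule mult_carrier_mat[OF _ S0(1)]) simp
    have "kms n (b s) * S = (kms n (b s) * kms n (exp (- u))) * S0"
      unfolding S_def by (rule assoc_mult_mat[symmetric, OF cN cN S0(1)])
    then have inv: "kms n (b s) * S = 1\<^sub>m N"
      by (simp add: bG S0)
    have "S * kms n (b s) = 1\<^sub>m N"
      by (rule mat_mult_left_right_inverse[OF _ S inv]) simp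
    moreover have "row_le S \<kappa>"
      unfolding S_def \<kappa>_def by (rule row_le_mult[OF cN S0(1) row_le_kms S0(3)]) simp
    moreover have "col_le S \<kappa>"
      unfolding S_def \<kappa>_def by (rule col_le_mult[OF cN S0(1) col_le_kms S0(4)]) simp
    ultimately show ?thesis
      using S inv unfolding N_def by blast
  qed
  with s0(1) that show ?thesis by blast
qed

lemma F_zero: "F n 0 = 1"
proof -
  have "cs 0 * v = 0"
    by (rule symbol_eqI) simp
  then have "b 0 = exp u"
    by (simp add: b_def Y_def)
  then show ?thesis
    by (simp add: F_def det_kms_upper[OF eu(3)] cf_exp_zero u(3) prod.distrib[symmetric] exp_minus_inverse)
qed

lemma cf_b_deriv: "((\<lambda>s. cf (b s) k x) has_field_derivative cf (v * b s) k x) (at s)"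
  using has_field_derivative_cf_exp[of "exp u" v k x s] unfolding b_def Y_def
  by (simp add: mult_ac)

lemma kms_index: "i < n + 1 \<Longrightarrow> j < n + 1 \<Longrightarrow>
    kms n f $$ (i, j) = cf f (int j - int i) (node n (int i) (int j))"
  by (simp add: kms_def)

lemma F_holomorphic: "F n holomorphic_on A"
proof -
  have "(\<lambda>s. cf (b s) k x) holomorphic_on A" for k x
    by (rule holomorphic_on_subset[OF _ subset_UNIV])
      (use cf_b_deriv in \<open>auto simp: holomorphic_on_open\<close>)
  then have ent: "(\<lambda>s. kms n (b s) $$ (i, j)) holomorphic_on A" if "i < n + 1" "j < n + 1" for i j
    using that by (simp add: kms_index)
  have p_lt: "p i < n + 1" if "p permutes {0..<n + 1}" "i < n + 1" for p i
    using permutes_in_image[OF that(1), of i] that(2) by auto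
  have "(\<lambda>s. \<Sum>p | p permutes {0..<n + 1}. signof p * (\<Prod>i = 0..<n + 1. kms n (b s) $$ (i, p i))) holomorphic_on A"
  proof (intro holomorphic_on_sum holomorphic_on_mult holomorphic_on_const holomorphic_on_prod)
    fix p i assume p: "p \<in> {p. p permutes {0..<n + 1}}" and i: "i \<in> {0..<n + 1}"
    show "(\<lambda>s. kms n (b s) $$ (i, p i)) holomorphic_on A"
      by (intro ent p_lt[of p]) (use p i in auto)
  qed
  then show ?thesis
    unfolding F_def det_def'[OF kms_carrier(1)] by (rule holomorphic_on_mult[OF _ holomorphic_on_const])
qed

lemma F_deriv:
  assumes "S \<in> carrier_mat (n + 1) (n + 1)" "kms n (b s) * S = 1\<^sub>m (n + 1)" "S * kms n (b s) = 1\<^sub>m (n + 1)"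
  shows "(F n has_field_derivative F n s * mtrace (S * kms n (v * b s))) (at s)"
proof -
  have "((\<lambda>s. Determinant.det (kms n (b s))) has_field_derivative
      Determinant.det (kms n (b s)) * mtrace (S * kms n (v * b s))) (at s)"
  proof (rule det_has_field_derivative[where M = "\<lambda>s. kms n (b s)", OF kms_carrier(1) kms_carrier(1) assms])
    show "((\<lambda>s. kms n (b s) $$ (i, j)) has_field_derivative kms n (v * b s) $$ (i, j)) (at s)"
      if "i < n + 1" "j < n + 1" for i j
      using cf_b_deriv that by (simp add: kms_index)
  qed
  from DERIV_cmult_right[OF this, of "\<Prod>i\<in>idx n. exp (- cf u 0 (node n i i))"] show ?thesis
    by (simp add: F_def[abs_def] mult_ac)
qed

text \<open>\<open>cf (ut * v) 0 x\<close> is the sum of \<open>k * cf u k x * cf v (- k) x\<close>;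
  for the logarithm of the symbol this is \<open>E_const a x\<close>.\<close>

definition c :: complex where
  "c = (cf (ut * v) 0 0 + cf (ut * v) 0 1) / 2"

lemma b_derivs: "\<exists>g. x_deriv (b s) g" "\<exists>g. t_deriv (b s) g"
  unfolding b_def using x_deriv_mult[OF eu(1) Y(1)] t_deriv_mult[OF eu(2) Y(2)] by blast+

text \<open>The two exact product formulas add up to V B + B V + G0 + G1 = 2 K + E, where K belongs
  to \<open>v * b s\<close>, G0 and G1 are the gaps and E is the symmetrized shift error. Multiplied
  by the inverse of B, both products have the trace of V, which is 0; E disappears and each gap
  yields one corner.\<close>

lemma trace_tendsto:
  assumes S: "\<And>n. n \<ge> n0 \<Longrightarrow> S n \<in> carrier_mat (n + 1) (n + 1)"
    "\<And>n. n \<ge> n0 \<Longrightarrow> kms n (b s) * S n = 1\<^sub>m (n + 1)" "\<And>n. n \<ge> n0 \<Longrightarrow> S n * kms n (b s) = 1\<^sub>m (n + 1)"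
    "\<And>n. n \<ge> n0 \<Longrightarrow> row_le (S n) \<kappa>" "\<And>n. n \<ge> n0 \<Longrightarrow> col_le (S n) \<kappa>"
  shows "(\<lambda>n. mtrace (S n * kms n (v * b s))) \<longlonglongrightarrow> c"
proof -
  define s' where "s' = (\<lambda>n i j. S n $$ (nat i, nat j))"
  have Seq: "imat n (s' n) = S n" if "n \<ge> n0" for n
    unfolding s'_def by (rule imat_index[symmetric, OF S(1)[OF that]])
  have XX: "exp u * exp (- u) = 1"
    by (rule exp_minus_inverse)
  have limit: "- cf ((- ut * exp (- u)) * (v * exp u)) 0 x = cf (ut * v) 0 x" for x
  proof -
    have "(- ut * exp (- u)) * (v * exp u) = - ((ut * v) * (exp u * exp (- u)))"
      by (simp add: mult_ac)
    then show ?thesis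
      by (simp add: XX)
  qed
  have node0: "(\<lambda>n. node n i j) \<longlonglongrightarrow> 0" for i j
    unfolding node_def by real_asymp
  have node1: "(\<lambda>n. node n (int n - j) (int n - i)) \<longlonglongrightarrow> 1" for i j
    unfolding node_def of_int_add of_int_diff of_int_of_nat_eq by real_asymp
  have "(\<lambda>n. mtrace (imat n (s' n) * imat n (\<lambda>i j.
      \<Sum>\<^sub>\<infinity>k\<in>{..<0}. cf v (k - i) (node n i j) * cf (b s) (j - k) (node n i j)))) \<longlonglongrightarrow>
      - cf ((- ut * exp (- u)) * (v * exp u)) 0 0"
  proof (rule corner_trace_tendsto[OF node0 v(3) v0 v(2) eu(3) em(3) XX em(2) Y(3) b_def])
    fix n assume n: "n \<ge> n0"
    show "imat n (\<lambda>i j. cf (b s) (j - i) (node n i j)) * imat n (s' n) = 1\<^sub>m (n + 1)"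
      using S(2)[OF n] unfolding Seq[OF n] kms_def .
    show "row_le (imat n (s' n)) \<kappa>"
      using S(4)[OF n] unfolding Seq[OF n] .
  qed
  moreover have "imat n (gap n v (b s)) = imat n (\<lambda>i j.
      \<Sum>\<^sub>\<infinity>k\<in>{..<0}. cf v (k - i) (node n i j) * cf (b s) (j - k) (node n i j))" for n
    by (rule imat_eqI) (rule gap_lower[OF v(3)])
  ultimately have c0: "(\<lambda>n. mtrace (imat n (s' n) * imat n (gap n v (b s)))) \<longlonglongrightarrow> cf (ut * v) 0 0"
    by (simp only: limit)
  have "(\<lambda>n. mtrace (imat n (flip n (s' n)) * imat n (\<lambda>i j.
      \<Sum>\<^sub>\<infinity>k\<in>{..<0}. cf v (k - i) (node n (int n - j) (int n - i)) *
        cf (b s) (j - k) (node n (int n - j) (int n - i))))) \<longlonglongrightarrow>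
      - cf ((- ut * exp (- u)) * (v * exp u)) 0 1"
  proof (rule corner_trace_tendsto[OF node1 v(3) v0 v(2) eu(3) em(3) XX em(2) Y(3) b_def])
    fix n assume n: "n \<ge> n0"
    \<comment> \<open>Reflection reverses products, so at this corner \<open>S n\<close> is used as
      a left inverse, and its column bound serves as the row bound.\<close>
    have "imat n (s' n) * imat n (\<lambda>i j. cf (b s) (j - i) (node n i j)) = 1\<^sub>m (n + 1)"
      using S(3)[OF n] unfolding Seq[OF n] kms_def .
    moreover have "flip n (\<lambda>i j. cf (b s) (j - i) (node n i j)) =
        (\<lambda>i j. cf (b s) (j - i) (node n (int n - j) (int n - i)))"
      by (intro ext) (simp add: flip_def)
    ultimately show "imat n (\<lambda>i j. cf (b s) (j - i) (node n (int n - j) (int n - i))) *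
        imat n (flip n (s' n)) = 1\<^sub>m (n + 1)"
      using flip_mult_one by metis
    show "row_le (imat n (flip n (s' n))) \<kappa>"
      using S(5)[OF n] by (intro row_le_flip) (simp add: Seq[OF n])
  qed
  moreover have "imat n (flip n (gap n (b s) v)) = imat n (\<lambda>i j.
      \<Sum>\<^sub>\<infinity>k\<in>{..<0}. cf v (k - i) (node n (int n - j) (int n - i)) *
        cf (b s) (j - k) (node n (int n - j) (int n - i)))" for n
    by (rule imat_eqI) (rule gap_flip[OF v(3)])
  ultimately have c1: "(\<lambda>n. mtrace (imat n (s' n) * imat n (gap n (b s) v))) \<longlonglongrightarrow> cf (ut * v) 0 1"
    by (simp only: limit flip: mtrace_flip[of _ "s' _"])
  define E where "E = (\<lambda>n. imat n (\<lambda>i j. \<Sum>k\<in>idx n. shift_error n v (b s) i k j + shift_error n (b s) v i k j))"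
  obtain bx bt where bd: "x_deriv (b s) bx" "t_deriv (b s) bt"
    using b_derivs by blast
  have E_lim: "(\<lambda>n. entry_norm (E n)) \<longlonglongrightarrow> 0"
    unfolding E_def entry_norm_imat by (rule symmetrized_shift_error_tendsto[OF v(1,2) bd])
  have eq: "2 * mtrace (S n * kms n (v * b s)) =
      mtrace (imat n (s' n) * imat n (gap n v (b s))) + mtrace (imat n (s' n) * imat n (gap n (b s) v))
      - mtrace (S n * E n)" if n: "n \<ge> n0" for n
  proof -
    define N where "N = n + 1"
    let ?V = "kms n v" and ?B = "kms n (b s)" and ?K = "kms n (v * b s)" and ?S = "S n"
    let ?G0 = "imat n (gap n v (b s))" and ?G1 = "imat n (gap n (b s) v)"
    have cN [simp]: "kms n f \<in> carrier_mat N N" "imat n g \<in> carrier_mat N N" "?S \<in> carrier_mat N N"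
        "E n \<in> carrier_mat N N" for f g
      using S(1)[OF n] by (simp_all add: N_def E_def)
    have mult_c [simp]: "A * B \<in> carrier_mat N N" if "A \<in> carrier_mat N N" "B \<in> carrier_mat N N"
      for A B :: "complex mat"
      using that by (rule mult_carrier_mat)
    have add_c [simp]: "A + B \<in> carrier_mat N N" if "A \<in> carrier_mat N N" "B \<in> carrier_mat N N"
      for A B :: "complex mat"
      using that by (intro add_carrier_mat)
    note assoc = assoc_mult_mat[of _ N N _ N _ N]
    have BS: "?B * ?S = 1\<^sub>m N" "?S * ?B = 1\<^sub>m N"
      using S(2,3)[OF n] by (simp_all add: N_def)
    have "(?V * ?B + ?B * ?V) + (?G0 + ?G1) = (?K + ?K) + E n"
      unfolding kms_mult[of n v "b s"] kms_mult[of n "b s" v] mult.commute[of "b s" v]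
      unfolding E_def kms_def imat_add by (rule imat_eqI) (simp add: sum.distrib)
    then have "mtrace (?S * ((?V * ?B + ?B * ?V) + (?G0 + ?G1))) = mtrace (?S * ((?K + ?K) + E n))"
      by simp
    then have "mtrace (?S * (?V * ?B)) + mtrace (?S * (?B * ?V)) + (mtrace (?S * ?G0) + mtrace (?S * ?G1)) =
        mtrace (?S * ?K) + mtrace (?S * ?K) + mtrace (?S * E n)"
      by (simp add: mult_add_distrib_mat[of _ N N _ N] mtrace_add[of _ N])
    moreover have "mtrace ?V = 0"
      unfolding kms_def mtrace_imat by (simp add: v0)
    moreover have "mtrace (?S * (?V * ?B)) = mtrace ?V"
    proof -
      have "mtrace (?S * (?V * ?B)) = mtrace ((?V * ?B) * ?S)"
        by (rule mtrace_mult_comm[of _ N]) auto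
      also have "(?V * ?B) * ?S = ?V * (?B * ?S)"
        by (rule assoc) auto
      also have "\<dots> = ?V"
        unfolding BS by (rule right_mult_one_mat[of _ N N]) auto
      finally show ?thesis .
    qed
    moreover have "?S * (?B * ?V) = ?V"
    proof -
      have "?S * (?B * ?V) = (?S * ?B) * ?V"
        by (rule assoc[symmetric]) auto
      also have "\<dots> = ?V"
        unfolding BS by (rule left_mult_one_mat[of _ N N]) auto
      finally show ?thesis .
    qed
    ultimately show ?thesis
      unfolding Seq[OF n] by (simp add: algebra_simps)
  qed
  have SE: "(\<lambda>n. mtrace (S n * E n)) \<longlonglongrightarrow> 0"
  proof (rule Lim_null_comparison)
    show "\<forall>\<^sub>F n in sequentially. norm (mtrace (S n * E n)) \<le> \<kappa> * entry_norm (E n)"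
      unfolding eventually_sequentially
      by (intro exI[of _ n0] allI impI norm_mtrace_mult_le[OF S(1) _ S(4)]) (auto simp: E_def)
    show "(\<lambda>n. \<kappa> * entry_norm (E n)) \<longlonglongrightarrow> 0"
      by (rule tendsto_mult_right_zero[OF E_lim])
  qed
  have "(\<lambda>n. (mtrace (imat n (s' n) * imat n (gap n v (b s))) + mtrace (imat n (s' n) * imat n (gap n (b s) v))
      - mtrace (S n * E n)) / 2) \<longlonglongrightarrow> (cf (ut * v) 0 0 + cf (ut * v) 0 1 - 0) / 2"
    by (intro tendsto_intros c0 c1 SE) auto
  then have lim: "(\<lambda>n. (mtrace (imat n (s' n) * imat n (gap n v (b s))) + mtrace (imat n (s' n) * imat n (gap n (b s) v))
      - mtrace (S n * E n)) / 2) \<longlonglongrightarrow> c"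
    by (simp add: c_def)
  have "\<forall>\<^sub>F n in sequentially. (mtrace (imat n (s' n) * imat n (gap n v (b s))) +
      mtrace (imat n (s' n) * imat n (gap n (b s) v)) - mtrace (S n * E n)) / 2 = mtrace (S n * kms n (v * b s))"
    unfolding eventually_sequentially using eq by (intro exI[of _ n0]) (auto simp: eq[symmetric])
  from Lim_transform_eventually[OF lim this] show ?thesis .
qed

text \<open>A subsequence staying away from the claimed limit has, by Montel, a further subsequence
  with a locally uniform limit \<open>g\<close>. Near 0 this satisfies \<open>g' = c * g\<close>
  with \<open>g 0 = 1\<close>, so it is the exponential there, and everywhere by the identity
  theorem: a contradiction at \<open>z\<close>.\<close>

lemma F_tendsto: "(\<lambda>n. F n z) \<longlonglongrightarrow> exp (c * z)"
proof (rule ccontr)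
  assume "\<not> (\<lambda>n. F n z) \<longlonglongrightarrow> exp (c * z)"
  then obtain e where e: "e > 0" "\<not> (\<forall>\<^sub>F n in sequentially. dist (F n z) (exp (c * z)) < e)"
    unfolding tendsto_iff by blast
  then have "infinite {n. \<not> dist (F n z) (exp (c * z)) < e}"
    unfolding eventually_sequentially infinite_nat_iff_unbounded_le by auto
  then obtain r :: "nat \<Rightarrow> nat" where r: "strict_mono r" "\<And>n. \<not> dist (F (r n) z) (exp (c * z)) < e"
    using infinite_enumerate by (metis (no_types, lifting) mem_Collect_eq)
  have bdd: "\<exists>B. \<forall>h\<in>range F. \<forall>z\<in>K. cmod (h z) \<le> B" if "compact K" for K
  proof -
    have "bounded K"
      using that by (rule compact_imp_bounded)
    then obtain R where "\<And>z. z \<in> K \<Longrightarrow> cmod z \<le> R"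
      unfolding bounded_iff by blast
    then show ?thesis
      using F_bounded[of R] by blast
  qed
  obtain g q where g: "g holomorphic_on UNIV" and q: "strict_mono (q :: nat \<Rightarrow> nat)"
    and lim: "\<And>x. (\<lambda>n. F (r (q n)) x) \<longlonglongrightarrow> g x"
    and unif: "\<And>K. compact K \<Longrightarrow> uniform_limit K ((\<lambda>n. F (r n)) \<circ> q) g sequentially"
  proof (rule Montel[of UNIV "range F" "\<lambda>n. F (r n)"])
    show "\<exists>B. \<forall>h\<in>range F. \<forall>z\<in>K. cmod (h z) \<le> B" if "compact K" for K
      by (rule bdd[OF that])
  qed (auto simp: F_holomorphic)
  obtain s0 n0 \<kappa> where s0: "s0 > 0" and inv: "\<And>n s. n \<ge> n0 \<Longrightarrow> cmod s < s0 \<Longrightarrow> \<exists>S\<in>carrier_mat (n + 1) (n + 1).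
      kms n (b s) * S = 1\<^sub>m (n + 1) \<and> S * kms n (b s) = 1\<^sub>m (n + 1) \<and> row_le S \<kappa> \<and> col_le S \<kappa>"
    using kms_b_inverse by metis
  have deriv_g: "deriv g s = c * g s" if s: "s \<in> ball 0 s0" for s
  proof -
    have "cmod s < s0" using s by simp
    then have "\<forall>n. \<exists>S. n \<ge> n0 \<longrightarrow> S \<in> carrier_mat (n + 1) (n + 1) \<and>
        kms n (b s) * S = 1\<^sub>m (n + 1) \<and> S * kms n (b s) = 1\<^sub>m (n + 1) \<and> row_le S \<kappa> \<and> col_le S \<kappa>"
      using inv by blast
    then obtain S where S: "\<And>n. n \<ge> n0 \<Longrightarrow> S n \<in> carrier_mat (n + 1) (n + 1)"
      "\<And>n. n \<ge> n0 \<Longrightarrow> kms n (b s) * S n = 1\<^sub>m (n + 1)" "\<And>n. n \<ge> n0 \<Longrightarrow> S n * kms n (b s) = 1\<^sub>m (n + 1)"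
      "\<And>n. n \<ge> n0 \<Longrightarrow> row_le (S n) \<kappa>" "\<And>n. n \<ge> n0 \<Longrightarrow> col_le (S n) \<kappa>"
      by metis
    have tr: "(\<lambda>n. mtrace (S n * kms n (v * b s))) \<longlonglongrightarrow> c"
      by (rule trace_tendsto[of n0]) (use S in auto)
    have rq: "strict_mono (r \<circ> q)"
      using r(1) q by (rule strict_mono_o)
    have tr': "(\<lambda>n. mtrace (S (r (q n)) * kms (r (q n)) (v * b s))) \<longlonglongrightarrow> c"
      using LIMSEQ_subseq_LIMSEQ[OF tr rq] by (simp add: o_def)
    \<comment> \<open>The derivative is written as a product with the trace and not as a quotient by
      \<open>F\<close>, so a possible zero of \<open>g\<close> does no harm.\<close>
    have 1: "(\<lambda>n. F (r (q n)) s * mtrace (S (r (q n)) * kms (r (q n)) (v * b s))) \<longlonglongrightarrow> g s * c"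
      by (intro tendsto_mult lim tr')
    have ev: "\<forall>\<^sub>F n in sequentially. F (r (q n)) s * mtrace (S (r (q n)) * kms (r (q n)) (v * b s)) =
        deriv (F (r (q n))) s"
      unfolding eventually_sequentially
    proof (intro exI[of _ n0] allI impI)
      fix n assume "n \<ge> n0"
      then have "r (q n) \<ge> n0"
        using seq_suble[OF rq, of n] by simp
      from DERIV_imp_deriv[OF F_deriv[OF S(1-3)[OF this]]]
      show "F (r (q n)) s * mtrace (S (r (q n)) * kms (r (q n)) (v * b s)) = deriv (F (r (q n))) s"
        by simp
    qed
    have 2: "(\<lambda>n. deriv (F (r (q n))) s) \<longlonglongrightarrow> deriv g s"
    proof (rule deriv_complex_uniform_limit[OF _ _ _ open_ball s])
      show "uniform_limit (ball 0 s0) (\<lambda>n. F (r (q n))) g sequentially"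
        using uniform_limit_on_subset[OF unif[OF compact_cball] ball_subset_cball] by (simp add: o_def)
    qed (auto simp: F_holomorphic)
    show ?thesis
      using LIMSEQ_unique[OF Lim_transform_eventually[OF 1 ev] 2] by (simp add: mult.commute)
  qed
  have "g 0 = 1"
    using lim[of 0] LIMSEQ_unique by (simp add: F_zero LIMSEQ_const_iff)
  have on_ball: "g s = exp (c * s)" if s: "s \<in> ball 0 s0" for s
  proof -
    have "\<exists>k. \<forall>s\<in>ball 0 s0. g s * exp (- c * s) = k"
    proof (rule has_field_derivative_zero_constant)
      fix s :: complex assume s: "s \<in> ball 0 s0"
      have "(g has_field_derivative c * g s) (at s)"
        using holomorphic_derivI[OF g open_UNIV, of s] deriv_g[OF s] by simp
      then have "((\<lambda>s. g s * exp (- c * s)) has_field_derivative 0) (at s)"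
        by (auto intro!: derivative_eq_intros simp: algebra_simps)
      then show "((\<lambda>s. g s * exp (- c * s)) has_field_derivative 0) (at s within ball 0 s0)"
        by (rule has_field_derivative_at_within)
    qed simp
    then obtain k where k: "\<And>s. s \<in> ball 0 s0 \<Longrightarrow> g s * exp (- c * s) = k" by blast
    from k[of 0] k[OF s] s0 \<open>g 0 = 1\<close> have "g s * exp (- c * s) = 1"
      by simp
    then have "g s * exp (- c * s) * exp (c * s) = exp (c * s)"
      by simp
    then show ?thesis
      by (simp add: mult.assoc exp_add[symmetric])
  qed
  have "g z = exp (c * z)"
  proof (rule analytic_continuation_open[of "ball 0 s0" UNIV g "\<lambda>s. exp (c * s)"])
    show "(\<lambda>s. exp (c * s)) holomorphic_on UNIV"
      by (intro holomorphic_intros)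
  qed (use s0 g on_ball in auto)
  then have "(\<lambda>n. F (r (q n)) z) \<longlonglongrightarrow> exp (c * z)"
    using lim[of z] by simp
  then have "\<forall>\<^sub>F n in sequentially. dist (F (r (q n)) z) (exp (c * z)) < e"
    by (rule tendstoD) (rule e(1))
  then show False
    using r(2) by simp
qed

lemma det_kms_exp_tendsto:
  "(\<lambda>n. Determinant.det (kms n (exp (u + v))) * (\<Prod>i\<in>idx n. exp (- cf u 0 (node n i i)))) \<longlonglongrightarrow> exp c"
proof -
  have "cs 1 * v = v"
    by (rule symbol_eqI) simp
  then have "b 1 = exp (u + v)"
    by (simp add: b_def Y_def exp_add_commuting mult.commute)
  then show ?thesis
    using F_tendsto[of 1] by (simp add: F_def)
qed

end

subsection \<open>Evaluation of symbols and Fourier coefficients\<close>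

abbreviation (input) ch :: "int \<Rightarrow> real \<Rightarrow> complex" where
  "ch k t \<equiv> exp (\<i> * of_int k * of_real t)"

lemma norm_ch: "cmod (ch k t) = 1"
proof -
  have "ch k t = exp (\<i> * of_real (of_int k * t))"
    by (simp add: mult.assoc)
  then show ?thesis
    by (simp only: norm_exp_i_times)
qed

lemma ch_add: "ch (k + l) t = ch k t * ch l t"
  by (simp add: exp_add[symmetric] algebra_simps)

lemma ch_uminus: "exp (- \<i> * of_int k * of_real t) = ch (- k) t"
  by simp

lemma ch_0 [simp]: "ch 0 t = 1"
  by simp

lemma ch_period: "ch k (2 * pi) = 1"
  using exp_integer_2pi[of "of_int k"] by (simp add: mult_ac)

lemma ch_has_vector_derivative:
  "((\<lambda>t. ch k t) has_vector_derivative \<i> * of_int k * ch k t) (at t within S)"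
proof -
  have "((\<lambda>z. exp (\<i> * of_int k * z)) has_field_derivative \<i> * of_int k * ch k t) (at (of_real t))"
    by (auto intro!: derivative_eq_intros)
  then show ?thesis
    by (rule has_vector_derivative_real_field)
qed

definition ev :: "symbol \<Rightarrow> real \<Rightarrow> real \<Rightarrow> complex" where
  "ev f x t = (\<Sum>\<^sub>\<infinity>k. cf f k x * ch k t)"

lemma norm_ev_term_le: "norm (cf f k x * ch k t) \<le> wn f k"
  by (simp add: norm_mult norm_ch norm_cf_le)

lemma ev_has_sum: "((\<lambda>k. cf f k x * ch k t) has_sum ev f x t) UNIV"
  unfolding ev_def
  by (rule has_sum_infsum, rule abs_summable_summable,
      rule summable_on_comparison_test[OF wcoeff_summable[of f]]) (auto simp: norm_ev_term_le)

lemma norm_ev_le: "cmod (ev f x t) \<le> norm f"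
  by (rule norm_infsum_le[OF ev_has_sum has_sum_norm_wcoeff]) (rule norm_ev_term_le)

lemma bounded_linear_ev: "bounded_linear (\<lambda>f. ev f x t)"
proof (rule bounded_linear_intro[of _ 1])
  show "ev (f + g) x t = ev f x t + ev g x t" for f g
    using has_sum_add[OF ev_has_sum[of f x t] ev_has_sum[of g x t]] ev_has_sum[of "f + g" x t]
    by (simp add: distrib_right has_sum_unique)
  show "ev (r *\<^sub>R f) x t = r *\<^sub>R ev f x t" for r f
    using has_sum_scaleR[OF ev_has_sum[of f x t], of r] ev_has_sum[of "r *\<^sub>R f" x t]
    by (simp add: has_sum_unique)
qed (simp add: norm_ev_le)

lemma ev_one: "ev 1 x t = 1"
proof -
  have "((\<lambda>k. cf 1 k x * ch k t) has_sum 1) UNIV"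
    by (rule has_sum_finite_neutralI[of "{0}"]) auto
  then show ?thesis
    using ev_has_sum has_sum_unique by blast
qed

lemma ev_mult: "ev (f * g) x t = ev f x t * ev g x t"
proof -
  let ?h = "\<lambda>(p, q). (cf f p x * ch p t) * (cf g q x * ch q t)"
  have abs: "(\<lambda>k. norm (cf f k x * ch k t)) summable_on UNIV" for f
    by (rule summable_on_comparison_test[OF wcoeff_summable[of f]]) (auto simp: norm_ev_term_le)
  have "(\<lambda>z. norm (?h z)) summable_on UNIV \<times> UNIV"
    using has_sum_imp_summable[OF has_sum_product[OF has_sum_infsum[OF abs[of f]] has_sum_infsum[OF abs[of g]]]]
    by (simp add: case_prod_unfold norm_mult)
  then have "?h summable_on UNIV \<times> UNIV"
    by (rule abs_summable_summable)
  then have "(?h has_sum ev f x t * ev g x t) (UNIV \<times> UNIV)"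
    by (intro has_sum_SigmaI[where g = "\<lambda>p. (cf f p x * ch p t) * ev g x t"])
      (auto intro!: has_sum_cmult_right has_sum_cmult_left ev_has_sum simp del: ch_0)
  then have 1: "((\<lambda>(k, p). ?h (p, k - p)) has_sum ev f x t * ev g x t) (UNIV \<times> UNIV)"
    unfolding UNIV_Times_UNIV by (subst has_sum_conv_pairs)
  have "((\<lambda>k. cf (f * g) k x * ch k t) has_sum ev f x t * ev g x t) UNIV"
  proof (rule has_sum_SigmaD[OF 1])
    fix k :: int
    have "(cf f p x * ch p t) * (cf g (k - p) x * ch (k - p) t) = (cf f p x * cf g (k - p) x) * ch k t" for p
      using ch_add[of p "k - p" t] by (simp add: mult_ac)
    then show "((\<lambda>p. case (k, p) of (k, p) \<Rightarrow> ?h (p, k - p)) has_sum cf (f * g) k x * ch k t) UNIV"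
      using has_sum_cmult_left[OF cf_mult[of f x g k], of "ch k t"] by (simp only: prod.case)
  qed
  then show ?thesis
    using ev_has_sum has_sum_unique by blast
qed

lemma ev_exp: "ev (exp f) x t = exp (ev f x t)"
proof (rule bounded_linear_exp_eq[OF bounded_linear_ev])
  show "ev (f ^ n) x t = ev f x t ^ n" for n
    by (induction n) (simp_all add: ev_one ev_mult)
qed

lemma continuous_on_ev: "continuous_on S (\<lambda>(x, t). ev f x t)"
proof (rule continuous_on_subset[OF _ subset_UNIV])
  have "uniform_limit UNIV (\<lambda>n z. \<Sum>k\<in>{- int n..int n}. cf f k (fst z) * ch k (snd z))
      (\<lambda>z. ev f (fst z) (snd z)) sequentially"
    by (rule uniform_limit_int_sums[where M = "wn f"]) (auto intro: ev_has_sum norm_ev_term_le)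
  moreover have "continuous_on UNIV (\<lambda>z. \<Sum>k\<in>{- int n..int n}. cf f k (fst z) * ch k (snd z))" for n
    by (intro continuous_intros continuous_on_compose2[OF continuous_on_cf[of UNIV]]) auto
  ultimately show "continuous_on UNIV (\<lambda>(x, t). ev f x t)"
    unfolding case_prod_unfold by (intro uniform_limit_theorem) (auto intro!: always_eventually)
qed

lemma continuous_on_ev_t: "continuous_on S (ev f x)"
proof -
  have "continuous_on S (\<lambda>t. (\<lambda>(x, t). ev f x t) (x, t))"
    by (rule continuous_on_compose2[OF continuous_on_ev[of UNIV]]) (auto intro!: continuous_intros)
  then show ?thesis by simp
qed

lemma ev_t_deriv:
  assumes "t_deriv f g"
  shows "(ev f x has_vector_derivative \<i> * ev g x t) (at t within S)"
proof -
  have "(ev f x has_vector_derivative \<i> * ev g x t) (at t within UNIV)"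
  proof (rule has_vector_derivative_has_sum[where S = UNIV and f = "\<lambda>k t. cf f k x * ch k t"
        and f' = "\<lambda>k t. \<i> * (cf g k x * ch k t)" and M = "wn g" and g' = "\<lambda>t. \<i> * ev g x t"])
    show "((\<lambda>t. cf f k x * ch k t) has_vector_derivative \<i> * (cf g k x * ch k t)) (at t within UNIV)" for k t
      using has_vector_derivative_mult_right[OF ch_has_vector_derivative[of k t UNIV], of "cf f k x"]
      by (simp add: t_derivD[OF assms] mult_ac)
    show "((\<lambda>k. \<i> * (cf g k x * ch k t)) has_sum \<i> * ev g x t) UNIV" for t
      by (intro has_sum_cmult_right ev_has_sum)
    show "norm (\<i> * (cf g k x * ch k t)) \<le> wn g k" for k t
      using norm_ev_term_le[of g k x t] by (simp add: norm_mult)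
  qed (auto intro: ev_has_sum)
  then show ?thesis
    by (rule has_vector_derivative_at_within)
qed

lemma ev_x_deriv:
  assumes "x_deriv f g" "x \<in> {0..1}"
  shows "((\<lambda>x. ev f x t) has_vector_derivative ev g x t) (at x within {0..1})"
proof (rule has_vector_derivative_has_sum[where f = "\<lambda>k x. cf f k x * ch k t"
      and f' = "\<lambda>k x. cf g k x * ch k t" and M = "wn g"])
  show "((\<lambda>x. cf f k x * ch k t) has_vector_derivative cf g k x * ch k t) (at x within {0..1})"
    if "x \<in> {0..1}" for k x
    by (rule has_vector_derivative_mult_left[OF x_derivD[OF assms(1) that]])
qed (use assms in \<open>auto intro: ev_has_sum norm_ev_term_le\<close>)

lemma ev_cong: "(\<And>k. cf f k x = cf g k x) \<Longrightarrow> ev f x t = ev g x t"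
  by (simp add: ev_def)

section \<open>Fourier coefficients of continuous functions of one variable\<close>

definition four :: "(real \<Rightarrow> complex) \<Rightarrow> int \<Rightarrow> complex" where
  "four h k = 1 / (2 * pi) * integral {0..2 * pi} (\<lambda>t. h t * exp (- \<i> * of_int k * of_real t))"

lemma four_cong: "(\<And>t. t \<in> {0..2 * pi} \<Longrightarrow> g t = h t) \<Longrightarrow> four g k = four h k"
  unfolding four_def by (intro arg_cong2[where f = "(*)"] refl integral_cong) auto

lemma norm_four_le:
  assumes "continuous_on {0..2 * pi} h" "\<And>t. t \<in> {0..2 * pi} \<Longrightarrow> cmod (h t) \<le> B"
  shows "cmod (four h k) \<le> B"
proof -
  have "norm (integral {0..2 * pi} (\<lambda>t. h t * ch (- k) t)) \<le> B * (2 * pi - 0)"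
    by (rule integral_bound) (use assms in \<open>auto intro!: continuous_intros simp: norm_mult norm_ch simp del: of_int_minus\<close>)
  moreover have "cmod (1 / (2 * pi) * I) = cmod I / (2 * pi)" for I :: complex
    by (simp add: norm_mult norm_divide)
  ultimately show ?thesis
    unfolding four_def ch_uminus by (simp only: pos_divide_le_eq[of "2 * pi"] pi_gt_zero zero_less_mult_iff
        zero_less_numeral diff_zero simp_thms)
qed

lemma four_cmult: "four (\<lambda>t. c * h t) k = c * four h k"
  unfolding four_def by (simp add: mult.assoc)

lemma four_add:
  assumes "continuous_on {0..2 * pi} g" "continuous_on {0..2 * pi} h"
  shows "four (\<lambda>t. g t + h t) k = four g k + four h k"
  unfolding four_def distrib_right ch_uminus
  by (subst integral_add) (auto intro!: integrable_continuous_real continuous_intros assms simp: distrib_left)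

text \<open>Integration by parts; periodicity of \<open>h\<close> removes the boundary term.\<close>

lemma four_deriv:
  assumes der: "\<And>t. t \<in> {0..2 * pi} \<Longrightarrow> (h has_vector_derivative h' t) (at t within {0..2 * pi})"
    and cont: "continuous_on {0..2 * pi} h'" and per: "h (2 * pi) = h 0"
  shows "four h' k = \<i> * of_int k * four h k"
proof -
  have conth: "continuous_on {0..2 * pi} h"
    using der by (meson continuous_on_eq_continuous_within has_vector_derivative_continuous)
  let ?H' = "\<lambda>t. h t * (\<i> * of_int (- k) * ch (- k) t) + h' t * ch (- k) t"
  have "((\<lambda>t. h t * ch (- k) t) has_vector_derivative ?H' t) (at t within {0..2 * pi})"
    if "t \<in> {0..2 * pi}" for t
    by (rule has_vector_derivative_mult[OF der[OF that] ch_has_vector_derivative])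
  then have "(?H' has_integral (h (2 * pi) * ch (- k) (2 * pi) - h 0 * ch (- k) 0)) {0..2 * pi}"
    by (intro fundamental_theorem_of_calculus) auto
  then have int0: "integral {0..2 * pi} ?H' = 0"
    using per by (simp add: integral_unique ch_period[of "- k", simplified])
  have "four (\<lambda>t. (- (\<i> * of_int k)) * h t + h' t) k = 1 / (2 * pi) * integral {0..2 * pi} ?H'"
    unfolding four_def ch_uminus by (simp add: algebra_simps)
  then have "(- (\<i> * of_int k)) * four h k + four h' k = 0"
    unfolding int0 four_add[OF continuous_on_mult_left[OF conth] cont] four_cmult by simp
  then show ?thesis
    by (simp add: add_eq_0_iff)
qed

lemma four_one: "four (\<lambda>_. 1) k = (if k = 0 then 1 else 0)"
proof (cases "k = 0")
  case False
  have "four (\<lambda>_. 0) k = \<i> * of_int k * four (\<lambda>_. 1) k"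
    by (rule four_deriv) auto
  with False show ?thesis by (simp add: four_def)
qed (simp add: four_def scaleR_conv_of_real)

text \<open>The Fourier series of a merely continuous \<open>h\<close> need not converge, so only
  \<open>ev f x\<close> is expanded and integrated termwise.\<close>

lemma four_ev_mult:
  assumes h: "continuous_on {0..2 * pi} h"
  shows "((\<lambda>p. cf f p x * four h (k - p)) has_sum four (\<lambda>t. ev f x t * h t) k) UNIV"
proof -
  have "compact (h ` {0..2 * pi})"
    by (intro compact_continuous_image h) auto
  then obtain B where B: "\<And>t. t \<in> {0..2 * pi} \<Longrightarrow> cmod (h t) \<le> B"
    using compact_imp_bounded[of "h ` {0..2 * pi}"] unfolding bounded_iff by blast
  have B0: "B \<ge> 0"
    using order_trans[OF norm_ge_zero B[of 0]] by simp
  have sm: "(\<lambda>p. wn f p * B) summable_on UNIV"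
    by (intro summable_on_cmult_left) auto
  have "(\<lambda>p. norm (cf f p x * four h (k - p))) summable_on UNIV"
    by (rule summable_on_comparison_test[OF sm])
      (auto simp: norm_mult intro!: mult_mono norm_cf_le norm_four_le h B)
  then have s: "((\<lambda>p. cf f p x * four h (k - p)) has_sum (\<Sum>\<^sub>\<infinity>p. cf f p x * four h (k - p))) UNIV"
    by (rule has_sum_infsum[OF abs_summable_summable])
  let ?g = "\<lambda>p t. cf f p x * ch p t * h t * ch (- k) t"
  have u: "uniform_limit {0..2 * pi} (\<lambda>n t. \<Sum>p\<in>{- int n..int n}. ?g p t) (\<lambda>t. ev f x t * h t * ch (- k) t) sequentially"
  proof (rule uniform_limit_int_sums[OF _ _ sm])
    show "((\<lambda>p. ?g p t) has_sum ev f x t * h t * ch (- k) t) UNIV" for t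
      by (intro has_sum_cmult_left ev_has_sum)
    show "norm (?g p t) \<le> wn f p * B" if "t \<in> {0..2 * pi}" for p t
      unfolding norm_mult norm_ch using B[OF that] by (auto intro!: mult_mono norm_cf_le)
  qed
  have cg: "continuous_on {0..2 * pi} (?g p)" for p
    by (intro continuous_intros h)
  obtain I J where IJ: "\<And>n. ((\<lambda>t. \<Sum>p\<in>{- int n..int n}. ?g p t) has_integral I n) {0..2 * pi}"
    "((\<lambda>t. ev f x t * h t * ch (- k) t) has_integral J) {0..2 * pi}" "I \<longlonglongrightarrow> J"
    by (rule uniform_limit_integral[OF u]) (use cg in \<open>auto intro!: continuous_on_sum\<close>)
  have "I n = (\<Sum>p\<in>{- int n..int n}. integral {0..2 * pi} (?g p))" for n
    using integral_unique[OF IJ(1)[of n]] cg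
    by (simp add: integral_sum[symmetric] integrable_continuous_real)
  moreover have "1 / (2 * pi) * integral {0..2 * pi} (?g p) = cf f p x * four h (k - p)" for p
  proof -
    have "?g p t = cf f p x * (h t * ch (- (k - p)) t)" for t
      using ch_add[of p "- k" t] by (simp add: mult_ac)
    then show ?thesis
      unfolding four_def ch_uminus by (simp only: integral_mult_right) simp
  qed
  ultimately have "1 / (2 * pi) * I n = (\<Sum>p\<in>{- int n..int n}. cf f p x * four h (k - p))" for n
    by (simp only: sum_distrib_left)
  then have "(\<lambda>n. \<Sum>p\<in>{- int n..int n}. cf f p x * four h (k - p)) \<longlonglongrightarrow> 1 / (2 * pi) * J"
    using tendsto_mult_left[OF IJ(3), of "1 / (2 * pi)"] by simp
  moreover have "1 / (2 * pi) * J = four (\<lambda>t. ev f x t * h t) k"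
    unfolding four_def ch_uminus using integral_unique[OF IJ(2)] by simp
  ultimately have "(\<Sum>\<^sub>\<infinity>p. cf f p x * four h (k - p)) = four (\<lambda>t. ev f x t * h t) k"
    using LIMSEQ_unique[OF has_sum_int_limit[OF s]] by simp
  then show ?thesis
    using s by simp
qed

lemma four_ev: "four (ev f x) k = cf f k x"
proof -
  have "((\<lambda>p. cf f p x * four (\<lambda>_. 1) (k - p)) has_sum cf f k x) UNIV"
    by (rule has_sum_finite_neutralI[of "{k}"]) (auto simp: four_one)
  moreover have "((\<lambda>p. cf f p x * four (\<lambda>_. 1) (k - p)) has_sum four (ev f x) k) UNIV"
    using four_ev_mult[of "\<lambda>_. 1" f x k] by simp
  ultimately show ?thesis
    using has_sum_unique by blast
qed
lemma continuous_on_four: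
  assumes "continuous_on (U \<times> {0..2 * pi}) (\<lambda>(x, t). h x t)"
  shows "continuous_on U (\<lambda>x. four (h x) k)"
proof -
  have "continuous_on U (\<lambda>x. integral (cbox 0 (2 * pi)) (\<lambda>t. h x t * ch (- k) t))"
  proof (rule integral_continuous_on_param)
    have "continuous_on (U \<times> {0..2 * pi}) (\<lambda>z. (case z of (x, t) \<Rightarrow> h x t) * ch (- k) (snd z))"
      by (intro continuous_intros assms)
    then show "continuous_on (U \<times> cbox 0 (2 * pi)) (\<lambda>(x, t). h x t * ch (- k) t)"
      by (simp add: case_prod_unfold)
  qed
  then show ?thesis
    unfolding four_def ch_uminus by (intro continuous_intros) simp
qed

lemma summable_on_int_inverse_square: "(\<lambda>k. 1 / real_of_int k ^ 2) summable_on UNIV"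
proof -
  have nat: "(\<lambda>n. 1 / real n ^ 2) summable_on UNIV"
    using inverse_power_summable[of 2, where 'a = real]
    by (intro norm_summable_imp_summable_on) (simp add: inverse_eq_divide)
  have inj: "inj int" "inj (\<lambda>n. - int n)"
    by (auto simp: inj_on_def)
  have "(\<lambda>k. 1 / real_of_int k ^ 2) summable_on range int"
    by (subst summable_on_reindex[OF inj(1)]) (use nat in \<open>simp add: o_def\<close>)
  moreover have "(\<lambda>k. 1 / real_of_int k ^ 2) summable_on range (\<lambda>n. - int n)"
    by (subst summable_on_reindex[OF inj(2)]) (use nat in \<open>simp add: o_def\<close>)
  ultimately have "(\<lambda>k. 1 / real_of_int k ^ 2) summable_on (range int \<union> range (\<lambda>n. - int n))"
    by (rule summable_on_union)
  moreover have "range int \<union> range (\<lambda>n. - int n) = UNIV"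
    by (auto intro: int_cases2)
  ultimately show ?thesis by simp
qed

lemma has_vector_derivative_compose_field:
  assumes "(f has_vector_derivative f') (at x within S)" "(g has_field_derivative g') (at (f x))"
  shows "((\<lambda>x. g (f x)) has_vector_derivative f' * g') (at x within S)"
  using field_vector_diff_chain_within[OF assms(1) has_field_derivative_at_within[OF assms(2)]]
  by (simp add: o_def)

text \<open>Clamping keeps the values on \<open>[0,1]\<close>. The formula for all \<open>x\<close>
  is exported too, because \<open>t_deriv\<close> speaks about every \<open>x\<close>.\<close>

lemma symbolI:
  fixes c :: "int \<Rightarrow> real \<Rightarrow> complex"
  assumes cont: "\<And>k. continuous_on {0..1} (c k)"
    and le: "\<And>k x. x \<in> {0..1} \<Longrightarrow> norm (c k x) \<le> M k"
    and M: "M summable_on UNIV"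
  obtains f where "\<And>k x. cf f k x = c k (clamp 0 1 x)" "\<And>k x. x \<in> {0..1} \<Longrightarrow> cf f k x = c k x"
    "\<And>k. wn f k \<le> M k"
proof -
  have "\<exists>g :: real \<Rightarrow>\<^sub>C complex. (\<forall>x. apply_bcontfun g x = c k (clamp 0 1 x)) \<and> norm g \<le> M k" for k
  proof -
    obtain g :: "real \<Rightarrow>\<^sub>C complex" where g: "\<And>x. g x = c k (clamp 0 1 x)"
      using continuous_on_cbox_bcontfunE[of 0 1 "c k"] cont by auto
    have "norm g \<le> M k"
    proof (rule norm_bound)
      fix x :: real
      have "clamp 0 1 x \<in> cbox 0 (1 :: real)"
        by (intro clamp_in_interval) auto
      then show "norm (apply_bcontfun g x) \<le> M k"
        unfolding g by (intro le) auto
    qed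
    then show ?thesis
      using g by (intro exI[of _ g]) auto
  qed
  then obtain g :: "int \<Rightarrow> real \<Rightarrow>\<^sub>C complex" where
    g: "\<And>k x. apply_bcontfun (g k) x = c k (clamp 0 1 x)" "\<And>k. norm (g k) \<le> M k"
    by metis
  have "(\<lambda>k. norm (g k)) summable_on UNIV"
    by (rule summable_on_comparison_test[OF M]) (use g in auto)
  then have w: "wcoeff (Wiener g) = g"
    by (simp add: Wiener_inverse)
  show ?thesis
  proof (rule that[of "Wiener g"])
    show *: "cf (Wiener g) k x = c k (clamp 0 1 x)" for k x
      by (simp add: cf_def w g)
    show "cf (Wiener g) k x = c k x" if "x \<in> {0..1}" for k x
      using that by (simp add: * clamp_cancel_cbox)
    show "wn (Wiener g) k \<le> M k" for k
      by (simp add: w g)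
  qed
qed

subsection \<open>The logarithm of a symbol\<close>

text \<open>Two \<open>t\<close>-derivatives make the Fourier coefficients of \<open>1 / A\<close>
  decay like \<open>1 / k ^ 2\<close>, so the reciprocal is a symbol \<open>R\<close> without an
  appeal to Wiener's theorem. The derivatives of the logarithm are then \<open>DA * R\<close> and
  \<open>A' * R\<close>, and the former bounds its coefficients.\<close>

lemma log_symbol_exists:
  assumes DA: "t_deriv A DA" "t_deriv DA D2A" and A': "x_deriv A A'"
    and pos: "\<And>x t. x \<in> {0..1} \<Longrightarrow> t \<in> {0..2 * pi} \<Longrightarrow> Re (ev A x t) > 0"
  obtains L DL L' where "t_deriv L DL" "x_deriv L L'"
    "\<And>x t. x \<in> {0..1} \<Longrightarrow> t \<in> {0..2 * pi} \<Longrightarrow> ev L x t = Ln (ev A x t)"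
proof -
  let ?I = "{0..2 * pi}" and ?S = "{0..1 :: real} \<times> {0..2 * pi}"
  have per: "ev f x (2 * pi) = ev f x 0" for f x
    unfolding ev_def ch_period by simp
  have "continuous_on ?S (\<lambda>z. Re (case z of (x, t) \<Rightarrow> ev A x t))"
    by (intro continuous_intros continuous_on_ev)
  then have "\<exists>z\<in>?S. \<forall>w\<in>?S. Re (case z of (x, t) \<Rightarrow> ev A x t) \<le> Re (case w of (x, t) \<Rightarrow> ev A x t)"
    by (intro continuous_attains_inf compact_Times) auto
  then obtain x0 t0 where "x0 \<in> {0..1}" "t0 \<in> ?I"
    and min: "\<And>x t. x \<in> {0..1} \<Longrightarrow> t \<in> ?I \<Longrightarrow> Re (ev A x0 t0) \<le> Re (ev A x t)"
    by fastforce
  define \<delta> where "\<delta> = Re (ev A x0 t0)"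
  have \<delta>: "\<delta> > 0"
    unfolding \<delta>_def by (rule pos) fact+
  have A_ge: "cmod (ev A x t) \<ge> \<delta>" if "x \<in> {0..1}" "t \<in> ?I" for x t
    using min[OF that] complex_Re_le_cmod[of "ev A x t"] by (simp add: \<delta>_def)
  have nz: "ev A x t \<noteq> 0" if "x \<in> {0..1}" "t \<in> ?I" for x t
    using pos[OF that] by auto

  \<comment> \<open>The reciprocal and, as \<open>r_der\<close> and \<open>r1_der\<close> confirm,
    its first two \<open>t\<close>-derivatives.\<close>
  define r where "r = (\<lambda>x t. inverse (ev A x t))"
  define r1 where "r1 = (\<lambda>x t. - \<i> * (ev DA x t * r x t ^ 2))"
  define r2 where "r2 = (\<lambda>x t. - \<i> * (ev DA x t * (r1 x t * (2 * r x t)) + \<i> * ev D2A x t * r x t ^ 2))"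
  have r_le: "cmod (r x t) \<le> 1 / \<delta>" if "x \<in> {0..1}" "t \<in> ?I" for x t
    unfolding r_def norm_inverse inverse_eq_divide[symmetric]
    using A_ge[OF that] \<delta> by (intro le_imp_inverse_le)
  have cont_r: "continuous_on ?S (\<lambda>(x, t). r x t)"
    unfolding r_def case_prod_unfold
    by (intro continuous_on_inverse continuous_on_ev[unfolded case_prod_unfold]) (use nz in auto)
  have r_der: "(r x has_vector_derivative r1 x t) (at t within ?I)" if "x \<in> {0..1}" "t \<in> ?I" for x t
  proof -
    have "((\<lambda>t. inverse (ev A x t)) has_vector_derivative \<i> * ev DA x t * - (inverse (ev A x t) ^ Suc (Suc 0))) (at t within ?I)"
      by (rule has_vector_derivative_compose_field[OF ev_t_deriv[OF DA(1)] DERIV_inverse[OF nz[OF that]]])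
    then show ?thesis
      by (simp add: r_def r1_def power2_eq_square mult_ac)
  qed
  have r1_der: "(r1 x has_vector_derivative r2 x t) (at t within ?I)" if "x \<in> {0..1}" "t \<in> ?I" for x t
  proof -
    have "((\<lambda>w :: complex. w ^ 2) has_field_derivative 2 * w) (at w)" for w
      by (auto intro!: derivative_eq_intros)
    then have "((\<lambda>t. r x t ^ 2) has_vector_derivative r1 x t * (2 * r x t)) (at t within ?I)"
      by (rule has_vector_derivative_compose_field[OF r_der[OF that]])
    then have "((\<lambda>t. - \<i> * (ev DA x t * r x t ^ 2)) has_vector_derivative r2 x t) (at t within ?I)"
      unfolding r2_def
      by (intro has_vector_derivative_mult_right has_vector_derivative_mult ev_t_deriv[OF DA(2)])
    then show ?thesis
      by (simp only: r1_def)
  qed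
  have cont_rx: "continuous_on ?I (r x)" if "x \<in> {0..1}" for x
    using r_der[OF that] by (meson continuous_on_eq_continuous_within has_vector_derivative_continuous)
  have cont_r1: "continuous_on ?I (r1 x)" if "x \<in> {0..1}" for x
    using r1_der[OF that] by (meson continuous_on_eq_continuous_within has_vector_derivative_continuous)
  have cont_r2: "continuous_on ?I (r2 x)" if "x \<in> {0..1}" for x
    unfolding r2_def by (intro continuous_intros continuous_on_ev_t cont_r1 cont_rx that)
  define C where "C = norm DA * (norm DA * (1 / \<delta>) ^ 2 * (2 * (1 / \<delta>))) + norm D2A * (1 / \<delta>) ^ 2"
  have r2_le: "cmod (r2 x t) \<le> C" if "x \<in> {0..1}" "t \<in> ?I" for x t
  proof -
    have r1_le: "cmod (r1 x t) \<le> norm DA * (1 / \<delta>) ^ 2"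
      unfolding r1_def norm_mult norm_power
      using r_le[OF that] \<delta> by (auto intro!: mult_mono norm_ev_le power_mono)
    have "cmod (r2 x t) \<le> cmod (ev DA x t * (r1 x t * (2 * r x t))) + cmod (\<i> * ev D2A x t * r x t ^ 2)"
      unfolding r2_def norm_mult[of "- \<i>"] by (simp add: norm_triangle_ineq)
    also have "\<dots> \<le> C"
      unfolding C_def norm_mult norm_power
      by (intro add_mono mult_mono norm_ev_le power_mono r_le[OF that] r1_le)
        (use \<delta> in \<open>auto simp: norm_ev_le\<close>)
    finally show ?thesis .
  qed
  have four_r: "cmod (four (r x) k) \<le> C / real_of_int k ^ 2" if x: "x \<in> {0..1}" and k: "k \<noteq> 0" for x k
  proof -
    have "four (r2 x) k = \<i> * of_int k * four (r1 x) k"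
      by (rule four_deriv[OF r1_der[OF x] cont_r2[OF x]]) (simp_all add: r1_def r_def per)
    also have "four (r1 x) k = \<i> * of_int k * four (r x) k"
      by (rule four_deriv[OF r_der[OF x] cont_r1[OF x]]) (simp_all add: r_def per)
    finally have "cmod (four (r2 x) k) = real_of_int k ^ 2 * cmod (four (r x) k)"
      by (simp add: norm_mult power2_eq_square)
    then have "real_of_int k ^ 2 * cmod (four (r x) k) \<le> C"
      using norm_four_le[OF cont_r2[OF x] r2_le[OF x], of k] by simp
    then show ?thesis
      using k by (simp add: field_simps)
  qed
  \<comment> \<open>Division by zero yields 0, so at \<open>k = 0\<close> the first summand vanishes
    and the bound \<open>1 / \<delta>\<close> has to be added.\<close>
  define M where "M = (\<lambda>k. C * (1 / real_of_int k ^ 2) + (if k = 0 then 1 / \<delta> else 0))"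
  have sum_single: "(\<lambda>k :: int. if k = 0 then b else 0 :: real) summable_on UNIV" for b
    by (rule finite_nonzero_values_imp_summable_on) (simp add: Collect_conv_if)
  have M: "M summable_on UNIV"
    unfolding M_def by (intro summable_on_add summable_on_cmult_right summable_on_int_inverse_square sum_single)
  obtain R where "\<And>k x. cf R k x = four (r (clamp 0 1 x)) k"
    and R: "\<And>k x. x \<in> {0..1} \<Longrightarrow> cf R k x = four (r x) k" and "\<And>k. wn R k \<le> M k"
  proof (rule symbolI[of "\<lambda>k x. four (r x) k" M])
    show "continuous_on {0..1} (\<lambda>x. four (r x) k)" for k
      by (rule continuous_on_four[OF cont_r])
    show "cmod (four (r x) k) \<le> M k" if "x \<in> {0..1}" for k x
      using four_r[OF that, of k] norm_four_le[OF cont_rx[OF that] r_le[OF that], of k]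
      by (cases "k = 0") (auto simp: M_def)
  qed (rule M, blast)
  have conv_R: "cf (f * R) k x = four (\<lambda>t. ev f x t * r x t) k" if "x \<in> {0..1}" for f k x
    using cf_mult[of f x R k] four_ev_mult[OF cont_rx[OF that], of f x k] that
    by (simp add: R has_sum_unique)
  \<comment> \<open>So far \<open>R\<close> is given only by Fourier coefficients. Comparing those
    of \<open>A * R\<close> with those of 1 shows that its series does sum to
    \<open>r\<close>.\<close>
  have AR: "cf (A * R) k x = cf 1 k x" if "x \<in> {0..1}" for k x
  proof -
    have "cf (A * R) k x = four (\<lambda>_. 1) k"
      unfolding conv_R[OF that] by (rule four_cong) (use nz that in \<open>simp add: r_def\<close>)
    then show ?thesis by (simp add: four_one)
  qed
  have ev_R: "ev R x t = r x t" if "x \<in> {0..1}" "t \<in> ?I" for x t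
  proof -
    have "ev A x t * ev R x t = 1"
      using ev_cong[of "A * R" x 1 t] AR[OF that(1)] by (simp add: ev_mult ev_one)
    then show ?thesis
      using nz[OF that] by (simp add: r_def field_simps)
  qed

  define l where "l = (\<lambda>x t. Ln (ev A x t))"
  have nonpos: "ev A x t \<notin> \<real>\<^sub>\<le>\<^sub>0" if "x \<in> {0..1}" "t \<in> ?I" for x t
    using pos[OF that] by (auto simp: complex_nonpos_Reals_iff)
  have cont_l: "continuous_on ?S (\<lambda>(x, t). l x t)"
    unfolding l_def case_prod_unfold
    by (intro continuous_on_Ln' continuous_on_ev[unfolded case_prod_unfold]) (use nonpos in auto)
  have l_t: "(l x has_vector_derivative \<i> * ev DA x t * r x t) (at t within ?I)"
    if "x \<in> {0..1}" "t \<in> ?I" for x t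
    unfolding l_def r_def
    by (rule has_vector_derivative_compose_field[OF ev_t_deriv[OF DA(1)] has_field_derivative_Ln[OF nonpos[OF that]]])
  have l_x: "((\<lambda>x. l x t) has_vector_derivative ev A' x t * r x t) (at x within {0..1})"
    if "x \<in> {0..1}" "t \<in> ?I" for x t
    unfolding l_def r_def
    by (rule has_vector_derivative_compose_field[OF ev_x_deriv[OF A' that(1)] has_field_derivative_Ln[OF nonpos[OF that]]])
  have cont_lx: "continuous_on ?I (l x)" if "x \<in> {0..1}" for x
    using l_t[OF that] by (meson continuous_on_eq_continuous_within has_vector_derivative_continuous)
  have four_l: "of_int k * four (l x) k = cf (DA * R) k x" if x: "x \<in> {0..1}" for k x
  proof -
    \<comment> \<open>\<open>l x\<close> inherits its period from \<open>ev A x\<close>: with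
      positive real part the principal branch never jumps, so there is no winding number.\<close>
    have "four (\<lambda>t. \<i> * ev DA x t * r x t) k = \<i> * of_int k * four (l x) k"
      by (rule four_deriv[OF l_t[OF x]])
        (auto intro!: continuous_intros continuous_on_ev_t cont_rx x simp: l_def per)
    moreover have "four (\<lambda>t. \<i> * ev DA x t * r x t) k = \<i> * cf (DA * R) k x"
      using four_cmult[of \<i> "\<lambda>t. ev DA x t * r x t" k] by (simp add: conv_R[OF x] mult.assoc)
    ultimately show ?thesis by simp
  qed
  have four_l_x: "((\<lambda>x. four (l x) k) has_vector_derivative cf (A' * R) k x) (at x within {0..1})"
    if x: "x \<in> {0..1}" for k x
  proof -
    have "((\<lambda>x. integral (cbox 0 (2 * pi)) (\<lambda>t. l x t * ch (- k) t)) has_vector_derivative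
        integral (cbox 0 (2 * pi)) (\<lambda>t. ev A' x t * r x t * ch (- k) t)) (at x within {0..1})"
    proof (rule leibniz_rule_vector_derivative[where f = "\<lambda>x t. l x t * ch (- k) t"])
      show "((\<lambda>x. l x t * ch (- k) t) has_vector_derivative ev A' x t * r x t * ch (- k) t) (at x within {0..1})"
        if "x \<in> {0..1}" "t \<in> cbox 0 (2 * pi)" for x t
        using has_vector_derivative_mult_left[OF l_x[of x t]] that by simp
      show "(\<lambda>t. l x t * ch (- k) t) integrable_on cbox 0 (2 * pi)" if "x \<in> {0..1}" for x
        using cont_lx[OF that] by (intro integrable_continuous continuous_intros) simp
      have "continuous_on ?S (\<lambda>z. (case z of (x, t) \<Rightarrow> ev A' x t) * (case z of (x, t) \<Rightarrow> r x t) * ch (- k) (snd z))"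
        by (intro continuous_intros continuous_on_ev cont_r)
      then show "continuous_on ({0..1} \<times> cbox 0 (2 * pi)) (\<lambda>(x, t). ev A' x t * r x t * ch (- k) t)"
        by (simp add: case_prod_unfold)
    qed (use x in auto)
    then show ?thesis
      unfolding conv_R[OF x] unfolding four_def ch_uminus box_real by (rule has_vector_derivative_mult_right)
  qed
  have "compact ((\<lambda>(x, t). l x t) ` ?S)"
    by (intro compact_continuous_image cont_l compact_Times) auto
  then have "bounded ((\<lambda>(x, t). l x t) ` ?S)"
    by (rule compact_imp_bounded)
  then obtain B where B: "\<And>x t. x \<in> {0..1} \<Longrightarrow> t \<in> ?I \<Longrightarrow> cmod (l x t) \<le> B"
    unfolding bounded_iff by fastforce
  define N where "N = (\<lambda>k. wn (DA * R) k + (if k = 0 then B else 0))"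
  have N: "N summable_on UNIV"
    unfolding N_def by (intro summable_on_add wcoeff_summable sum_single)
  have cont_four_l: "continuous_on {0..1} (\<lambda>x. four (l x) k)" for k
    by (rule continuous_on_four[OF cont_l])
  obtain L where L: "\<And>k x. cf L k x = four (l (clamp 0 1 x)) k" "\<And>k x. x \<in> {0..1} \<Longrightarrow> cf L k x = four (l x) k"
    and "\<And>k. wn L k \<le> N k"
  proof (rule symbolI[of "\<lambda>k x. four (l x) k" N])
    show "cmod (four (l x) k) \<le> N k" if x: "x \<in> {0..1}" for k x
    proof (cases "k = 0")
      case True
      then show ?thesis
        using norm_four_le[OF cont_lx[OF x] B[OF x], of k] by (simp add: N_def add_increasing)
    next
      case False
      then have "1 \<le> \<bar>real_of_int k\<bar>"
        by linarith
      then have "1 * cmod (four (l x) k) \<le> \<bar>real_of_int k\<bar> * cmod (four (l x) k)"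
        by (rule mult_right_mono) simp
      also have "\<dots> = cmod (cf (DA * R) k x)"
        unfolding four_l[OF x, symmetric] by (simp add: norm_mult)
      also have "\<dots> \<le> wn (DA * R) k"
        by (rule norm_cf_le)
      finally show ?thesis using False by (simp add: N_def)
    qed
  qed (rule cont_four_l, rule N, blast)
  \<comment> \<open>Built from the coefficients of \<open>l\<close> and not as
    \<open>DA * R\<close>, since \<open>t_deriv\<close> must hold also for \<open>x\<close> outside
    \<open>[0,1]\<close>.\<close>
  obtain DL where DL: "\<And>k x. cf DL k x = of_int k * four (l (clamp 0 1 x)) k"
    "\<And>k x. x \<in> {0..1} \<Longrightarrow> cf DL k x = of_int k * four (l x) k"
    and "\<And>k. wn DL k \<le> wn (DA * R) k"
  proof (rule symbolI[of "\<lambda>k x. of_int k * four (l x) k" "wn (DA * R)"])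
    show "cmod (of_int k * four (l x) k) \<le> wn (DA * R) k" if "x \<in> {0..1}" for k x
      unfolding four_l[OF that] by (rule norm_cf_le)
    show "continuous_on {0..1} (\<lambda>x. of_int k * four (l x) k)" for k
      by (intro continuous_intros cont_four_l)
  qed (rule wcoeff_summable, blast)
  have tL: "t_deriv L DL"
    by (simp add: t_deriv_def L(1) DL(1))
  have xL: "x_deriv L (A' * R)"
    unfolding x_deriv_def
  proof (intro allI ballI)
    fix k and x :: real assume x: "x \<in> {0..1}"
    show "(cf L k has_vector_derivative cf (A' * R) k x) (at x within {0..1})"
      by (rule has_vector_derivative_transform[OF x _ four_l_x[OF x]]) (simp add: L(2))
  qed
  have "ev L x t = Ln (ev A x t)" if x: "x \<in> {0..1}" and t: "t \<in> ?I" for x t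
  proof -
    \<comment> \<open>Both sides have the same \<open>t\<close>-derivative, so they differ by a
      constant in \<open>t\<close>, which the zeroth Fourier coefficients then show to be 0.\<close>
    have "\<exists>c. \<forall>t\<in>?I. l x t - ev L x t = c"
    proof (rule has_derivative_zero_constant)
      fix t assume t: "t \<in> ?I"
      have "ev DL x t = ev (DA * R) x t"
        by (rule ev_cong) (simp add: DL(2)[OF x] four_l[OF x])
      then have "\<i> * ev DA x t * r x t - \<i> * ev DL x t = 0"
        by (simp add: ev_mult ev_R[OF x t] mult.assoc)
      with has_vector_derivative_diff[OF l_t[OF x t] ev_t_deriv[OF tL, of x t ?I]]
      have "((\<lambda>t. l x t - ev L x t) has_vector_derivative 0) (at t within ?I)"
        by (simp only:)
      then show "((\<lambda>t. l x t - ev L x t) has_derivative (\<lambda>h. 0)) (at t within ?I)"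
        by (simp add: has_vector_derivative_def)
    qed simp
    then obtain c where c: "\<And>t. t \<in> ?I \<Longrightarrow> l x t - ev L x t = c" by blast
    have "four (l x) 0 = four (\<lambda>t. ev L x t + c * 1) 0"
      by (rule four_cong) (use c in \<open>auto simp: algebra_simps\<close>)
    also have "\<dots> = four (ev L x) 0 + c"
      by (subst four_add) (auto intro!: continuous_on_ev_t simp: four_cmult four_one simp del: mult_1_right)
    also have "four (ev L x) 0 = four (l x) 0"
      by (simp add: four_ev L(2)[OF x])
    finally have "c = 0" by simp
    then show ?thesis
      using c[OF t] by (simp add: l_def)
  qed
  with tL xL show ?thesis by (rule that)
qed

subsection \<open>Splitting by the sign of the index\<close>

definition restr :: "(int \<Rightarrow> bool) \<Rightarrow> symbol \<Rightarrow> symbol" where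
  "restr P f = Wiener (\<lambda>k. if P k then wcoeff f k else 0)"

lemma cf_restr [simp]: "cf (restr P f) k x = (if P k then cf f k x else 0)"
proof -
  have "(\<lambda>k. norm (if P k then wcoeff f k else 0)) summable_on UNIV"
    by (rule summable_on_comparison_test[OF wcoeff_summable[of f]]) auto
  then have "wcoeff (restr P f) = (\<lambda>k. if P k then wcoeff f k else 0)"
    unfolding restr_def by (simp add: Wiener_inverse)
  then show ?thesis
    by (simp add: cf_def)
qed

lemma t_deriv_restr: "t_deriv f g \<Longrightarrow> t_deriv (restr P f) (restr P g)"
  by (simp add: t_deriv_def)

lemma x_deriv_restr:
  assumes "x_deriv f g"
  shows "x_deriv (restr P f) (restr P g)"
proof -
  have "cf (restr P f) k = (if P k then cf f k else (\<lambda>_. 0))" for k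
    by auto
  then show ?thesis
    using assms by (auto simp: x_deriv_def)
qed

subsection \<open>Left-endpoint Riemann sums\<close>

lemma integral_subdivide:
  fixes f :: "real \<Rightarrow> complex"
  assumes f: "continuous_on {0..1} f" and "m \<le> N" "N > 0"
  shows "integral {0..real m / real N} f = (\<Sum>i<m. integral {real i / real N..real (Suc i) / real N} f)"
  using \<open>m \<le> N\<close>
proof (induction m)
  case (Suc m)
  have "integral {0..real m / real N} f + integral {real m / real N..real (Suc m) / real N} f =
      integral {0..real (Suc m) / real N} f"
  proof (rule Henstock_Kurzweil_Integration.integral_combine)
    have "{0..real (Suc m) / real N} \<subseteq> {0..1}"
      using Suc.prems \<open>N > 0\<close> by (auto simp: divide_le_eq)
    then show "f integrable_on {0..real (Suc m) / real N}"
      using f by (intro integrable_continuous_real) (rule continuous_on_subset)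
  qed (use \<open>N > 0\<close> in \<open>auto simp: divide_right_mono\<close>)
  with Suc show ?case by simp
qed simp

text \<open>The first term of the Euler-Maclaurin formula, for functions that are merely
  continuously differentiable.\<close>

lemma riemann_sum_tendsto:
  assumes f: "x_deriv f g"
  shows "(\<lambda>n. (\<Sum>i\<in>idx n. cf f k (node n i i)) - of_nat (n + 1) * integral {0..1} (cf f k)) \<longlonglongrightarrow>
    (cf f k 0 - cf f k 1) / 2"
proof (rule LIMSEQ_I)
  fix e :: real assume "e > 0"
  let ?F = "cf f k" and ?G = "cf g k"
  obtain d where d: "d > 0" "\<And>x y. x \<in> {0..1} \<Longrightarrow> y \<in> {0..1} \<Longrightarrow> \<bar>y - x\<bar> < d \<Longrightarrow>
      cmod (?F y - ?F x - of_real (y - x) * ?G x) \<le> e / 4 * \<bar>y - x\<bar>"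
    using x_deriv_linearization[OF f, of "e / 4" k] \<open>e > 0\<close> by auto
  obtain n0 where n0: "1 / real (Suc n0) < d"
    using reals_Archimedean[OF d(1)] by (auto simp: inverse_eq_divide)
  have "norm ((\<Sum>i\<in>idx n. ?F (node n i i)) - of_nat (n + 1) * integral {0..1} ?F - (?F 0 - ?F 1) / 2) < e"
    if n: "n \<ge> n0" for n
  proof -
    define N where "N = n + 1"
    define h where "h = 1 / real N"
    define p where "p = (\<lambda>i. real i / real N)"
    have N: "N > 0" by (simp add: N_def)
    have h: "h > 0" "h < d"
    proof -
      show "h > 0" using N by (simp add: h_def)
      have "h \<le> 1 / real (Suc n0)"
        unfolding h_def N_def using n by (intro divide_left_mono) auto
      then show "h < d" using n0 by simp
    qed
    have p_Suc: "p (Suc i) = p i + h" for i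
      by (simp add: p_def h_def add_divide_distrib)
    have p_in: "p i \<in> {0..1}" if "i \<le> N" for i
      using that N by (auto simp: p_def divide_le_eq)
    have cF: "continuous_on S ?F" for S
      by (rule continuous_on_cf)
    \<comment> \<open>Integral and right end value are both compared with the linearization at
      \<open>p i\<close>, whose terms cancel because \<open>N * h = 1\<close>. What remains is
      \<open>e / 4 * h + e / 8 * h\<close>, and \<open>N\<close> cells give at most
      \<open>e / 2\<close>.\<close>
    have step: "cmod (of_nat N * integral {p i..p (Suc i)} ?F - (?F (p i) + ?F (p (Suc i))) / 2) \<le> e / 2 * h"
      if i: "i < N" for i
    proof -
      have mem: "p i \<in> {0..1}" "p (Suc i) \<in> {0..1}"
        using p_in i by auto
      let ?L = "\<lambda>x. ?F (p i) + of_real (x - p i) * ?G (p i)"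
      have int_L: "(?L has_integral (of_real h * ?F (p i) + of_real (h ^ 2 / 2) * ?G (p i))) {p i..p (Suc i)}"
      proof -
        have "((\<lambda>x. of_real (x - p i) * ?F (p i) + of_real ((x - p i) ^ 2 / 2) * ?G (p i)) has_vector_derivative ?L x)
            (at x within {p i..p (Suc i)})" for x
          by (auto intro!: derivative_eq_intros has_vector_derivative_real_field simp: has_vector_derivative_def
              scaleR_conv_of_real field_simps)
        then have "(?L has_integral
            (of_real (p (Suc i) - p i) * ?F (p i) + of_real ((p (Suc i) - p i) ^ 2 / 2) * ?G (p i)) -
            (of_real (p i - p i) * ?F (p i) + of_real ((p i - p i) ^ 2 / 2) * ?G (p i))) {p i..p (Suc i)}"
          by (intro fundamental_theorem_of_calculus) (use h p_Suc in auto)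
        then show ?thesis
          by (simp add: p_Suc)
      qed
      have "norm (integral {p i..p (Suc i)} (\<lambda>x. ?F x - ?L x)) \<le> e / 4 * h * (p (Suc i) - p i)"
      proof (rule integral_bound)
        show "norm (?F x - ?L x) \<le> e / 4 * h" if x: "x \<in> {p i..p (Suc i)}" for x
        proof -
          have "norm (?F x - ?F (p i) - of_real (x - p i) * ?G (p i)) \<le> e / 4 * \<bar>x - p i\<bar>"
            using x mem p_Suc[of i] h by (intro d(2)) auto
          also have "\<dots> \<le> e / 4 * h"
            using x p_Suc[of i] \<open>e > 0\<close> by (intro mult_left_mono) auto
          finally show ?thesis by (simp add: algebra_simps)
        qed
      qed (use h p_Suc in \<open>auto intro!: continuous_intros cF\<close>)
      moreover have "integral {p i..p (Suc i)} (\<lambda>x. ?F x - ?L x) =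
          integral {p i..p (Suc i)} ?F - (of_real h * ?F (p i) + of_real (h ^ 2 / 2) * ?G (p i))"
        by (rule integral_unique, rule has_integral_diff[OF integrable_integral int_L])
          (intro integrable_continuous_real cF)
      ultimately have 1: "norm (integral {p i..p (Suc i)} ?F - (of_real h * ?F (p i) + of_real (h ^ 2 / 2) * ?G (p i))) \<le> e / 4 * h * h"
        using p_Suc[of i] by simp
      have 2: "norm (?F (p (Suc i)) - ?F (p i) - of_real h * ?G (p i)) \<le> e / 4 * h"
        using d(2)[OF mem] h p_Suc[of i] by simp
      have Nh: "complex_of_nat N * of_real h = 1"
        using N by (simp add: h_def)
      have "of_nat N * integral {p i..p (Suc i)} ?F - (?F (p i) + ?F (p (Suc i))) / 2 =
          of_nat N * (integral {p i..p (Suc i)} ?F - (of_real h * ?F (p i) + of_real (h ^ 2 / 2) * ?G (p i)))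
          - (?F (p (Suc i)) - ?F (p i) - of_real h * ?G (p i)) / 2"
      proof -
        have "of_nat N * (of_real h * ?F (p i) + of_real (h ^ 2 / 2) * ?G (p i)) =
            (complex_of_nat N * of_real h) * ?F (p i) + (complex_of_nat N * of_real h) * of_real h * ?G (p i) / 2"
          by (simp add: algebra_simps power2_eq_square)
        then show ?thesis
          unfolding Nh by (simp add: algebra_simps diff_divide_distrib add_divide_distrib)
      qed
      also have "norm \<dots> \<le> real N * (e / 4 * h * h) + e / 4 * h / 2"
        by (rule order_trans[OF norm_triangle_ineq4], unfold norm_mult norm_divide norm_of_nat norm_numeral)
          (intro add_mono mult_left_mono divide_right_mono 1 2, simp_all)
      also have "real N * (e / 4 * h * h) = e / 4 * h"
        using N by (simp add: h_def)
      also have "e / 4 * h + e / 4 * h / 2 \<le> e / 2 * h"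
        using mult_pos_pos[OF \<open>e > 0\<close> h(1)] by simp
      finally show ?thesis .
    qed
    have node: "node n (int i) (int i) = p i" for i
      by (simp add: node_def p_def N_def field_simps)
    have sumF: "(\<Sum>i\<in>idx n. ?F (node n i i)) = (\<Sum>i<N. ?F (p i))"
      unfolding N_def sum_idx[of "\<lambda>i. ?F (node n i i)", symmetric] node ..
    \<comment> \<open>The trapezoidal sum differs from the left-endpoint sum by a telescoping
      half-difference; this is the limit asserted.\<close>
    have tel: "(\<Sum>i<N. (?F (p i) + ?F (p (Suc i))) / 2) = (\<Sum>i<N. ?F (p i)) - (?F 0 - ?F 1) / 2"
    proof -
      have "(\<Sum>i<N. (?F (p i) + ?F (p (Suc i))) / 2) =
          (\<Sum>i<N. ?F (p i)) + (\<Sum>i<N. ?F (p (Suc i)) - ?F (p i)) / 2"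
        by (simp add: sum.distrib[symmetric] sum_divide_distrib diff_divide_distrib add_divide_distrib)
      also have "(\<Sum>i<N. ?F (p (Suc i)) - ?F (p i)) = ?F (p N) - ?F (p 0)"
        by (rule sum_lessThan_telescope)
      finally show ?thesis
        using N by (simp add: p_def field_simps)
    qed
    have "integral {0..1} ?F = (\<Sum>i<N. integral {p i..p (Suc i)} ?F)"
      using integral_subdivide[OF cF, of N N] N by (simp add: p_def)
    then have "(\<Sum>i\<in>idx n. ?F (node n i i)) - of_nat (n + 1) * integral {0..1} ?F - (?F 0 - ?F 1) / 2 =
        - (\<Sum>i<N. of_nat N * integral {p i..p (Suc i)} ?F - (?F (p i) + ?F (p (Suc i))) / 2)"
      unfolding sumF N_def[symmetric] sum_subtractf tel sum_distrib_left[symmetric] by simp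
    also have "norm \<dots> \<le> (\<Sum>i<N. e / 2 * h)"
      unfolding norm_minus_cancel by (intro sum_norm_le step) simp
    also have "\<dots> = e / 2"
      using N by (simp add: h_def)
    also have "\<dots> < e"
      using \<open>e > 0\<close> by simp
    finally show ?thesis .
  qed
  then show "\<exists>n0. \<forall>n\<ge>n0. norm ((\<Sum>i\<in>idx n. ?F (node n i i)) - of_nat (n + 1) * integral {0..1} ?F -
      (?F 0 - ?F 1) / 2) < e"
    by blast
qed

subsection \<open>Reading off the hypotheses\<close>

lemma sum_le_infsum_ennreal:
  fixes f :: "'a \<Rightarrow> ennreal"
  assumes "finite F"
  shows "(\<Sum>k\<in>F. f k) \<le> (\<Sum>\<^sub>\<infinity>k. f k)"
proof -
  have "(\<Sum>\<^sub>\<infinity>k. f k) = (SUP F\<in>{F. finite F \<and> F \<subseteq> UNIV}. sum f F)"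
    by (rule nonneg_infsum_complete) simp
  then show ?thesis
    using assms by (auto intro: SUP_upper)
qed

lemma summable_on_ennreal_majorant:
  fixes g :: "'a \<Rightarrow> real"
  assumes fin: "(\<Sum>\<^sub>\<infinity>k. f k) < (\<infinity> :: ennreal)" and le: "\<And>k. ennreal (g k) \<le> f k" and "\<And>k. g k \<ge> 0"
  shows "g summable_on UNIV"
proof (rule nonneg_bdd_above_summable_on)
  show "bdd_above (sum g ` {F. F \<subseteq> UNIV \<and> finite F})"
  proof (rule bdd_aboveI2)
    fix F :: "'a set" assume "F \<in> {F. F \<subseteq> UNIV \<and> finite F}"
    then have F: "finite F" by simp
    have "ennreal (sum g F) = (\<Sum>k\<in>F. ennreal (g k))"
      using assms by (simp add: sum_ennreal)
    also have "\<dots> \<le> (\<Sum>k\<in>F. f k)"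
      by (intro sum_mono le)
    also have "\<dots> \<le> (\<Sum>\<^sub>\<infinity>k. f k)"
      using F by (rule sum_le_infsum_ennreal)
    finally have "ennreal (sum g F) \<le> (\<Sum>\<^sub>\<infinity>k. f k)" .
    then show "sum g F \<le> enn2real (\<Sum>\<^sub>\<infinity>k. f k)"
      using fin by (metis assms(3) enn2real_ennreal enn2real_mono infinity_ennreal_def sum_nonneg)
  qed
qed (use assms in auto)

lemma term_finite_of_infsum:
  fixes f :: "'a \<Rightarrow> ennreal"
  assumes "(\<Sum>\<^sub>\<infinity>k. f k) < \<infinity>"
  shows "f k < \<infinity>"
proof -
  have "(\<Sum>k\<in>{k}. f k) \<le> (\<Sum>\<^sub>\<infinity>k. f k)"
    by (rule sum_le_infsum_ennreal) simp
  then show ?thesis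
    using assms by (simp add: order.strict_trans1)
qed

lemma norm_le_enn2real_sup_norm:
  assumes "sup_norm_on S f < \<infinity>" "x \<in> S"
  shows "norm (f x) \<le> enn2real (sup_norm_on S f)"
proof -
  have "ennreal (norm (f x)) \<le> sup_norm_on S f"
    unfolding sup_norm_on_def using assms(2) by (rule SUP_upper)
  then show ?thesis
    using assms(1) by (metis enn2real_ennreal enn2real_mono infinity_ennreal_def norm_ge_zero)
qed

lemma sup_norm_on_finite:
  assumes "continuous_on S f" "compact S"
  shows "sup_norm_on S f < \<infinity>"
proof -
  obtain B where B: "\<And>x. x \<in> S \<Longrightarrow> norm (f x) \<le> B"
    using compact_imp_bounded[OF compact_continuous_image[OF assms]] unfolding bounded_iff by blast
  have "sup_norm_on S f \<le> ennreal B"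
    unfolding sup_norm_on_def by (intro SUP_least ennreal_leI B)
  also have "\<dots> < \<infinity>" by simp
  finally show ?thesis .
qed

text \<open>Together with the sup part of the norm, this lets the derivatives of the Fourier
  coefficients form a symbol.\<close>

lemma continuous_on_holder:
  assumes fin: "holder_seminorm_on \<epsilon> S f < \<infinity>" and "\<epsilon> > 0"
  shows "continuous_on S f"
  unfolding continuous_on_iff
proof (intro ballI allI impI)
  fix x e assume x: "x \<in> S" and e: "(e :: real) > 0"
  define C where "C = enn2real (holder_seminorm_on \<epsilon> S f)"
  have C: "norm (f y - f x) \<le> C * dist y x powr \<epsilon>" if y: "y \<in> S" for y
  proof (cases "y = x")
    case False
    have "ennreal (norm (f y - f x) / dist y x powr \<epsilon>) \<le> holder_seminorm_on \<epsilon> S f"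
      unfolding holder_seminorm_on_def
      by (rule SUP_upper2[of "(y, x)"]) (use x y False in auto)
    then have "norm (f y - f x) / dist y x powr \<epsilon> \<le> C"
      unfolding C_def using fin
      by (metis divide_nonneg_nonneg enn2real_ennreal enn2real_mono infinity_ennreal_def norm_ge_zero powr_ge_zero)
    then show ?thesis
      using False by (simp add: divide_le_eq)
  qed simp
  have C0: "C \<ge> 0" by (simp add: C_def)
  define d where "d = (e / (C + 1)) powr (1 / \<epsilon>)"
  have "d > 0"
    using e C0 by (simp add: d_def)
  moreover have "dist (f y) (f x) < e" if y: "y \<in> S" "dist y x < d" for y
  proof -
    have "dist y x powr \<epsilon> \<le> d powr \<epsilon>"
      using y(2) \<open>\<epsilon> > 0\<close> by (intro powr_mono2) auto
    also have "d powr \<epsilon> = e / (C + 1)"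
      using \<open>\<epsilon> > 0\<close> e C0 by (simp add: d_def powr_powr)
    finally have "norm (f y - f x) \<le> C * (e / (C + 1))"
      using C[OF y(1)] C0 by (meson mult_left_mono order_trans)
    also have "\<dots> < e"
      using e C0 by (simp add: field_simps)
    finally show ?thesis by (simp add: dist_norm)
  qed
  ultimately show "\<exists>d>0. \<forall>y\<in>S. dist y x < d \<longrightarrow> dist (f y) (f x) < e"
    by blast
qed

lemma fourier_coeff_eq_four: "fourier_coeff a k x = four (a x) k"
  by (simp add: fourier_coeff_def four_def)

theorem theorem3p2:
  fixes a :: "real \<Rightarrow> real \<Rightarrow> complex" and \<alpha> \<epsilon> :: real
  assumes "0 < \<alpha>" and "\<alpha> \<le> 1"
    and fourier_series:
      "\<And>x t. x \<in> {0..1} \<Longrightarrow> t \<in> {0..2 * pi} \<Longrightarrow>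
         ((\<lambda>k::int. fourier_coeff a k x * exp (\<i> * of_int k * of_real t)) has_sum a x t) UNIV"
    and smooth_t: "\<And>x. x \<in> {0..1} \<Longrightarrow> C1_holder_on \<alpha> {0..2 * pi} (\<lambda>t. a x t)"
    and smooth_x:
      "\<And>t. t \<in> {0..2 * pi} \<Longrightarrow> C_diff_on (1 + nat \<lceil>1 / \<alpha>\<rceil>) {0..1} (\<lambda>x. a x t)"
    and sum_coeffs:
      "(\<Sum>\<^sub>\<infinity>k::int. ennreal (\<bar>real_of_int k\<bar> powr (1 + 1 / \<alpha>))
                      * sup_norm_on {0..1} (fourier_coeff a k)) < \<infinity>"
    and "0 < \<epsilon>" and "\<epsilon> \<le> 1"
    and diff_coeffs: "\<And>k::int. fourier_coeff a k differentiable_on {0..1}"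
    and sum_derivs:
      "(\<Sum>\<^sub>\<infinity>k::int. holder_norm_on \<epsilon> {0..1} (fourier_coeff_deriv a k)) < \<infinity>"
    and Re_pos: "\<And>x t. x \<in> {0..1} \<Longrightarrow> t \<in> {0..2 * pi} \<Longrightarrow> Re (a x t) > 0"
  shows "(\<lambda>n. Determinant.det (KMS_matrix n a) / G_const a ^ (n + 1)) \<longlonglongrightarrow>
           exp (1 / 2 * (e_const a 0 - e_const a 1 + E_const a 0 + E_const a 1))"
proof -
  define s where "s = (\<lambda>k. enn2real (sup_norm_on {0..1} (fourier_coeff a k)))"
  have cont_a: "continuous_on {0..1} (fourier_coeff a k)" for k
    by (rule differentiable_imp_continuous_on[OF diff_coeffs])
  have s_fin: "sup_norm_on {0..1} (fourier_coeff a k) < \<infinity>" for k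
    by (rule sup_norm_on_finite[OF cont_a]) simp
  have s_eq: "sup_norm_on {0..1} (fourier_coeff a k) = ennreal (s k)" for k
    using s_fin[of k] by (simp add: s_def less_top)
  have s_le: "cmod (fourier_coeff a k x) \<le> s k" if "x \<in> {0..1}" for k x
    unfolding s_def by (rule norm_le_enn2real_sup_norm[OF s_fin that])
  have s0: "s k \<ge> 0" for k
    by (simp add: s_def)
  \<comment> \<open>As \<alpha> is at most 1, the exponent \<open>1 + 1 / \<alpha>\<close> is at
    least 2: these are the two \<open>t\<close>-derivatives that \<open>log_symbol_exists\<close>
    asks for.\<close>
  have sq: "(\<lambda>k. real_of_int k ^ 2 * s k) summable_on UNIV"
  proof (rule summable_on_ennreal_majorant[OF sum_coeffs])
    fix k
    have "real_of_int k ^ 2 \<le> \<bar>real_of_int k\<bar> powr (1 + 1 / \<alpha>)"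
    proof (cases "k = 0")
      case False
      then have "1 \<le> \<bar>real_of_int k\<bar>"
        by linarith
      moreover have "2 \<le> 1 + 1 / \<alpha>"
        using \<open>0 < \<alpha>\<close> \<open>\<alpha> \<le> 1\<close> by simp
      ultimately have "\<bar>real_of_int k\<bar> powr 2 \<le> \<bar>real_of_int k\<bar> powr (1 + 1 / \<alpha>)"
        by (intro powr_mono)
      then show ?thesis
        using False by (simp add: powr_numeral)
    qed simp
    then show "ennreal (real_of_int k ^ 2 * s k) \<le>
        ennreal (\<bar>real_of_int k\<bar> powr (1 + 1 / \<alpha>)) * sup_norm_on {0..1} (fourier_coeff a k)"
      unfolding s_eq using s0 by (simp add: ennreal_mult[symmetric] ennreal_leI mult_right_mono)
  qed (use s0 in auto)
  have one_le: "1 \<le> \<bar>real_of_int k\<bar>" if "k \<noteq> 0" for k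
    using that by linarith
  have s_sum: "s summable_on UNIV"
  proof (rule summable_on_comparison_test)
    \<comment> \<open>The weight \<open>k ^ 2\<close> vanishes at \<open>k = 0\<close>, so that term
      is put in by hand.\<close>
    show "(\<lambda>k. real_of_int k ^ 2 * s k + (if k = 0 then s 0 else 0)) summable_on UNIV"
      by (intro summable_on_add sq finite_nonzero_values_imp_summable_on) (simp add: Collect_conv_if)
    show "s k \<le> real_of_int k ^ 2 * s k + (if k = 0 then s 0 else 0)" for k
      using mult_right_mono[of 1 "real_of_int k ^ 2" "s k"] one_le[of k] s0[of k]
      by (cases "k = 0") (auto simp: abs_le_square_iff[of 1, simplified])
  qed (use s0 in auto)
  have abs_sum: "(\<lambda>k. \<bar>real_of_int k\<bar> * s k) summable_on UNIV"
  proof (rule summable_on_comparison_test[OF sq])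
    show "\<bar>real_of_int k\<bar> * s k \<le> real_of_int k ^ 2 * s k" for k
      using mult_right_mono[of 1 "\<bar>real_of_int k\<bar>" "\<bar>real_of_int k\<bar>"] one_le[of k] s0[of k]
      by (cases "k = 0") (auto simp: power2_eq_square intro!: mult_right_mono)
  qed (use s0 in auto)

  obtain A where A: "\<And>k x. cf A k x = fourier_coeff a k (clamp 0 1 x)"
    "\<And>k x. x \<in> {0..1} \<Longrightarrow> cf A k x = fourier_coeff a k x" "\<And>k. wn A k \<le> s k"
    by (rule symbolI[of "fourier_coeff a" s, OF cont_a _ s_sum]) (erule s_le, blast)
  obtain DA where DA: "\<And>k x. cf DA k x = of_int k * fourier_coeff a k (clamp 0 1 x)"
    "\<And>k x. x \<in> {0..1} \<Longrightarrow> cf DA k x = of_int k * fourier_coeff a k x"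
    "\<And>k. wn DA k \<le> \<bar>real_of_int k\<bar> * s k"
  proof (rule symbolI)
    show "continuous_on {0..1} (\<lambda>x. of_int k * fourier_coeff a k x)" for k
      by (intro continuous_intros cont_a)
    show "cmod (of_int k * fourier_coeff a k x) \<le> \<bar>real_of_int k\<bar> * s k" if "x \<in> {0..1}" for k x
      using s_le[OF that, of k] by (simp add: norm_mult mult_left_mono)
  qed (rule abs_sum, blast)
  obtain D2A where D2A: "\<And>k x. cf D2A k x = of_int k ^ 2 * fourier_coeff a k (clamp 0 1 x)"
    "\<And>k x. x \<in> {0..1} \<Longrightarrow> cf D2A k x = of_int k ^ 2 * fourier_coeff a k x"
    "\<And>k. wn D2A k \<le> real_of_int k ^ 2 * s k"
  proof (rule symbolI)
    show "continuous_on {0..1} (\<lambda>x. of_int k ^ 2 * fourier_coeff a k x)" for k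
      by (intro continuous_intros cont_a)
    show "cmod (of_int k ^ 2 * fourier_coeff a k x) \<le> real_of_int k ^ 2 * s k" if "x \<in> {0..1}" for k x
      using s_le[OF that, of k] by (simp add: norm_mult norm_power mult_left_mono)
  qed (rule sq, blast)
  have tA: "t_deriv A DA" "t_deriv DA D2A"
    by (simp_all add: t_deriv_def A(1) DA(1) D2A(1) power2_eq_square)

  define m where "m = (\<lambda>k. enn2real (holder_norm_on \<epsilon> {0..1} (fourier_coeff_deriv a k)))"
  have h_fin: "holder_norm_on \<epsilon> {0..1} (fourier_coeff_deriv a k) < \<infinity>" for k
    by (rule term_finite_of_infsum[OF sum_derivs])
  have sup_le: "sup_norm_on {0..1} (fourier_coeff_deriv a k) \<le> holder_norm_on \<epsilon> {0..1} (fourier_coeff_deriv a k)"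
    and semi_le: "holder_seminorm_on \<epsilon> {0..1} (fourier_coeff_deriv a k) \<le> holder_norm_on \<epsilon> {0..1} (fourier_coeff_deriv a k)" for k
    by (simp_all add: holder_norm_on_def)
  have cont_d: "continuous_on {0..1} (fourier_coeff_deriv a k)" for k
    by (rule continuous_on_holder[OF le_less_trans[OF semi_le h_fin] \<open>0 < \<epsilon>\<close>])
  have m_le: "cmod (fourier_coeff_deriv a k x) \<le> m k" if "x \<in> {0..1}" for k x
  proof -
    have "cmod (fourier_coeff_deriv a k x) \<le> enn2real (sup_norm_on {0..1} (fourier_coeff_deriv a k))"
      by (rule norm_le_enn2real_sup_norm[OF le_less_trans[OF sup_le h_fin] that])
    also have "\<dots> \<le> m k"
      unfolding m_def using h_fin by (intro enn2real_mono sup_le) simp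
    finally show ?thesis .
  qed
  have m_sum: "m summable_on UNIV"
    by (rule summable_on_ennreal_majorant[OF sum_derivs]) (use h_fin in \<open>auto simp: m_def less_top\<close>)
  obtain A' where "\<And>k x. cf A' k x = fourier_coeff_deriv a k (clamp 0 1 x)"
    and A': "\<And>k x. x \<in> {0..1} \<Longrightarrow> cf A' k x = fourier_coeff_deriv a k x" and "\<And>k. wn A' k \<le> m k"
    by (rule symbolI[of "fourier_coeff_deriv a" m, OF cont_d _ m_sum]) (erule m_le, blast)
  have xA: "x_deriv A A'"
    unfolding x_deriv_def
  proof (intro allI ballI)
    fix k and x :: real assume x: "x \<in> {0..1}"
    have *: "(fourier_coeff a k has_vector_derivative fourier_coeff_deriv a k x) (at x within {0..1})"
      using diff_coeffs[of k] x unfolding fourier_coeff_deriv_def differentiable_on_def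
      by (simp add: vector_derivative_works)
    show "(cf A k has_vector_derivative cf A' k x) (at x within {0..1})"
      unfolding A'[OF x] by (rule has_vector_derivative_transform[OF x _ *]) (rule A(2))
  qed
  have ev_A: "ev A x t = a x t" if "x \<in> {0..1}" "t \<in> {0..2 * pi}" for x t
    using fourier_series[OF that] ev_has_sum[of A x t] A(2)[OF that(1)] has_sum_unique by fastforce

  obtain L DL L' where L: "t_deriv L DL" "x_deriv L L'"
    "\<And>x t. x \<in> {0..1} \<Longrightarrow> t \<in> {0..2 * pi} \<Longrightarrow> ev L x t = Ln (ev A x t)"
    by (rule log_symbol_exists[OF tA xA]) (simp add: ev_A Re_pos, blast)
  have fourier_log: "fourier_coeff (log_symbol a) k x = cf L k x" if "x \<in> {0..1}" for k x
  proof -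
    have "four (log_symbol a x) k = four (ev L x) k"
      by (rule four_cong) (simp add: log_symbol_def L(3) ev_A that del: atLeastAtMost_iff)
    then show ?thesis
      by (simp add: fourier_coeff_eq_four four_ev)
  qed
  have expL: "cf (exp L) k x = fourier_coeff a k x" if x: "x \<in> {0..1}" for k x
  proof -
    have "ev (exp L) x t = ev A x t" if t: "t \<in> {0..2 * pi}" for t
    proof -
      have "ev A x t \<noteq> 0"
        using Re_pos[OF x t] by (auto simp: ev_A[OF x t])
      then show ?thesis
        by (simp add: ev_exp L(3)[OF x t])
    qed
    then have "four (ev (exp L) x) k = four (ev A x) k"
      by (rule four_cong)
    then show ?thesis
      by (simp add: four_ev A(2)[OF x])
  qed

  \<comment> \<open>The zeroth coefficient goes to \<open>u\<close>, as the locale requires of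
    \<open>v\<close>.\<close>
  define u v ut where "u = restr (\<lambda>k. 0 \<le> k) L" and "v = restr (\<lambda>k. k < 0) L"
    and "ut = restr (\<lambda>k. 0 \<le> k) DL"
  interpret kms_factor u v "restr (\<lambda>k. 0 \<le> k) L'" ut "restr (\<lambda>k. k < 0) L'" "restr (\<lambda>k. k < 0) DL"
    unfolding u_def v_def ut_def
    by unfold_locales (auto intro: t_deriv_restr x_deriv_restr L simp: upper_def lower_def)
  have "u + v = L"
    unfolding u_def v_def by (rule symbol_eqI) simp
  have KMS: "KMS_matrix n a = kms n (exp (u + v))" for n
  proof (rule eq_matI)
    fix i j assume "i < dim_row (kms n (exp (u + v)))" "j < dim_col (kms n (exp (u + v)))"
    then have ij: "i < n + 1" "j < n + 1" by simp_all
    have node: "node n (int i) (int j) = real (i + j) / real (2 * n + 2)"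
      by (simp add: node_def)
    have "node n (int i) (int j) \<in> {0..1}"
      using ij by (intro node_in) auto
    then show "KMS_matrix n a $$ (i, j) = kms n (exp (u + v)) $$ (i, j)"
      using ij unfolding \<open>u + v = L\<close> by (simp add: KMS_matrix_def kms_index expL node)
  qed (simp_all add: KMS_matrix_def)

  let ?l = "cf L 0"
  have e_eq: "e_const a x = ?l x" if "x \<in> {0..1}" for x
    using fourier_log[OF that, of 0] by (simp add: e_const_def fourier_coeff_def)
  have G_eq: "G_const a ^ (n + 1) = exp (of_nat (n + 1) * integral {0..1} ?l)" for n
  proof -
    have "1 / (2 * pi) * integral {0..1} (\<lambda>x. integral {0..2 * pi} (\<lambda>t. log_symbol a x t)) =
        integral {0..1} (e_const a)"
      unfolding e_const_def by simp
    also have "\<dots> = integral {0..1} ?l"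
      by (rule integral_cong) (rule e_eq)
    finally show ?thesis
      unfolding G_const_def exp_of_nat_mult by simp
  qed
  have E_eq: "E_const a x = cf (ut * v) 0 x" if x: "x \<in> {0..1}" for x
  proof -
    let ?f = "\<lambda>k. of_nat (Suc k) * fourier_coeff (log_symbol a) (int (Suc k)) x
      * fourier_coeff (log_symbol a) (- int (Suc k)) x"
    have inj: "inj (\<lambda>k. int (Suc k))"
      by (auto simp: inj_on_def)
    \<comment> \<open>\<open>cf v (- p) x\<close> vanishes for \<open>p <= 0\<close>, so the
      convolution runs over positive \<open>p\<close> only, which is the series of
      \<open>E_const\<close>.\<close>
    have "((\<lambda>p. cf ut p x * cf v (0 - p) x) has_sum cf (ut * v) 0 x) (range (\<lambda>k. int (Suc k)))"
    proof (subst has_sum_cong_neutral[of UNIV _ _ "\<lambda>p. cf ut p x * cf v (0 - p) x"])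
      show "((\<lambda>p. cf ut p x * cf v (0 - p) x) has_sum cf (ut * v) 0 x) UNIV"
        by (rule cf_mult)
      fix p assume "p \<in> UNIV - range (\<lambda>k. int (Suc k))"
      then have "p \<noteq> int (Suc (nat (p - 1)))"
        by blast
      then have "p \<le> 0"
        by linarith
      then show "cf ut p x * cf v (0 - p) x = 0"
        by (auto simp: v_def)
    qed auto
    then have "((\<lambda>k. cf ut (int (Suc k)) x * cf v (- int (Suc k)) x) has_sum cf (ut * v) 0 x) UNIV"
      by (subst (asm) has_sum_reindex[OF inj]) (simp add: o_def)
    moreover have "cf ut (int (Suc k)) x * cf v (- int (Suc k)) x = ?f k" for k
      using t_derivD[OF L(1), of "int (Suc k)" x]
      by (simp add: ut_def v_def fourier_log[OF x])
    ultimately have "?f sums cf (ut * v) 0 x"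
      using has_sum_imp_sums by simp
    then show ?thesis
      unfolding E_const_def by (simp add: sums_iff)
  qed

  have c_eq: "c = (E_const a 0 + E_const a 1) / 2"
    by (simp add: c_def E_eq)
  \<comment> \<open>This factor converts the normalization of \<open>F\<close> by sampled values of
    \<open>cf u 0 = cf L 0\<close> into the one by \<open>G_const a ^ (n + 1)\<close>.\<close>
  have "(\<lambda>n. exp ((\<Sum>i\<in>idx n. ?l (node n i i)) - of_nat (n + 1) * integral {0..1} ?l)) \<longlonglongrightarrow>
      exp ((?l 0 - ?l 1) / 2)"
    by (intro tendsto_exp riemann_sum_tendsto[OF L(2)])
  from tendsto_mult[OF det_kms_exp_tendsto this]
  have "(\<lambda>n. Determinant.det (kms n (exp (u + v))) * (\<Prod>i\<in>idx n. exp (- cf u 0 (node n i i))) *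
      exp ((\<Sum>i\<in>idx n. ?l (node n i i)) - of_nat (n + 1) * integral {0..1} ?l)) \<longlonglongrightarrow>
      exp c * exp ((?l 0 - ?l 1) / 2)" .
  moreover have "Determinant.det (kms n (exp (u + v))) * (\<Prod>i\<in>idx n. exp (- cf u 0 (node n i i))) *
      exp ((\<Sum>i\<in>idx n. ?l (node n i i)) - of_nat (n + 1) * integral {0..1} ?l) =
      Determinant.det (KMS_matrix n a) / G_const a ^ (n + 1)" for n
  proof -
    have "(\<Prod>i\<in>idx n. exp (- cf u 0 (node n i i))) = exp (- (\<Sum>i\<in>idx n. ?l (node n i i)))"
      by (simp add: u_def exp_sum[symmetric] sum_negf)
    then show ?thesis
      unfolding KMS G_eq by (simp add: exp_diff exp_minus field_simps)
  qed
  moreover have "exp c * exp ((?l 0 - ?l 1) / 2) =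
      exp (1 / 2 * (e_const a 0 - e_const a 1 + E_const a 0 + E_const a 1))"
    unfolding exp_add[symmetric] c_eq
    by (simp add: e_eq diff_divide_distrib add_divide_distrib add_ac)
  ultimately show ?thesis
    by simp
qed

end
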